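(* The spectrum of the operator $L_{\mathrm{per}}$ on $L^2(-\pi,\pi)$ is (a) real, and (b) purely discrete, i.e. it consists only of isolated eigenvalues of finite multiplicity with no accumulation points apart from, possibly, infinity.
   Context: Let $0<\epsilon<\pi$ and let $f:\mathbb{R}\to\mathbb{R}$ be a $2\pi$-periodic function such that $f(x+\pi)=-f(x)$ and $f(-x)=-f(x)$ for all $x$, and $f(x)>0$ for $x\in(0,\pi)$ (in particular $f$ vanishes on $\pi\mathbb{Z}$). Assume that $f$ is continuous, and differentiable except possibly at a finite number of points (in a period), the points of non-differentiability excluding $\pi\mathbb{Z}$, and that $f'(0)=2/\pi$. The operator $L_{\mathrm{per}}$ is defined by $$L_{\mathrm{per}}u := i\epsilon\,(f(x)u'(x))' + i u'(x)$$ on the domain $$\mathcal{D}=\{u\in L^2(-\pi,\pi) : L_{\mathrm{per}}u\in L^2(-\pi,\pi),\ u(-\pi)=u(\pi)\}.$$ Here derivatives are taken in the weak sense on $(-\pi,\pi)$. It is known that if $u\in L^2(-\pi,\pi)$ and $L_{\mathrm{per}}u\in L^2(-\pi,\pi)$ then $u\in H^1(-\pi,\pi)$, so the boundary values $u(\pm\pi)$ make sense. *)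

theory Defs
  imports "HOL-Analysis.Analysis"
begin

text \<open>
  Elements of \<open>L\<^sup>2(-\<pi>,\<pi>)\<close> are handled through representatives \<open>real \<Rightarrow> complex\<close>, and equality in
  \<open>L\<^sup>2\<close> is \<open>ae_eq\<close>. Values outside \<open>(-\<pi>,\<pi>)\<close> are irrelevant.
\<close>

abbreviation per_interval :: "real set" where
  "per_interval \<equiv> {-pi<..<pi}"

abbreviation per_measure :: "real measure" where
  "per_measure \<equiv> lebesgue_on per_interval"

definition ae_eq :: "(real \<Rightarrow> complex) \<Rightarrow> (real \<Rightarrow> complex) \<Rightarrow> bool" where
  "ae_eq u v \<longleftrightarrow> (AE x in per_measure. u x = v x)"

definition L2 :: "(real \<Rightarrow> complex) set" where
  "L2 = {u \<in> borel_measurable per_measure. integrable per_measure (\<lambda>x. (cmod (u x))\<^sup>2)}"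

definition norm_L2 :: "(real \<Rightarrow> complex) \<Rightarrow> real" where
  "norm_L2 u = sqrt (LINT x|per_measure. (cmod (u x))\<^sup>2)"

subsection \<open>Weak derivatives on \<open>(-\<pi>,\<pi>)\<close>\<close>

definition test_function :: "(real \<Rightarrow> real) \<Rightarrow> bool" where
  "test_function \<phi> \<longleftrightarrow>
     (\<forall>n. (deriv ^^ n) \<phi> differentiable_on UNIV) \<and>
     (\<exists>K. compact K \<and> K \<subseteq> per_interval \<and> (\<forall>x. x \<notin> K \<longrightarrow> \<phi> x = 0))"

definition loc_integrable :: "(real \<Rightarrow> complex) \<Rightarrow> bool" where
  "loc_integrable u \<longleftrightarrow>
     (\<forall>K. compact K \<and> K \<subseteq> per_interval \<longrightarrow> u absolutely_integrable_on K)"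

text \<open>Real-valued test functions suffice, since the identity is linear in \<open>\<phi>\<close>.\<close>

definition weak_deriv :: "(real \<Rightarrow> complex) \<Rightarrow> (real \<Rightarrow> complex) \<Rightarrow> bool" where
  "weak_deriv u v \<longleftrightarrow> loc_integrable u \<and> loc_integrable v \<and>
     (\<forall>\<phi>. test_function \<phi> \<longrightarrow>
        (LINT x|per_measure. u x * of_real (deriv \<phi> x)) =
        - (LINT x|per_measure. v x * of_real (\<phi> x)))"

subsection \<open>The operator \<open>L_per\<close>\<close>

text \<open>
  \<open>L_expr \<epsilon> f u w\<close>: the differential expression \<open>\<i>\<epsilon>(f u')' + \<i> u'\<close> is defined in the weak sense and
  is represented by \<open>w\<close>. Asking for \<open>(f u')'\<close> itself to be a locally integrable function is no
  restriction: it equals \<open>(w - \<i> u') / (\<i>\<epsilon>)\<close> as soon as \<open>w\<close> and \<open>u'\<close> are locally integrable.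
\<close>

definition L_expr ::
    "real \<Rightarrow> (real \<Rightarrow> real) \<Rightarrow> (real \<Rightarrow> complex) \<Rightarrow> (real \<Rightarrow> complex) \<Rightarrow> bool" where
  "L_expr \<epsilon> f u w \<longleftrightarrow>
     (\<exists>u' q. weak_deriv u u' \<and> weak_deriv (\<lambda>x. of_real (f x) * u' x) q \<and>
        ae_eq w (\<lambda>x. \<i> * of_real \<epsilon> * q x + \<i> * u' x))"

text \<open>\<open>u(-\<pi>) = u(\<pi>)\<close>, read off from the representative of \<open>u\<close> that is continuous up to the
  boundary.\<close>

definition periodic_bc :: "(real \<Rightarrow> complex) \<Rightarrow> bool" where
  "periodic_bc u \<longleftrightarrow>
     (\<exists>U. continuous_on {-pi..pi} U \<and> ae_eq u U \<and> U (-pi) = U pi)"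

definition L_per_dom :: "real \<Rightarrow> (real \<Rightarrow> real) \<Rightarrow> (real \<Rightarrow> complex) set" where
  "L_per_dom \<epsilon> f = {u \<in> L2. (\<exists>w\<in>L2. L_expr \<epsilon> f u w) \<and> periodic_bc u}"

text \<open>The operator is given by its graph, which is closed under a.e. changes of
  representatives in both components.\<close>

definition L_per ::
    "real \<Rightarrow> (real \<Rightarrow> real) \<Rightarrow> ((real \<Rightarrow> complex) \<times> (real \<Rightarrow> complex)) set" where
  "L_per \<epsilon> f = {(u, w). u \<in> L_per_dom \<epsilon> f \<and> w \<in> L2 \<and> L_expr \<epsilon> f u w}"

subsection \<open>Spectral notions for operators on \<open>L\<^sup>2(-\<pi>,\<pi>)\<close> given by graphs\<close>

text \<open>The graph of \<open>T - z\<close>.\<close>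

definition op_minus ::
    "((real \<Rightarrow> complex) \<times> (real \<Rightarrow> complex)) set \<Rightarrow> complex \<Rightarrow>
     ((real \<Rightarrow> complex) \<times> (real \<Rightarrow> complex)) set" where
  "op_minus T z = {(u, \<lambda>x. w x - z * u x) | u w. (u, w) \<in> T}"

text \<open>\<open>T - z\<close> maps its domain bijectively onto \<open>L\<^sup>2\<close>, with bounded inverse.\<close>

definition resolvent_set :: "((real \<Rightarrow> complex) \<times> (real \<Rightarrow> complex)) set \<Rightarrow> complex set" where
  "resolvent_set T = {z.
     (\<forall>w\<in>L2. \<exists>u. (u, w) \<in> op_minus T z) \<and>
     (\<forall>u v w. (u, w) \<in> op_minus T z \<and> (v, w) \<in> op_minus T z \<longrightarrow> ae_eq u v) \<and>
     (\<exists>C. \<forall>u w. (u, w) \<in> op_minus T z \<longrightarrow> norm_L2 u \<le> C * norm_L2 w)}"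

definition spectrum_of :: "((real \<Rightarrow> complex) \<times> (real \<Rightarrow> complex)) set \<Rightarrow> complex set" where
  "spectrum_of T = - resolvent_set T"

definition is_eigenvalue :: "((real \<Rightarrow> complex) \<times> (real \<Rightarrow> complex)) set \<Rightarrow> complex \<Rightarrow> bool" where
  "is_eigenvalue T z \<longleftrightarrow> (\<exists>u. (u, \<lambda>x. 0) \<in> op_minus T z \<and> \<not> ae_eq u (\<lambda>x. 0))"

text \<open>The union of the kernels of \<open>(T - z)\<^sup>k\<close>; it contains the eigenspace (\<open>k = 1\<close>).\<close>

definition root_space ::
    "((real \<Rightarrow> complex) \<times> (real \<Rightarrow> complex)) set \<Rightarrow> complex \<Rightarrow> (real \<Rightarrow> complex) set" where
  "root_space T z = {u. \<exists>k. (u, \<lambda>x. 0) \<in> op_minus T z ^^ k}"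

definition finite_dim_ae :: "(real \<Rightarrow> complex) set \<Rightarrow> bool" where
  "finite_dim_ae V \<longleftrightarrow>
     (\<exists>B. finite B \<and> B \<subseteq> V \<and> (\<forall>u\<in>V. \<exists>c. ae_eq u (\<lambda>x. \<Sum>b\<in>B. c b * b x)))"

text \<open>Multiplicity is algebraic multiplicity, so its finiteness includes that of the geometric
  one. As \<open>islimpt\<close> is taken in the finite complex plane, infinity remains permitted as an
  accumulation point.\<close>

definition purely_discrete_spectrum ::
    "((real \<Rightarrow> complex) \<times> (real \<Rightarrow> complex)) set \<Rightarrow> bool" where
  "purely_discrete_spectrum T \<longleftrightarrow>
     (\<forall>z\<in>spectrum_of T.
        z isolated_in spectrum_of T \<and> is_eigenvalue T z \<and> finite_dim_ae (root_space T z)) \<and>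
     (\<forall>z. \<not> z islimpt spectrum_of T)"

end

theory Submission
  imports Defs "HOL-Complex_Analysis.Complex_Analysis" "HOL-Computational_Algebra.Polynomial"
begin

text \<open>
  With an integrating factor \<open>wt\<close>, \<open>wt' = wt / (\<epsilon> f)\<close> on \<open>(0,\<pi>)\<close>, the equation \<open>L u = w\<close> becomes
  \<open>(wt f u')' = - \<i> wt w / \<epsilon>\<close>. Local integrability of \<open>u'\<close> forces \<open>f u'\<close> to vanish at \<open>0\<close>, so on
  each half of the interval \<open>u = u(0) + K(- \<i> w)\<close> for a Volterra operator \<open>K\<close>, the left half being
  reflected to \<open>(0,\<pi>)\<close> with \<open>w(x)\<close> replaced by \<open>- w(- x)\<close>. Let \<open>\<phi>\<^sub>z\<close> solve \<open>\<phi>\<^sub>z = 1 + z K \<phi>\<^sub>z\<close>. Then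
  \<open>L - \<lambda>\<close> is boundedly invertible unless \<open>\<Delta>(\<lambda>) = \<phi>\<^sub>z(\<pi>) - \<phi>\<^sub>-\<^sub>z(\<pi>)\<close> vanishes at \<open>z = - \<i> \<lambda>\<close>, and
  \<open>\<Delta>\<close> is entire.

  Reality: the quadratic quantities \<open>|\<phi>\<^sub>z|\<^sup>2\<close>, \<open>Re\<close> and \<open>Im\<close> of the conjugate of \<open>\<phi>\<^sub>z\<close> times its flux,
  and the squared modulus of the flux satisfy a linear system which is cooperative for \<open>Re z > 0\<close>;
  comparing the systems for \<open>z\<close> and \<open>- z\<close> gives \<open>|\<phi>\<^sub>-\<^sub>z(\<pi>)| < |\<phi>\<^sub>z(\<pi>)|\<close>. The derivative of this
  comparison on the imaginary axis shows that the zeros of \<open>\<Delta>\<close> are simple, hence that root spaces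
  are one-dimensional.
\<close>

text \<open>Formally, \<i>\<epsilon>(f u')' is skew-symmetric and \<i> u' is symmetric, so the
  reality of the spectrum does not come from self-adjointness. It has to be read off from the
  solutions. Since f has slope 2/pi at 0, \<open>wt\<close> is roughly x^(pi/(2\<epsilon>)) near 0
  and roughly (pi - x)^(-pi/(2\<epsilon>)) near pi, and \<open>wt\<close> times an L2 function need
  not be integrable up to pi. The obstacle is to show that u' is integrable there all the same. For
  this the integral of \<open>wt\<close> |w| over (0,y) is compared with \<open>wt y\<close>, which
  bounds u' by a multiple of 1 / sqrt (y (pi - y)). So K maps L2 into the continuous functions on
  the closed half interval, and solutions have values at pi. With z = - \<i> \<lambda> the real part
  of z is the imaginary part of \<lambda>. Because f is odd, the left half sees - z where the right
  half sees z. A non-real \<lambda> therefore gives two solutions of different modulus at the end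
  points, which cannot be matched periodically.\<close>

section \<open>Primitives of integrable functions\<close>

text \<open>Local absolute continuity with density \<open>v\<close>, expressed through increments.
  The set \<open>S\<close> may then be open or half open, and \<open>v\<close> need not be
  integrable up to a missing end point.\<close>

definition primitive_on :: "real set \<Rightarrow> (real \<Rightarrow> complex) \<Rightarrow> (real \<Rightarrow> complex) \<Rightarrow> bool" where
  "primitive_on S U v \<longleftrightarrow> (\<forall>a\<in>S. \<forall>b\<in>S. a \<le> b \<longrightarrow>
     v absolutely_integrable_on {a..b} \<and> U b - U a = integral {a..b} v)"

lemma primitive_onD:
  assumes "primitive_on S U v" "a \<in> S" "b \<in> S" "a \<le> b"
  shows "v absolutely_integrable_on {a..b}" "v integrable_on {a..b}" "U b - U a = integral {a..b} v"
  using assms set_lebesgue_integral_eq_integral(1) unfolding primitive_on_def by blast+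

lemma primitive_on_subset: "primitive_on S U v \<Longrightarrow> T \<subseteq> S \<Longrightarrow> primitive_on T U v"
  unfolding primitive_on_def by blast

lemma primitive_on_spike:
  assumes "primitive_on S U v" "negligible N" "is_interval S"
    and "\<And>x. x \<in> S - N \<Longrightarrow> v x = v' x"
  shows "primitive_on S U v'"
  unfolding primitive_on_def
proof (intro ballI impI)
  fix a b assume ab: "a \<in> S" "b \<in> S" "a \<le> b"
  then have "{a..b} \<subseteq> S"
    using assms(3) unfolding is_interval_1 by fastforce
  then have *: "\<And>x. x \<in> {a..b} - N \<Longrightarrow> v' x = v x" using assms(4) by fastforce
  have "v' absolutely_integrable_on {a..b}"
    using absolutely_integrable_spike[OF primitive_onD(1)[OF assms(1) ab] assms(2) *] .
  moreover have "integral {a..b} v' = integral {a..b} v"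
    using integral_spike[OF assms(2), of "{a..b}" v v'] * by metis
  ultimately show "v' absolutely_integrable_on {a..b} \<and> U b - U a = integral {a..b} v'"
    using primitive_onD(3)[OF assms(1) ab] by simp
qed

lemma primitive_on_continuous:
  assumes U: "primitive_on {a..b} U v"
  shows "continuous_on {a..b} U"
proof (cases "a \<le> b")
  case True
  have "continuous_on {a..b} (\<lambda>x. U a + integral {a..x} v)"
    using True U by (intro continuous_intros indefinite_integral_continuous_1 primitive_onD(2)) auto
  moreover have "U a + integral {a..x} v = U x" if "x \<in> {a..b}" for x
    using primitive_onD(3)[OF U, of a x] that by (auto simp: algebra_simps)
  ultimately show ?thesis by (rule continuous_on_eq)
qed simp

lemma absolutely_integrable_continuous_mult:
  fixes g :: "real \<Rightarrow> complex"
  assumes "continuous_on {a..b} h" "g absolutely_integrable_on {a..b}"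
  shows "(\<lambda>x. h x * g x) absolutely_integrable_on {a..b}"
proof (rule absolutely_integrable_bounded_measurable_product[OF bilinear_times])
  show "h \<in> borel_measurable (lebesgue_on {a..b})"
    using assms(1) by (intro continuous_imp_measurable_on_sets_lebesgue) auto
  show "bounded (h ` {a..b})"
    using assms(1) by (intro compact_imp_bounded compact_continuous_image) auto
qed (use assms in auto)

text \<open>The difference of the two sides, as a function of the right end point, has increments
  that are small compared to those of a fixed increasing function, hence is constant.\<close>

lemma primitive_on_mult:
  fixes p p' :: "real \<Rightarrow> real"
  assumes V: "primitive_on S V q" and S: "is_interval S"
    and p: "\<And>x. x \<in> S \<Longrightarrow> (p has_real_derivative p' x) (at x within S)"
    and p': "continuous_on S p'"
  shows "primitive_on S (\<lambda>x. of_real (p x) * V x) (\<lambda>x. of_real (p x) * q x + of_real (p' x) * V x)"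
  unfolding primitive_on_def
proof (intro ballI impI)
  fix a b assume ab: "a \<in> S" "b \<in> S" "a \<le> b"
  then have sub: "{a..b} \<subseteq> S"
    using S unfolding is_interval_1 by fastforce
  have Vab: "primitive_on {a..b} V q" using V sub by (rule primitive_on_subset)
  have cV: "continuous_on {a..b} V" using Vab by (rule primitive_on_continuous)
  have cp': "continuous_on {a..b} p'" using p' sub by (rule continuous_on_subset)
  have pd: "(p has_real_derivative p' x) (at x within {a..b})" if "x \<in> {a..b}" for x
    using p[of x] that sub by (meson DERIV_subset subsetD)
  have cp: "continuous_on {a..b} p"
    using pd by (meson DERIV_continuous continuous_on_eq_continuous_within)
  have iq: "q absolutely_integrable_on {a..b}" using V ab by (rule primitive_onD)
  define h where "h x = of_real (p x) * q x + of_real (p' x) * V x" for x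
  have ih: "h absolutely_integrable_on {a..b}"
    unfolding h_def
  proof (rule set_integral_add(1))
    show "(\<lambda>x. of_real (p x) * q x) absolutely_integrable_on {a..b}"
      using cp iq by (intro absolutely_integrable_continuous_mult continuous_intros)
    show "(\<lambda>x. of_real (p' x) * V x) absolutely_integrable_on {a..b}"
      using cp' cV by (intro absolutely_integrable_continuous_real continuous_intros)
  qed
  define E where "E x = of_real (p x) * V x - integral {a..x} h" for x
  define m where "m x = norm (q x) + \<bar>p' x\<bar>" for x
  have im: "m integrable_on {a..b}"
    unfolding m_def
  proof (rule integrable_add)
    show "(\<lambda>x. norm (q x)) integrable_on {a..b}"
      using iq by (simp add: absolutely_integrable_on_def)
    show "(\<lambda>x. \<bar>p' x\<bar>) integrable_on {a..b}"
      by (intro integrable_continuous_real continuous_on_rabs cp')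
  qed
  define M where "M x = integral {a..x} m" for x
  have sub_im: "m integrable_on {x..y}" and sub_ih: "h integrable_on {x..y}"
    if "a \<le> x" "y \<le> b" for x y
    using im ih that integrable_on_subinterval[of _ "{a..b}" x y] by (auto simp: absolutely_integrable_on_def)
  have Mdiff: "M y - M x = integral {x..y} m" if "a \<le> x" "x \<le> y" "y \<le> b" for x y
    using Henstock_Kurzweil_Integration.integral_combine[of a x y m] that sub_im[of a y] unfolding M_def by (simp add: algebra_simps)
  have hdiff: "integral {a..y} h - integral {a..x} h = integral {x..y} h" if "a \<le> x" "x \<le> y" "y \<le> b" for x y
    using Henstock_Kurzweil_Integration.integral_combine[of a x y h] that sub_ih[of a y] by (simp add: algebra_simps)
  have bound: "norm (E b - E a) \<le> \<eta> * (M b - M a)" if \<eta>: "\<eta> > 0" for \<eta>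
  proof -
    have "uniformly_continuous_on {a..b} p" "uniformly_continuous_on {a..b} V"
      using cp cV by (auto intro: compact_uniformly_continuous)
    note uc = this[unfolded uniformly_continuous_on_def, rule_format, OF \<eta>]
    obtain d1 where d1p: "d1 > 0"
      and d1: "\<And>x y. x \<in> {a..b} \<Longrightarrow> y \<in> {a..b} \<Longrightarrow> dist y x < d1 \<Longrightarrow> dist (p y) (p x) < \<eta>"
      using uc(1) by blast
    obtain d2 where d2p: "d2 > 0"
      and d2: "\<And>x y. x \<in> {a..b} \<Longrightarrow> y \<in> {a..b} \<Longrightarrow> dist y x < d2 \<Longrightarrow> dist (V y) (V x) < \<eta>"
      using uc(2) by blast
    define P where "P x y \<longleftrightarrow> (a \<le> x \<longrightarrow> x \<le> y \<longrightarrow> y \<le> b \<longrightarrow> norm (E y - E x) \<le> \<eta> * (M y - M x))" for x y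
    \<comment> \<open>Bisection: the bound is additive over adjacent intervals and holds on all
      sufficiently short ones, so it holds on the whole interval.\<close>
    have "P a b" using ab(3)
    proof (induction rule: Bolzano)
      case (trans x y z)
      show ?case unfolding P_def
      proof (intro impI)
        assume H: "a \<le> x" "x \<le> z" "z \<le> b"
        have "norm (E z - E x) \<le> norm (E z - E y) + norm (E y - E x)"
          using norm_triangle_ineq[of "E z - E y" "E y - E x"] by simp
        also have "\<dots> \<le> \<eta> * (M z - M y) + \<eta> * (M y - M x)"
          using trans H unfolding P_def by (intro add_mono) auto
        finally show "norm (E z - E x) \<le> \<eta> * (M z - M x)" by (simp add: algebra_simps)
      qed
    next
      case (local x0)
      have "P x y" if "y - x < min d1 d2" for x y
        unfolding P_def
      proof (intro impI)
        assume H: "a \<le> x" "x \<le> y" "y \<le> b"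
        have mem: "x \<in> {a..b}" "y \<in> {a..b}" using H by auto
        have xyab: "{x..y} \<subseteq> {a..b}" using H by auto
        have iqxy: "q integrable_on {x..y}" and Vxy: "V y - V x = integral {x..y} q"
          using primitive_onD[OF Vab mem] H by auto
        have ip: "(p' has_integral (p y - p x)) {x..y}"
        proof (rule fundamental_theorem_of_calculus)
          show "(p has_vector_derivative p' r) (at r within {x..y})" if "r \<in> {x..y}" for r
            unfolding has_real_derivative_iff_has_vector_derivative[symmetric]
            by (rule DERIV_subset[OF pd xyab]) (use that xyab in blast)
        qed (rule H)
        have ip': "((\<lambda>r. of_real (p' r)) has_integral (of_real (p y) - of_real (p x) :: complex)) {x..y}"
          using has_integral_of_real[OF ip] by simp
        \<comment> \<open>With \<open>p\<close> frozen at the right end and \<open>V\<close> at the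
          left end, the integral is exact: p(y) (V(y) - V(x)) + V(x) (p(y) - p(x)) telescopes to the
          increment of p V. What remains to be estimated is the effect of freezing.\<close>
        have "((\<lambda>r. of_real (p y) * q r + V x * of_real (p' r) - h r) has_integral
            of_real (p y) * (V y - V x) + V x * (of_real (p y) - of_real (p x)) - integral {x..y} h) {x..y}"
          unfolding Vxy
          by (intro has_integral_diff has_integral_add has_integral_mult_right ip' integrable_integral iqxy)
            (use H sub_ih in auto)
        also have "of_real (p y) * (V y - V x) + V x * (of_real (p y) - of_real (p x)) - integral {x..y} h
            = E y - E x"
          unfolding E_def hdiff[OF H, symmetric] by (simp add: algebra_simps)
        finally have I: "((\<lambda>r. of_real (p y) * q r + V x * of_real (p' r) - h r) has_integral (E y - E x)) {x..y}" .
        have mi: "(\<lambda>r. \<eta> * m r) integrable_on {x..y}"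
          using sub_im[of x y] H by (intro integrable_on_mult_right) auto
        have "norm (E y - E x) \<le> integral {x..y} (\<lambda>r. \<eta> * m r)"
          unfolding integral_unique[OF I, symmetric]
        proof (rule integral_norm_bound_integral)
          show "(\<lambda>r. of_real (p y) * q r + V x * of_real (p' r) - h r) integrable_on {x..y}"
            using I by blast
          show "(\<lambda>r. \<eta> * m r) integrable_on {x..y}" by (rule mi)
          fix r assume r: "r \<in> {x..y}"
          have rm: "r \<in> {a..b}" using r H by auto
          have "of_real (p y) * q r + V x * of_real (p' r) - h r
              = of_real (p y - p r) * q r + of_real (p' r) * (V x - V r)"
            unfolding h_def by (simp add: algebra_simps)
          also have "norm \<dots> \<le> \<bar>p y - p r\<bar> * norm (q r) + \<bar>p' r\<bar> * norm (V x - V r)"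
            by (rule order_trans[OF norm_triangle_ineq]) (simp add: norm_mult del: of_real_diff)
          also have "\<dots> \<le> \<eta> * norm (q r) + \<bar>p' r\<bar> * \<eta>"
          proof (intro add_mono mult_right_mono mult_left_mono)
            show "\<bar>p y - p r\<bar> \<le> \<eta>"
              using d1[OF rm mem(2)] r that by (auto simp: dist_real_def)
            show "norm (V x - V r) \<le> \<eta>"
              using d2[OF rm mem(1)] r that by (auto simp: dist_norm)
          qed auto
          finally show "norm (of_real (p y) * q r + V x * of_real (p' r) - h r) \<le> \<eta> * m r"
            unfolding m_def by (simp add: algebra_simps)
        qed
        also have "\<dots> = \<eta> * (M y - M x)" using Mdiff[OF H] by simp
        finally show "norm (E y - E x) \<le> \<eta> * (M y - M x)" .
      qed
      moreover have "min d1 d2 > 0" using d1p d2p by simp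
      ultimately show ?case by blast
    qed
    then show ?thesis unfolding P_def using ab(3) by auto
  qed
  have "E b = E a"
  proof (rule ccontr)
    assume "E b \<noteq> E a"
    then have pos: "norm (E b - E a) > 0" by simp
    define K where "K = \<bar>M b - M a\<bar> + 1"
    have K: "K > 0" "M b - M a \<le> K" unfolding K_def by (auto intro: add_nonneg_pos)
    have "norm (E b - E a) \<le> norm (E b - E a) / (2 * K) * (M b - M a)"
      by (intro bound divide_pos_pos pos mult_pos_pos K) simp
    also have "\<dots> \<le> norm (E b - E a) / (2 * K) * K"
      using K by (intro mult_left_mono) auto
    also have "\<dots> = norm (E b - E a) / 2" using K by (simp add: field_simps)
    finally show False using pos by linarith
  qed
  then show "h absolutely_integrable_on {a..b} \<and>
    of_real (p b) * V b - of_real (p a) * V a = integral {a..b} h"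
    using ih unfolding E_def by (simp add: algebra_simps)
qed

text \<open>Henstock's lemma makes the sum of |mu(k) h(x) - integral of h over k| small on fine
  divisions. As all these integrals vanish, the sum is a Riemann sum of |h|, so |h| has integral
  0.\<close>

lemma negligible_if_integrals_0:
  fixes h :: "real \<Rightarrow> complex"
  assumes h: "h absolutely_integrable_on {a..b}"
    and zero: "\<And>c d. a \<le> c \<Longrightarrow> c \<le> d \<Longrightarrow> d \<le> b \<Longrightarrow> integral {c..d} h = 0"
  shows "negligible {x \<in> {a..b}. h x \<noteq> 0}"
proof -
  have hi: "h integrable_on cbox a b"
    using h by (auto simp: absolutely_integrable_on_def)
  have hi0: "((\<lambda>x. norm (h x)) has_integral 0) (cbox a b)"
    unfolding has_integral
  proof (intro allI impI)
    fix e :: real assume "e > 0"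
    then obtain \<gamma> where \<gamma>: "gauge \<gamma>"
      and less: "\<And>p. \<lbrakk>p tagged_partial_division_of (cbox a b); \<gamma> fine p\<rbrakk> \<Longrightarrow>
             sum (\<lambda>(x,k). norm(measure lborel k *\<^sub>R h x - integral k h)) p < e"
      using Henstock_lemma[OF hi] by blast
    have "norm ((\<Sum>(x, k)\<in>p. measure lborel k *\<^sub>R norm (h x)) - 0) < e"
      if p: "p tagged_division_of cbox a b" "\<gamma> fine p" for p
    proof -
      have "(\<Sum>(x, k)\<in>p. measure lborel k *\<^sub>R norm (h x)) = sum (\<lambda>(x,k). norm(measure lborel k *\<^sub>R h x - integral k h)) p"
      proof (rule sum.cong)
        fix z assume z: "z \<in> p"
        obtain x k where xk: "z = (x, k)" by (cases z)
        have xkp: "(x, k) \<in> p" using z xk by simp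
        obtain c d where k: "k = cbox c d"
          using tagged_division_ofD(4)[OF p(1) xkp] by blast
        have "cbox c d \<subseteq> cbox a b" "x \<in> cbox c d"
          using tagged_division_ofD(2,3)[OF p(1) xkp] k by blast+
        then have "integral k h = 0" unfolding k using zero[of c d] by fastforce
        then show "(case z of (x, k) \<Rightarrow> measure lborel k *\<^sub>R norm (h x)) =
          (case z of (x, k) \<Rightarrow> norm (measure lborel k *\<^sub>R h x - integral k h))"
          unfolding xk by simp
      qed auto
      also have "\<dots> < e"
        using less[of p] p by (simp add: tagged_division_of_def)
      finally have "(\<Sum>(x, k)\<in>p. measure lborel k *\<^sub>R norm (h x)) < e" .
      moreover have "(\<Sum>(x, k)\<in>p. measure lborel k *\<^sub>R norm (h x)) \<ge> 0"
        by (rule sum_nonneg) (simp add: split_beta)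
      ultimately show ?thesis by simp
    qed
    then show "\<exists>\<gamma>. gauge \<gamma> \<and> (\<forall>p. p tagged_division_of cbox a b \<and> \<gamma> fine p \<longrightarrow>
        norm ((\<Sum>(x, k)\<in>p. measure lborel k *\<^sub>R norm (h x)) - 0) < e)"
      using \<gamma> by blast
  qed
  have "integral {a..b} (\<lambda>x. norm (h x)) = 0"
    using integral_unique[OF hi0] by simp
  moreover have i: "integrable (lebesgue_on {a..b}) (\<lambda>x. norm (h x))"
    by (rule integrable_norm, rule absolutely_integrable_imp_integrable[OF h]) simp
  ultimately have "integral\<^sup>L (lebesgue_on {a..b}) (\<lambda>x. norm (h x)) = 0"
    using lebesgue_integral_eq_integral[OF i] by simp
  then have "AE x in lebesgue_on {a..b}. norm (h x) = 0"
    using integral_nonneg_eq_0_iff_AE[OF i] by simp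
  then have "AE x in lebesgue. x \<in> {a..b} \<longrightarrow> h x = 0"
    by (simp add: AE_restrict_space_iff)
  then obtain N where N: "negligible N" "{x. \<not> (x \<in> {a..b} \<longrightarrow> h x = 0)} \<subseteq> N"
    unfolding eventually_ae_filter_negligible by blast
  show ?thesis
    by (rule negligible_subset[OF N(1)]) (use N(2) in blast)
qed

section \<open>Bump functions\<close>

lemma ae_eq_iff_negligible: "ae_eq u v \<longleftrightarrow> negligible {x \<in> per_interval. u x \<noteq> v x}"
proof -
  have "ae_eq u v \<longleftrightarrow> (AE x in lebesgue. x \<in> per_interval \<longrightarrow> u x = v x)"
    unfolding ae_eq_def by (simp add: AE_restrict_space_iff)
  also have "\<dots> \<longleftrightarrow> (\<exists>N. negligible N \<and> {x \<in> per_interval. u x \<noteq> v x} \<subseteq> N)"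
    unfolding eventually_ae_filter_negligible by (simp add: set_eq_iff subset_eq)
  also have "\<dots> \<longleftrightarrow> negligible {x \<in> per_interval. u x \<noteq> v x}"
    using negligible_subset by blast
  finally show ?thesis .
qed

text \<open>The polynomial and the exponent \<open>k\<close> make the family closed under
  differentiation; the standard bump has \<open>P = 1\<close> and \<open>k = 0\<close>.\<close>

definition bump :: "real poly \<Rightarrow> nat \<Rightarrow> real \<Rightarrow> real \<Rightarrow> real \<Rightarrow> real \<Rightarrow> real" where
  "bump P k a b c x =
     (if a < x \<and> x < b
      then poly P x / ((x - a) * (b - x)) ^ k * exp (- c / ((x - a) * (b - x))) else 0)"

lemma power_le_fact_exp:
  fixes t :: real
  assumes "t \<ge> 0"
  shows "t ^ n \<le> fact n * exp t"
proof -
  have "t ^ n /\<^sub>R fact n \<le> exp t"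
    using sum_le_suminf[OF sums_summable[OF exp_converges[of t]], of "{n}"] assms
    by (simp add: exp_def)
  then have "t ^ n / fact n \<le> exp t" by (simp add: divide_inverse mult.commute)
  then show ?thesis by (simp add: pos_divide_le_eq mult.commute)
qed

text \<open>The exponential beats every power of w = (y - a) (b - y), and w is at most (b - a) |y -
  x| when x lies outside the interval. A quadratic bound suffices for derivative 0 at such x, the
  end points included.\<close>

lemma bump_quadratic_bound:
  assumes "c > 0"
  obtains C where "C \<ge> 0" "\<And>x y. \<not> (a < x \<and> x < b) \<Longrightarrow> \<bar>bump P k a b c y\<bar> \<le> C * (y - x)\<^sup>2"
proof -
  have "bounded (poly P ` {a..b})"
    by (intro compact_imp_bounded compact_continuous_image) (auto intro: continuous_intros)
  then obtain M where M: "M > 0" "\<And>y. y \<in> {a..b} \<Longrightarrow> \<bar>poly P y\<bar> \<le> M"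
    unfolding bounded_pos by (auto simp: image_iff)
  define C where "C = M * (fact (k + 2) / c ^ (k + 2)) * (b - a)\<^sup>2"
  have C0: "C \<ge> 0" unfolding C_def using M assms by simp
  moreover have "\<bar>bump P k a b c y\<bar> \<le> C * (y - x)\<^sup>2" if x: "\<not> (a < x \<and> x < b)" for x y
  proof (cases "a < y \<and> y < b")
    case True
    define w where "w = (y - a) * (b - y)"
    have w: "w > 0" unfolding w_def using True by simp
    have "w \<le> (b - a) * \<bar>y - x\<bar>"
    proof (cases "x \<le> a")
      case True
      then have "w \<le> \<bar>y - x\<bar> * (b - a)" unfolding w_def using \<open>a < y \<and> y < b\<close>
        by (intro mult_mono) auto
      then show ?thesis by (simp add: mult.commute)
    next
      case False
      then show ?thesis unfolding w_def using \<open>a < y \<and> y < b\<close> x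
        by (intro mult_mono) auto
    qed
    then have w2: "w\<^sup>2 \<le> (b - a)\<^sup>2 * (y - x)\<^sup>2"
      using w power_mono[of w "(b - a) * \<bar>y - x\<bar>" 2] by (simp add: power_mult_distrib)
    \<comment> \<open>Of the power k + 2, the part k cancels the denominator of the bump and the
      part 2 yields the quadratic bound.\<close>
    have "exp (- c / w) \<le> fact (k + 2) * (w / c) ^ (k + 2)"
      using power_le_fact_exp[of "c / w" "k + 2"] w assms
      by (simp add: exp_minus field_simps del: power_Suc fact_Suc)
    then have "\<bar>poly P y\<bar> / w ^ k * exp (- c / w) \<le> M / w ^ k * (fact (k + 2) * (w / c) ^ (k + 2))"
      using w M(2)[of y] True assms by (intro mult_mono divide_right_mono) auto
    also have "\<dots> = M * (fact (k + 2) / c ^ (k + 2)) * w\<^sup>2"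
      using w assms by (simp add: field_simps power_add power2_eq_square del: fact_Suc)
    also have "\<dots> \<le> M * (fact (k + 2) / c ^ (k + 2)) * ((b - a)\<^sup>2 * (y - x)\<^sup>2)"
      using M assms w2 by (intro mult_left_mono) auto
    finally have "\<bar>poly P y\<bar> / w ^ k * exp (- c / w) \<le> C * (y - x)\<^sup>2"
      unfolding C_def by (simp only: mult.assoc)
    moreover have "\<bar>bump P k a b c y\<bar> = \<bar>poly P y\<bar> / w ^ k * exp (- c / w)"
      using True w unfolding bump_def w_def[symmetric] by (simp add: abs_mult)
    ultimately show ?thesis by simp
  next
    case False
    then have "bump P k a b c y = 0" by (auto simp: bump_def)
    then show ?thesis using C0 by simp
  qed
  ultimately show ?thesis by (rule that)
qed

text \<open>Inside the interval this is the product rule brought to the common denominator W^(k +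
  2). Outside, the quadratic bound forces the difference quotient to 0.\<close>

lemma has_real_derivative_bump:
  fixes a b c :: real
  assumes c: "c > 0"
  defines "W \<equiv> [:-a, 1:] * [:b, -1:]"
  shows "(bump P k a b c has_real_derivative
    bump (pderiv P * W\<^sup>2 - of_nat k * P * pderiv W * W + smult c (P * pderiv W)) (k + 2) a b c x) (at x)"
    (is "(_ has_real_derivative ?D) _")
proof (cases "a < x \<and> x < b")
  case True
  have W: "poly W y = (y - a) * (b - y)" for y unfolding W_def by (simp add: algebra_simps)
  have w: "poly W x > 0" unfolding W using True by simp
  define v where "v y = inverse (poly W y)" for y
  have vk: "z * v y ^ j * exp (- c * v y) = z / ((y - a) * (b - y)) ^ j * exp (- c / ((y - a) * (b - y)))" for y z j
    unfolding v_def W inverse_eq_divide power_one_over by simp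
  define e where "e = exp (- c * v x)"
  have vw: "v x * poly W x = 1" using w unfolding v_def by simp
  have dv: "(v has_real_derivative - (poly (pderiv W) x * (v x)\<^sup>2)) (at x)"
    using DERIV_inverse_fun[OF poly_DERIV[of W x]] w
    unfolding v_def by (simp add: power2_eq_square mult.assoc)
  have "((\<lambda>y. poly P y * v y ^ k) has_real_derivative
     poly (pderiv P) x * v x ^ k + of_nat k * - (poly (pderiv W) x * (v x)\<^sup>2) * v x ^ (k - 1) * poly P x) (at x)"
    using DERIV_mult[OF poly_DERIV[of P x] DERIV_power[OF dv, of k]] by (simp add: mult_ac)
  moreover have "((\<lambda>y. exp (- c * v y)) has_real_derivative e * (- c * - (poly (pderiv W) x * (v x)\<^sup>2))) (at x)"
    unfolding e_def by (rule DERIV_fun_exp, rule DERIV_cmult, rule dv)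
  ultimately have "((\<lambda>y. poly P y * v y ^ k * exp (- c * v y)) has_real_derivative
     (poly (pderiv P) x * v x ^ k + of_nat k * - (poly (pderiv W) x * (v x)\<^sup>2) * v x ^ (k - 1) * poly P x) * e
      + e * (- c * - (poly (pderiv W) x * (v x)\<^sup>2)) * (poly P x * v x ^ k)) (at x)"
    using DERIV_mult by (fastforce simp: e_def)
  moreover have "(poly (pderiv P) x * v x ^ k + of_nat k * - (poly (pderiv W) x * (v x)\<^sup>2) * v x ^ (k - 1) * poly P x) * e
      + e * (- c * - (poly (pderiv W) x * (v x)\<^sup>2)) * (poly P x * v x ^ k) = ?D"
  proof -
    have "?D = (poly (pderiv P) x * (poly W x)\<^sup>2 - of_nat k * poly P x * poly (pderiv W) x * poly W x
        + c * (poly P x * poly (pderiv W) x)) * v x ^ (k + 2) * e"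
      using True unfolding bump_def e_def vk by simp
    also have "\<dots> = poly (pderiv P) x * (v x * poly W x)\<^sup>2 * v x ^ k * e
        - of_nat k * poly P x * poly (pderiv W) x * (v x * poly W x) * v x ^ (k + 1) * e
        + c * (poly P x * poly (pderiv W) x) * v x ^ (k + 2) * e"
      by (simp add: algebra_simps power2_eq_square)
    also have "\<dots> = poly (pderiv P) x * v x ^ k * e
        - of_nat k * v x ^ (k + 1) * poly P x * poly (pderiv W) x * e
        + c * (poly P x * poly (pderiv W) x) * v x ^ (k + 2) * e"
      unfolding vw by (simp add: mult_ac)
    \<comment> \<open>For \<open>k = 0\<close> the truncated exponent \<open>k - 1\<close> is
      harmless, because the factor \<open>of_nat k\<close> vanishes.\<close>
    also have "of_nat k * v x ^ (k + 1) = of_nat k * ((v x)\<^sup>2 * v x ^ (k - 1))"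
      by (cases k) (auto simp: power2_eq_square)
    finally show ?thesis by (simp add: algebra_simps power2_eq_square)
  qed
  ultimately have "((\<lambda>y. poly P y * v y ^ k * exp (- c * v y)) has_real_derivative ?D) (at x)"
    by (simp only:)
  then show ?thesis
  proof (rule has_field_derivative_transform_within_open[where S="{a<..<b}"])
    show "poly P y * v y ^ k * exp (- c * v y) = bump P k a b c y" if "y \<in> {a<..<b}" for y
      using that by (simp only: vk bump_def greaterThanLessThan_iff simp_thms if_True)
  qed (use True in auto)
next
  case False
  then have D: "?D = 0" "bump P k a b c x = 0" unfolding bump_def by auto
  obtain C where C: "C \<ge> 0" "\<And>y. \<bar>bump P k a b c y\<bar> \<le> C * (y - x)\<^sup>2"
    using bump_quadratic_bound[OF c, of a b P k] False by metis
  have "((\<lambda>y. (bump P k a b c y - bump P k a b c x) / (y - x)) \<longlongrightarrow> 0) (at x)"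
  proof (rule Lim_null_comparison)
    show "\<forall>\<^sub>F y in at x. norm ((bump P k a b c y - bump P k a b c x) / (y - x)) \<le> C * \<bar>y - x\<bar>"
      unfolding eventually_at_filter
    proof (intro always_eventually allI impI)
      fix y assume "y \<noteq> x"
      then show "norm ((bump P k a b c y - bump P k a b c x) / (y - x)) \<le> C * \<bar>y - x\<bar>"
        using C(2)[of y] D by (simp add: abs_divide divide_le_eq power2_eq_square abs_mult[symmetric] mult.assoc)
    qed
    show "((\<lambda>y. C * \<bar>y - x\<bar>) \<longlongrightarrow> 0) (at x)"
      by (rule tendsto_eq_intros refl | simp)+
  qed
  then show ?thesis unfolding has_field_derivative_iff D by simp
qed

lemma higher_deriv_bump:
  assumes "c > 0"
  shows "\<exists>P' k'. (deriv ^^ n) (bump P k a b c) = bump P' k' a b c"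
proof (induction n)
  case (Suc n)
  then obtain P' k' where *: "(deriv ^^ n) (bump P k a b c) = bump P' k' a b c" by blast
  have "deriv (bump P' k' a b c) = bump (pderiv P' * ([:-a, 1:] * [:b, -1:])\<^sup>2
      - of_nat k' * P' * pderiv ([:-a, 1:] * [:b, -1:]) * ([:-a, 1:] * [:b, -1:])
      + smult c (P' * pderiv ([:-a, 1:] * [:b, -1:]))) (k' + 2) a b c"
    by (rule ext) (rule DERIV_imp_deriv[OF has_real_derivative_bump[OF assms]])
  then show ?case unfolding funpow.simps comp_def * by blast
qed auto

lemma bump_smooth:
  assumes "c > 0"
  shows "\<exists>D. ((deriv ^^ n) (bump P k a b c) has_real_derivative D) (at x)"
  using higher_deriv_bump[OF assms, of n P k a b] has_real_derivative_bump[OF assms] by metis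

lemma continuous_on_bump: "c > 0 \<Longrightarrow> continuous_on S (bump P k a b c)"
  using has_real_derivative_bump by (meson DERIV_isCont continuous_at_imp_continuous_on)

section \<open>Weak derivatives as primitives\<close>

lemma compact_subset_per_interval:
  assumes "compact K" "K \<subseteq> per_interval"
  obtains A B where "-pi < A" "A < B" "B < pi" "K \<subseteq> {A<..<B}"
proof (cases "K = {}")
  case True
  then show ?thesis using that[of "-1" 1] pi_gt3 by auto
next
  case False
  obtain s where s: "s \<in> K" "\<And>x. x \<in> K \<Longrightarrow> s \<le> x"
    using compact_attains_inf[OF assms(1) False] by blast
  obtain t where t: "t \<in> K" "\<And>x. x \<in> K \<Longrightarrow> x \<le> t"
    using compact_attains_sup[OF assms(1) False] by blast
  have st: "-pi < s" "s \<le> t" "t < pi" using s t assms(2) by auto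
  show ?thesis
  proof (rule that[of "(s - pi) / 2" "(t + pi) / 2"])
    show "K \<subseteq> {(s - pi) / 2<..<(t + pi) / 2}"
    proof
      fix x assume "x \<in> K"
      then have "s \<le> x" "x \<le> t" using s t by auto
      then show "x \<in> {(s - pi) / 2<..<(t + pi) / 2}" using st by (auto simp: field_simps)
    qed
  qed (use st in \<open>auto simp: field_simps\<close>)
qed

lemma test_functionE:
  assumes "test_function \<phi>"
  obtains A B where "-pi < A" "A < B" "B < pi"
    "\<forall>x. x \<notin> {A<..<B} \<longrightarrow> \<phi> x = 0" "\<forall>x. x \<notin> {A..B} \<longrightarrow> deriv \<phi> x = 0"
    "\<forall>x. (\<phi> has_real_derivative deriv \<phi> x) (at x)" "continuous_on UNIV (deriv \<phi>)"
proof -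
  obtain K where K: "compact K" "K \<subseteq> per_interval" "\<And>x. x \<notin> K \<Longrightarrow> \<phi> x = 0"
    using assms unfolding test_function_def by blast
  obtain A B where AB: "-pi < A" "A < B" "B < pi" "K \<subseteq> {A<..<B}"
    using compact_subset_per_interval[OF K(1,2)] .
  have z: "\<phi> x = 0" if "x \<notin> {A<..<B}" for x using K(3) AB(4) that by blast
  have "(deriv ^^ 0) \<phi> differentiable_on UNIV" "(deriv ^^ 1) \<phi> differentiable_on UNIV"
    using assms unfolding test_function_def by blast+
  then have d: "\<phi> differentiable_on UNIV" "deriv \<phi> differentiable_on UNIV" by auto
  have D: "(\<phi> has_real_derivative deriv \<phi> x) (at x)" for x
    using d(1) unfolding differentiable_on_def
    by (metis DERIV_deriv_iff_real_differentiable UNIV_I)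
  have "deriv \<phi> x = 0" if x: "x \<notin> {A..B}" for x
  proof -
    have "((\<lambda>_. 0) has_real_derivative 0) (at x)" by simp
    then have "(\<phi> has_real_derivative 0) (at x)"
      by (rule has_field_derivative_transform_within_open[where S="- {A..B}"])
        (use x z in \<open>auto simp: open_Compl\<close>)
    then show ?thesis by (rule DERIV_imp_deriv)
  qed
  then show ?thesis
    using that[OF AB(1-3)] z D differentiable_imp_continuous_on[OF d(2)] by blast
qed

lemma loc_integrable_mult:
  assumes u: "loc_integrable u" and g: "continuous_on UNIV g"
    and AB: "-pi < A" "B < pi" and z: "\<forall>x. x \<notin> {A..B} \<longrightarrow> g x = 0"
  shows "integrable per_measure (\<lambda>x. u x * of_real (g x))"
    and "(LINT x|per_measure. u x * of_real (g x)) = integral {A..B} (\<lambda>x. u x * of_real (g x))"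
proof -
  have sub: "{A..B} \<subseteq> per_interval" using AB by auto
  then have "u absolutely_integrable_on {A..B}"
    using u unfolding loc_integrable_def by blast
  then have "(\<lambda>x. of_real (g x) * u x) absolutely_integrable_on {A..B}"
    using g by (intro absolutely_integrable_continuous_mult continuous_intros) (auto intro: continuous_on_subset)
  then have i0: "(\<lambda>x. u x * of_real (g x)) absolutely_integrable_on {A..B}"
    by (simp add: mult.commute)
  have N: "{x \<in> {A..B} - per_interval. u x * of_real (g x) \<noteq> 0} = {}"
    "{x \<in> per_interval - {A..B}. u x * of_real (g x) \<noteq> 0} = {}"
    using sub z by auto
  have neg: "negligible {x \<in> {A..B} - per_interval. u x * of_real (g x) \<noteq> 0}"
    "negligible {x \<in> per_interval - {A..B}. u x * of_real (g x) \<noteq> 0}"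
    unfolding N by simp_all
  from i0 have "(\<lambda>x. u x * of_real (g x)) absolutely_integrable_on per_interval"
    by (rule absolutely_integrable_spike_set[OF _ neg])
  then show i: "integrable per_measure (\<lambda>x. u x * of_real (g x))"
    by (rule absolutely_integrable_imp_integrable) simp
  show "(LINT x|per_measure. u x * of_real (g x)) = integral {A..B} (\<lambda>x. u x * of_real (g x))"
    unfolding lebesgue_integral_eq_integral[OF i, simplified]
    by (rule integral_spike_set[OF neg(2,1)])
qed

lemma loc_integrableD:
  assumes "loc_integrable u" "-pi < a" "b < pi"
  shows "u absolutely_integrable_on {a..b}"
proof -
  have "{a..b} \<subseteq> per_interval" using assms(2,3) by auto
  then show ?thesis using assms(1) unfolding loc_integrable_def by blast
qed

lemma loc_integrableI:
  assumes "\<And>a b. -pi < a \<Longrightarrow> a < b \<Longrightarrow> b < pi \<Longrightarrow> u absolutely_integrable_on {a..b}"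
  shows "loc_integrable u"
  unfolding loc_integrable_def
proof (intro allI impI, elim conjE)
  fix K :: "real set" assume K: "compact K" "K \<subseteq> per_interval"
  obtain A B where AB: "-pi < A" "A < B" "B < pi" "K \<subseteq> {A<..<B}"
    using compact_subset_per_interval[OF K] .
  show "u absolutely_integrable_on K"
  proof (rule set_integrable_subset)
    show "u absolutely_integrable_on {A..B}" using assms AB by blast
    show "K \<in> sets lebesgue" using K(1) by (simp add: borel_compact)
    show "K \<subseteq> {A..B}" using AB by auto
  qed
qed

text \<open>Integration by parts: \<phi> U is a primitive of \<phi> v + \<phi>' U, and it vanishes
  at both ends of an interval containing the support of \<phi>.\<close>

lemma weak_deriv_if_primitive_on:
  assumes P: "primitive_on per_interval U v"
  shows "weak_deriv U v"
proof -
  have v: "loc_integrable v"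
    by (rule loc_integrableI, rule primitive_onD(1)[OF P]) auto
  have U: "loc_integrable U"
  proof (rule loc_integrableI)
    fix a b assume "-pi < a" "a < b" "b < pi"
    then have "primitive_on {a..b} U v" by (intro primitive_on_subset[OF P]) auto
    then show "U absolutely_integrable_on {a..b}"
      by (intro absolutely_integrable_continuous_real primitive_on_continuous)
  qed
  have "(LINT x|per_measure. U x * of_real (deriv \<phi> x)) = - (LINT x|per_measure. v x * of_real (\<phi> x))"
    if "test_function \<phi>" for \<phi>
  proof -
    obtain A B where AB: "-pi < A" "A < B" "B < pi"
      "\<forall>x. x \<notin> {A<..<B} \<longrightarrow> \<phi> x = 0" "\<forall>x. x \<notin> {A..B} \<longrightarrow> deriv \<phi> x = 0"
      "\<forall>x. (\<phi> has_real_derivative deriv \<phi> x) (at x)" "continuous_on UNIV (deriv \<phi>)"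
      using test_functionE[OF \<open>test_function \<phi>\<close>] by blast
    have c\<phi>: "continuous_on UNIV \<phi>" using AB(6) by (meson DERIV_isCont continuous_at_imp_continuous_on)
    have z: "\<phi> A = 0" "\<phi> B = 0" "\<forall>x. x \<notin> {A..B} \<longrightarrow> \<phi> x = 0" using AB(4) by auto
    have M: "primitive_on per_interval (\<lambda>x. of_real (\<phi> x) * U x) (\<lambda>x. of_real (\<phi> x) * v x + of_real (deriv \<phi> x) * U x)"
      using AB by (intro primitive_on_mult[OF P]) (auto intro: DERIV_subset continuous_on_subset is_interval_oo)
    have "A \<in> per_interval" "B \<in> per_interval" "A \<le> B" using AB by auto
    from primitive_onD[OF M this] z
    have I0: "integral {A..B} (\<lambda>x. of_real (\<phi> x) * v x + of_real (deriv \<phi> x) * U x) = 0" by simp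
    have i: "(\<lambda>x. U x * of_real (deriv \<phi> x)) integrable_on {A..B}" "(\<lambda>x. v x * of_real (\<phi> x)) integrable_on {A..B}"
      using absolutely_integrable_continuous_mult[OF continuous_on_of_real, OF continuous_on_subset[OF AB(7)], of A B U]
        absolutely_integrable_continuous_mult[OF continuous_on_of_real, OF continuous_on_subset[OF c\<phi>], of A B v]
        loc_integrableD[OF U AB(1,3)] loc_integrableD[OF v AB(1,3)]
      by (auto simp: mult.commute absolutely_integrable_on_def)
    have "integral {A..B} (\<lambda>x. U x * of_real (deriv \<phi> x)) + integral {A..B} (\<lambda>x. v x * of_real (\<phi> x)) = 0"
      using I0 unfolding Henstock_Kurzweil_Integration.integral_add[OF i, symmetric] by (simp add: mult.commute add.commute)
    then show ?thesis
      using loc_integrable_mult(2)[OF U AB(7,1,3,5)] loc_integrable_mult(2)[OF v c\<phi> AB(1,3) z(3)]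
      by (simp only: eq_neg_iff_add_eq_0)
  qed
  then show ?thesis using U v unfolding weak_deriv_def by blast
qed

section \<open>The lemma of du Bois-Reymond\<close>

definition bump0 :: "real \<Rightarrow> real \<Rightarrow> real \<Rightarrow> real \<Rightarrow> real" where
  "bump0 a b c = bump 1 0 a b c"

lemma bump0_def': "bump0 a b c x = (if a < x \<and> x < b then exp (- c / ((x - a) * (b - x))) else 0)"
  unfolding bump0_def bump_def by simp

lemma bump0_integral_pos:
  assumes "a < b" "c > 0"
  shows "integral {a..b} (bump0 a b c) > 0"
proof -
  have c: "continuous_on {a..b} (bump0 a b c)"
    unfolding bump0_def by (rule continuous_on_bump[OF assms(2)])
  have n: "x \<in> {a..b} \<Longrightarrow> 0 \<le> bump0 a b c x" for x by (simp add: bump0_def')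
  have "integral {a..b} (bump0 a b c) \<ge> 0"
    by (rule Henstock_Kurzweil_Integration.integral_nonneg[OF integrable_continuous_real[OF c]]) (use n in auto)
  moreover have "integral {a..b} (bump0 a b c) \<noteq> 0"
  proof
    assume "integral {a..b} (bump0 a b c) = 0"
    then have "\<forall>x\<in>{a..b}. bump0 a b c x = 0"
      using integral_eq_0_iff[OF c assms(1) n] by simp
    then have "bump0 a b c ((a + b) / 2) = 0" using assms(1) by simp
    then show False using assms(1) by (simp add: bump0_def')
  qed
  ultimately show ?thesis by linarith
qed

text \<open>Subtracting a multiple of a fixed bump of integral \<open>\<noteq> 0\<close> makes the primitive of a bump
  compactly supported.\<close>

lemma test_function_bump_primitive:
  assumes ab: "-pi < a" "a < b" "b < pi" and c: "c > 0"
  defines "\<kappa> \<equiv> integral {a..b} (bump0 a b c) / integral {-1..1} (bump0 (-1) 1 1)"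
  obtains \<phi> where "test_function \<phi>" "deriv \<phi> = (\<lambda>x. bump0 a b c x - \<kappa> * bump0 (-1) 1 1 x)"
proof -
  define g where "g x = bump0 a b c x - \<kappa> * bump0 (-1) 1 1 x" for x
  define A where "A = min a (-1)"
  define B where "B = max b 1"
  have AB: "-pi < A" "A < B" "B < pi" "A \<le> a" "A \<le> -1" "b \<le> B" "1 \<le> B"
    using ab pi_gt3 unfolding A_def B_def by auto
  have cont: "continuous_on S (bump0 a b c)" "continuous_on S (bump0 (-1) 1 1)" for S
    unfolding bump0_def using c by (auto intro: continuous_on_bump)
  have cg: "continuous_on S g" for S
    unfolding g_def by (intro continuous_intros cont)
  have g0: "g x = 0" if "x \<le> A \<or> B \<le> x" for x
    using that AB unfolding g_def bump0_def' by auto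
  have "(bump0 a b c has_integral integral {a..b} (bump0 a b c)) {A..B}"
    using AB by (intro has_integral_on_superset[OF integrable_integral[OF integrable_continuous_real[OF cont(1)[of "{a..b}"]]]])
      (auto simp: bump0_def')
  moreover have "(bump0 (-1) 1 1 has_integral integral {-1..1} (bump0 (-1) 1 1)) {A..B}"
    using AB by (intro has_integral_on_superset[OF integrable_integral[OF integrable_continuous_real[OF cont(2)[of "{-1..1}"]]]])
      (auto simp: bump0_def')
  ultimately have "(g has_integral (integral {a..b} (bump0 a b c) - \<kappa> * integral {-1..1} (bump0 (-1) 1 1))) {A..B}"
    unfolding g_def by (intro has_integral_diff has_integral_mult_right)
  moreover have "integral {a..b} (bump0 a b c) - \<kappa> * integral {-1..1} (bump0 (-1) 1 1) = 0"
    using bump0_integral_pos[of "-1" 1 1] unfolding \<kappa>_def by simp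
  ultimately have gAB: "(g has_integral 0) {A..B}" by simp
  \<comment> \<open>Any base point to the left of the support would do. As -4 < -pi <
    \<open>A\<close>, the function \<open>g\<close> vanishes on all of
    [-4, \<open>A\<close>].\<close>
  define \<phi> where "\<phi> x = integral {-4..x} g" for x
  have D: "(\<phi> has_real_derivative g x) (at x)" for x
  proof (cases "x < A")
    case True
    have "((\<lambda>_. 0) has_real_derivative g x) (at x)" using g0[of x] True by simp
    then show ?thesis
    proof (rule has_field_derivative_transform_within_open[where S="{..<A}"])
      fix y assume "y \<in> {..<A}"
      then have "integral {-4..y} g = integral {-4..y} (\<lambda>_. 0)"
        by (intro integral_cong) (auto simp: g0)
      then show "0 = \<phi> y" unfolding \<phi>_def by simp
    qed (use True in auto)
  next
    case False
    then have x: "x \<in> {-4..x+1}" "-4 < x" using AB pi_less_4 by auto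
    show ?thesis
      using integral_has_real_derivative[OF cg x(1)] at_within_Icc_at[of "-4" x "x+1"] x(2)
      unfolding \<phi>_def by simp
  qed
  then have deriv: "deriv \<phi> = g" by (intro ext DERIV_imp_deriv)
  have higher_g: "\<exists>D. ((deriv ^^ n) g has_real_derivative D) (at x)
      \<and> (deriv ^^ n) g = (\<lambda>x. (deriv ^^ n) (bump0 a b c) x - \<kappa> * (deriv ^^ n) (bump0 (-1) 1 1) x)" for n x
  proof (induction n arbitrary: x)
    case 0
    obtain D1 D2 where "(bump0 a b c has_real_derivative D1) (at x)" "(bump0 (-1) 1 1 has_real_derivative D2) (at x)"
      using bump_smooth[of c 0 1 0 a b x] bump_smooth[of 1 0 1 0 "-1" 1 x] c unfolding bump0_def by auto
    then have "(g has_real_derivative D1 - \<kappa> * D2) (at x)"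
      unfolding g_def by (intro DERIV_diff DERIV_cmult)
    then show ?case unfolding g_def by auto
  next
    case (Suc n)
    have d: "((deriv ^^ m) (bump0 a b c) has_real_derivative (deriv ^^ Suc m) (bump0 a b c) y) (at y)"
      "((deriv ^^ m) (bump0 (-1) 1 1) has_real_derivative (deriv ^^ Suc m) (bump0 (-1) 1 1) y) (at y)" for y m
      using bump_smooth[of c m 1 0 a b y] bump_smooth[of 1 m 1 0 "-1" 1 y] c DERIV_imp_deriv
      unfolding bump0_def by fastforce+
    have "(deriv ^^ n) g = (\<lambda>x. (deriv ^^ n) (bump0 a b c) x - \<kappa> * (deriv ^^ n) (bump0 (-1) 1 1) x)"
      using Suc by blast
    then have "(deriv ^^ Suc n) g = deriv (\<lambda>x. (deriv ^^ n) (bump0 a b c) x - \<kappa> * (deriv ^^ n) (bump0 (-1) 1 1) x)"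
      by simp
    also have "\<dots> = (\<lambda>x. (deriv ^^ Suc n) (bump0 a b c) x - \<kappa> * (deriv ^^ Suc n) (bump0 (-1) 1 1) x)"
      by (intro ext DERIV_imp_deriv DERIV_diff DERIV_cmult d)
    finally have e: "(deriv ^^ Suc n) g = (\<lambda>x. (deriv ^^ Suc n) (bump0 a b c) x - \<kappa> * (deriv ^^ Suc n) (bump0 (-1) 1 1) x)" .
    show ?case
      unfolding e using DERIV_diff[OF d(1)[of "Suc n" x] DERIV_cmult[OF d(2)[of "Suc n" x], of \<kappa>]] by blast
  qed
  have "(deriv ^^ n) \<phi> differentiable_on UNIV" for n
  proof (cases n)
    case 0
    then show ?thesis using D
      by (auto simp: differentiable_on_def simp: real_differentiable_def)
  next
    case (Suc m)
    then have "(deriv ^^ n) \<phi> = (deriv ^^ m) g" using deriv by (simp add: funpow_swap1)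
    moreover have "\<exists>D. ((deriv ^^ m) g has_real_derivative D) (at x)" for x using higher_g[of m x] by blast
    ultimately show ?thesis
      by (auto simp: differentiable_on_def simp: real_differentiable_def)
  qed
  moreover have "\<phi> x = 0" if "x \<notin> {A..B}" for x
  proof (cases "x < A")
    case True
    then have "integral {-4..x} g = integral {-4..x} (\<lambda>_. 0)"
      by (intro integral_cong) (auto simp: g0)
    then show ?thesis unfolding \<phi>_def by simp
  next
    case False
    then have "B < x" using that by auto
    then have "(g has_integral 0) {-4..x}"
      using AB pi_less_4 by (intro has_integral_on_superset[OF gAB]) (auto intro: g0)
    then show ?thesis unfolding \<phi>_def by (rule integral_unique)
  qed
  ultimately have "test_function \<phi>"
    unfolding test_function_def using AB by (auto intro!: exI[of _ "{A..B}"])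
  then show ?thesis using deriv that unfolding g_def by blast
qed

text \<open>\<open>C\<close> is the average of h against the fixed bump \<rho>. Testing with the
  compactly supported primitives shows that h - \<open>C\<close> integrates to 0 against every bump.
  As c tends to 0 the bumps on (a,b) increase to its indicator function, so h - \<open>C\<close> has
  integral 0 over every compact subinterval.\<close>

lemma du_Bois_Reymond:
  assumes h: "loc_integrable h"
    and z: "\<And>\<phi>. test_function \<phi> \<Longrightarrow> (LINT x|per_measure. h x * of_real (deriv \<phi> x)) = 0"
  obtains C where "ae_eq h (\<lambda>_. C)"
proof -
  define \<rho> where "\<rho> = bump0 (-1) 1 1"
  define Z where "Z = integral {-1..1} \<rho>"
  define C where "C = (LINT x|per_measure. h x * of_real (\<rho> x)) / of_real Z"
  have Z: "Z > 0" unfolding Z_def \<rho>_def by (rule bump0_integral_pos) auto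
  have cont: "continuous_on S (bump0 a b c)" if "c > 0" for S a b c
    unfolding bump0_def using that by (rule continuous_on_bump)
  have c\<rho>: "continuous_on S \<rho>" for S unfolding \<rho>_def by (rule cont) simp
  have key: "integral {a..b} (\<lambda>x. h x * of_real (bump0 a b c x)) = C * of_real (integral {a..b} (bump0 a b c))"
    if ab: "-pi < a" "a < b" "b < pi" and c: "c > 0" for a b c
  proof -
    define \<kappa> where "\<kappa> = integral {a..b} (bump0 a b c) / Z"
    obtain \<phi> where \<phi>: "test_function \<phi>" "deriv \<phi> = (\<lambda>x. bump0 a b c x - \<kappa> * \<rho> x)"
      using test_function_bump_primitive[OF ab c] unfolding \<kappa>_def Z_def \<rho>_def by blast
    have s: "\<forall>x. x \<notin> {a..b} \<longrightarrow> bump0 a b c x = 0" "\<forall>x. x \<notin> {-1..1} \<longrightarrow> \<rho> x = 0"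
      unfolding \<rho>_def bump0_def' by auto
    have i1: "integrable per_measure (\<lambda>x. h x * of_real (bump0 a b c x))"
      by (rule loc_integrable_mult(1)[OF h cont[OF c] ab(1,3) s(1)])
    have i2: "integrable per_measure (\<lambda>x. h x * of_real (\<rho> x))"
      by (rule loc_integrable_mult(1)[OF h c\<rho> _ _ s(2)]) (use pi_gt3 in auto)
    have "0 = (LINT x|per_measure. h x * of_real (bump0 a b c x) - of_real \<kappa> * (h x * of_real (\<rho> x)))"
      using z[OF \<phi>(1)] unfolding \<phi>(2) by (simp add: algebra_simps)
    also have "\<dots> = (LINT x|per_measure. h x * of_real (bump0 a b c x)) - of_real \<kappa> * (LINT x|per_measure. h x * of_real (\<rho> x))"
      using i1 i2 by (simp del: of_real_mult)
    finally show ?thesis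
      using loc_integrable_mult(2)[OF h cont[OF c] ab(1,3) s(1)] Z
      unfolding C_def \<kappa>_def by (simp add: field_simps)
  qed
  have avg: "integral {a..b} (\<lambda>x. h x - C) = 0" if ab: "-pi < a" "a < b" "b < pi" for a b
  proof -
    define c where "c n = inverse (real (Suc n))" for n
    have c: "c n > 0" for n unfolding c_def by simp
    have hi: "h absolutely_integrable_on {a..b}" using h ab(1,3) by (rule loc_integrableD)
    have bump_le: "\<bar>bump0 a b (c n) x\<bar> \<le> 1" for n x
      using c[of n] by (auto simp: bump0_def' intro!: divide_nonneg_pos)
    have bump_lim: "(\<lambda>n. bump0 a b (c n) x) \<longlonglongrightarrow> 1" if "x \<in> {a<..<b}" for x
    proof -
      have "c \<longlonglongrightarrow> 0" unfolding c_def by (rule LIMSEQ_inverse_real_of_nat)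
      then have "(\<lambda>n. exp (- c n / ((x - a) * (b - x)))) \<longlonglongrightarrow> exp (- 0 / ((x - a) * (b - x)))"
        using that by (intro tendsto_intros) auto
      then show ?thesis using that by (simp add: bump0_def')
    qed
    have ci: "bump0 a b (c n) absolutely_integrable_on {a..b}" for n
      by (intro absolutely_integrable_continuous_real cont c)
    have hci: "(\<lambda>x. h x * of_real (bump0 a b (c n) x)) absolutely_integrable_on {a..b}" for n
      using absolutely_integrable_continuous_mult[OF continuous_on_of_real[OF cont[OF c]] hi]
      by (simp add: mult.commute)
    have "(\<lambda>n. integral {a<..<b} (\<lambda>x. h x * of_real (bump0 a b (c n) x))) \<longlonglongrightarrow> integral {a<..<b} h"
    proof (rule dominated_convergence(2))
      show "(\<lambda>x. h x * of_real (bump0 a b (c n) x)) integrable_on {a<..<b}" for n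
        using hci[of n] by (simp add: absolutely_integrable_on_def integrable_on_Icc_iff_Ioo)
      show "(\<lambda>x. norm (h x)) integrable_on {a<..<b}"
        using hi by (simp add: absolutely_integrable_on_def integrable_on_Icc_iff_Ioo)
      show "norm (h x * of_real (bump0 a b (c n) x)) \<le> norm (h x)" for n x
        using mult_left_mono[OF bump_le[of n x] norm_ge_zero[of "h x"]] by (simp add: norm_mult)
      show "(\<lambda>n. h x * of_real (bump0 a b (c n) x)) \<longlonglongrightarrow> h x" if "x \<in> {a<..<b}" for x
        using tendsto_mult[OF tendsto_const tendsto_of_real[OF bump_lim[OF that]], of "h x"] by simp
    qed
    then have l1: "(\<lambda>n. integral {a..b} (\<lambda>x. h x * of_real (bump0 a b (c n) x))) \<longlonglongrightarrow> integral {a..b} h"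
      by (simp add: integral_open_interval_real)
    have "(\<lambda>n. integral {a<..<b} (bump0 a b (c n))) \<longlonglongrightarrow> integral {a<..<b} (\<lambda>_. 1)"
    proof (rule dominated_convergence(2))
      show "bump0 a b (c n) integrable_on {a<..<b}" for n
        using ci[of n] by (simp add: absolutely_integrable_on_def integrable_on_Icc_iff_Ioo)
      show "(\<lambda>x. 1::real) integrable_on {a<..<b}"
        using integrable_on_Icc_iff_Ioo[of "\<lambda>_. 1::real" a b] integrable_const_ivl[of "1::real" a b] by blast
      show "norm (bump0 a b (c n) x) \<le> 1" for n x using bump_le by simp
    qed (rule bump_lim)
    then have "(\<lambda>n. integral {a..b} (bump0 a b (c n))) \<longlonglongrightarrow> b - a"
      unfolding integral_open_interval_real[symmetric] using ab by simp
    from tendsto_mult[OF tendsto_const tendsto_of_real[OF this], of C]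
    have "(\<lambda>n. integral {a..b} (\<lambda>x. h x * of_real (bump0 a b (c n) x))) \<longlonglongrightarrow> C * of_real (b - a)"
      unfolding key[OF ab c] .
    from LIMSEQ_unique[OF l1 this] have "integral {a..b} h = C * of_real (b - a)" .
    moreover have "integral {a..b} (\<lambda>x. h x - C) = integral {a..b} h - integral {a..b} (\<lambda>_. C)"
      using hi by (intro Henstock_Kurzweil_Integration.integral_diff) (auto simp: absolutely_integrable_on_def)
    ultimately show ?thesis using ab by (simp add: scaleR_conv_of_real mult.commute)
  qed
  define l where "l n = pi - inverse (real (Suc n))" for n
  have neg: "negligible {x \<in> {- l n..l n}. h x - C \<noteq> 0}" for n
  proof (rule negligible_if_integrals_0)
    have l: "l n < pi" unfolding l_def by simp
    show "(\<lambda>x. h x - C) absolutely_integrable_on {- l n..l n}"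
      using l by (intro set_integral_diff(1) loc_integrableD[OF h]) auto
    show "integral {u..v} (\<lambda>x. h x - C) = 0" if "- l n \<le> u" "u \<le> v" "v \<le> l n" for u v
      using avg[of u v] that l by (cases "u = v") auto
  qed
  have "{x \<in> per_interval. h x \<noteq> C} \<subseteq> (\<Union>n. {x \<in> {- l n..l n}. h x - C \<noteq> 0})"
  proof
    fix x assume x: "x \<in> {x \<in> per_interval. h x \<noteq> C}"
    then have "pi - \<bar>x\<bar> > 0" by auto
    then obtain n where "inverse (real (Suc n)) < pi - \<bar>x\<bar>" using reals_Archimedean by blast
    then show "x \<in> (\<Union>n. {x \<in> {- l n..l n}. h x - C \<noteq> 0})"
      using x unfolding l_def by (auto intro!: exI[of _ n])
  qed
  moreover have "negligible (\<Union>n. {x \<in> {- l n..l n}. h x - C \<noteq> 0})"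
    by (rule negligible_countable_Union) (use neg in blast)+
  ultimately have "ae_eq h (\<lambda>_. C)"
    unfolding ae_eq_iff_negligible by (rule negligible_subset[rotated])
  then show ?thesis by (rule that)
qed

text \<open>The difference of u and an integral of its weak derivative has weak derivative 0, hence
  is almost everywhere constant. The constant is absorbed into the primitive.\<close>

lemma primitive_on_if_weak_deriv:
  assumes W: "weak_deriv u v"
  obtains U where "primitive_on per_interval U v" "ae_eq u U"
proof -
  have u: "loc_integrable u" and v: "loc_integrable v" using W unfolding weak_deriv_def by auto
  define U where "U x = (if 0 \<le> x then integral {0..x} v else - integral {x..0} v)" for x
  have vi: "v integrable_on {a..b}" if "-pi < a" "b < pi" for a b
    using loc_integrableD[OF v that] by (simp add: absolutely_integrable_on_def)
  have P: "primitive_on per_interval U v"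
    unfolding primitive_on_def
  proof (intro ballI impI conjI)
    fix a b assume ab: "a \<in> per_interval" "b \<in> per_interval" "a \<le> b"
    then show "v absolutely_integrable_on {a..b}" using loc_integrableD[OF v] by simp
    consider "0 \<le> a" | "b < 0" | "a < 0" "0 \<le> b" by linarith
    then show "U b - U a = integral {a..b} v"
    proof cases
      case 1
      then show ?thesis
        using Henstock_Kurzweil_Integration.integral_combine[of 0 a b v] vi[of 0 b] ab by (simp add: U_def algebra_simps)
    next
      case 2
      then show ?thesis
        using Henstock_Kurzweil_Integration.integral_combine[of a b 0 v] vi[of a 0] ab by (simp add: U_def algebra_simps)
    next
      case 3
      then show ?thesis
        using Henstock_Kurzweil_Integration.integral_combine[of a 0 b v] vi[of a b] ab by (simp add: U_def algebra_simps)
    qed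
  qed
  have WU: "weak_deriv U v" using P by (rule weak_deriv_if_primitive_on)
  then have U: "loc_integrable U" unfolding weak_deriv_def by blast
  have "loc_integrable (\<lambda>x. u x - U x)"
    by (intro loc_integrableI set_integral_diff(1) loc_integrableD[OF u] loc_integrableD[OF U])
  moreover have "(LINT x|per_measure. (u x - U x) * of_real (deriv \<phi> x)) = 0" if T: "test_function \<phi>" for \<phi>
  proof -
    obtain A B where AB: "-pi < A" "B < pi"
      "\<forall>x. x \<notin> {A..B} \<longrightarrow> deriv \<phi> x = 0" "continuous_on UNIV (deriv \<phi>)"
      using test_functionE[OF T] by metis
    note i = loc_integrable_mult(1)[OF u AB(4,1,2,3)] loc_integrable_mult(1)[OF U AB(4,1,2,3)]
    have "(LINT x|per_measure. (u x - U x) * of_real (deriv \<phi> x))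
        = (LINT x|per_measure. u x * of_real (deriv \<phi> x)) - (LINT x|per_measure. U x * of_real (deriv \<phi> x))"
      unfolding left_diff_distrib using i by (rule Bochner_Integration.integral_diff)
    also have "\<dots> = 0" using W WU T unfolding weak_deriv_def by simp
    finally show ?thesis .
  qed
  ultimately obtain C where C: "ae_eq (\<lambda>x. u x - U x) (\<lambda>_. C)"
    using du_Bois_Reymond by blast
  have "primitive_on per_interval (\<lambda>x. U x + C) v"
    using P unfolding primitive_on_def by simp
  moreover have "ae_eq u (\<lambda>x. U x + C)"
    using C unfolding ae_eq_iff_negligible by (simp add: diff_eq_eq add.commute)
  ultimately show ?thesis by (rule that)
qed

section \<open>The integrating factor\<close>

text \<open>\<open>f_refl\<close> combines antiperiodicity with oddness; it carries the slope 2/pi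
  at 0 over to the end point pi.\<close>

locale singular_ode =
  fixes \<epsilon> :: real and f :: "real \<Rightarrow> real"
  assumes eps: "0 < \<epsilon>" "\<epsilon> < pi"
    and cont_f: "continuous_on UNIV f"
    and f_pos: "\<And>x. 0 < x \<Longrightarrow> x < pi \<Longrightarrow> 0 < f x"
    and f_odd: "\<And>x. f (- x) = - f x"
    and f_refl: "\<And>x. f (pi - x) = f x"
    and f_deriv: "(f has_real_derivative 2 / pi) (at 0)"
begin

lemma f_0: "f 0 = 0"
  using f_odd[of 0] by simp

lemma isCont_f: "isCont f x"
  using cont_f by (simp add: continuous_on_eq_continuous_at)

lemma f_quotient_tendsto: "((\<lambda>x. f x / x) \<longlongrightarrow> 2 / pi) (at_right 0)"
  using f_deriv unfolding has_field_derivative_iff f_0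
  by (simp add: filterlim_at_split)

text \<open>The exponential of an antiderivative of 1 / (\<epsilon> f). Another choice of
  antiderivative multiplies \<open>wt\<close> by a constant, which cancels in the operator
  \<open>K\<close> below. The value 0 at 0 keeps \<open>wt\<close> increasing on [0, pi).\<close>

definition wt :: "real \<Rightarrow> real" where
  "wt x = (if 0 < x then (SOME p. \<forall>x. 0 < x \<and> x < pi \<longrightarrow>
     0 < p x \<and> (p has_real_derivative p x / (\<epsilon> * f x)) (at x)) x else 0)"

lemma
  assumes x: "0 < x" "x < pi"
  shows wt_pos: "0 < wt x" and wt_deriv: "(wt has_real_derivative wt x / (\<epsilon> * f x)) (at x)"
proof -
  have "\<exists>F. \<forall>x::real. ereal 0 < ereal x \<longrightarrow> ereal x < ereal pi \<longrightarrow> (F has_vector_derivative 1 / (\<epsilon> * f x)) (at x)"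
  proof (rule einterval_antiderivative)
    fix y :: real assume "ereal 0 < ereal y" "ereal y < ereal pi"
    then have "f y > 0" using f_pos by auto
    then show "isCont (\<lambda>x. 1 / (\<epsilon> * f x)) y"
      using eps by (intro continuous_intros isCont_f) auto
  qed simp
  then obtain F where F: "\<And>x. 0 < x \<Longrightarrow> x < pi \<Longrightarrow> (F has_real_derivative 1 / (\<epsilon> * f x)) (at x)"
    by (auto simp: has_real_derivative_iff_has_vector_derivative)
  define p0 where "p0 = (SOME p. \<forall>x. 0 < x \<and> x < pi \<longrightarrow>
     0 < p x \<and> (p has_real_derivative p x / (\<epsilon> * f x)) (at x))"
  have "\<forall>x. 0 < x \<and> x < pi \<longrightarrow>
     0 < exp (F x) \<and> ((\<lambda>x. exp (F x)) has_real_derivative exp (F x) / (\<epsilon> * f x)) (at x)"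
    using DERIV_fun_exp[OF F] by simp
  then have p0: "\<forall>x. 0 < x \<and> x < pi \<longrightarrow>
     0 < p0 x \<and> (p0 has_real_derivative p0 x / (\<epsilon> * f x)) (at x)"
    unfolding p0_def by (rule someI[where x="\<lambda>x. exp (F x)"])
  have wt: "wt y = p0 y" if "0 < y" for y using that unfolding wt_def p0_def by simp
  show "0 < wt x" using p0 wt x by simp
  have "(p0 has_real_derivative wt x / (\<epsilon> * f x)) (at x)" using p0 wt x by simp
  then show "(wt has_real_derivative wt x / (\<epsilon> * f x)) (at x)"
    by (rule has_field_derivative_transform_within_open[where S="{0<..}"]) (use x wt in auto)
qed

lemma wt_0: "wt 0 = 0"
  unfolding wt_def by simp

lemma wt_mono: "0 \<le> x \<Longrightarrow> x \<le> y \<Longrightarrow> y < pi \<Longrightarrow> wt x \<le> wt y"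
proof (cases "x = 0")
  case True
  then show "0 \<le> x \<Longrightarrow> x \<le> y \<Longrightarrow> y < pi \<Longrightarrow> wt x \<le> wt y"
    using wt_pos[of y] wt_0 by (cases "y = 0") (auto simp: less_imp_le)
next
  case False
  show "wt x \<le> wt y" if "0 \<le> x" "x \<le> y" "y < pi"
  proof (rule DERIV_nonneg_imp_nondecreasing[OF that(2)])
    fix z assume "x \<le> z" "z \<le> y"
    then have "0 < z" "z < pi" using that False by auto
    then show "\<exists>D. (wt has_real_derivative D) (at z) \<and> 0 \<le> D"
      using wt_deriv[of z] wt_pos[of z] f_pos[of z] eps by (auto intro!: exI)
  qed
qed

lemma wt_nonneg: "0 \<le> x \<Longrightarrow> x < pi \<Longrightarrow> 0 \<le> wt x"
  using wt_mono[of 0 x] wt_0 by simp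

lemma isCont_wt: "0 < x \<Longrightarrow> x < pi \<Longrightarrow> isCont wt x"
  using wt_deriv DERIV_isCont by blast

text \<open>Near 0 the slope 2/pi gives f x \<ge> x / pi, near pi the same follows by reflection,
  and on the compact rest f has a positive minimum. The two constants use x (pi - x) \<le> pi x and
  x (pi - x) \<le> pi^2.\<close>

lemma f_lower:
  obtains c where "c > 0" "\<And>x. 0 < x \<Longrightarrow> x < pi \<Longrightarrow> c * (x * (pi - x)) \<le> f x"
proof -
  have "\<forall>\<^sub>F x in at_right 0. f x / x > 1 / pi"
    using f_quotient_tendsto by (rule order_tendstoD) (simp add: divide_strict_right_mono)
  then obtain d0 where d0: "d0 > 0" "\<And>x. 0 < x \<Longrightarrow> x < d0 \<Longrightarrow> f x / x > 1 / pi"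
    unfolding eventually_at_right_field by auto
  define d where "d = min (d0 / 2) 1"
  have d: "d > 0" "d \<le> 1" "d < d0" using d0 unfolding d_def by auto
  have dl: "x / pi \<le> f x" if "0 < x" "x \<le> d" for x
    using d0(2)[of x] that d by (simp add: field_simps)
  have "\<exists>z\<in>{d..pi - d}. \<forall>y\<in>{d..pi - d}. f z \<le> f y"
    by (rule continuous_attains_inf) (use d pi_gt3 in \<open>auto intro: continuous_on_subset[OF cont_f]\<close>)
  then obtain z where z: "z \<in> {d..pi - d}" "\<And>y. y \<in> {d..pi - d} \<Longrightarrow> f z \<le> f y" by blast
  have fz: "f z > 0" using z d by (intro f_pos) auto
  have le: "x * (pi - x) \<le> pi * pi" if "0 < x" "x < pi" for x
    using that by (intro mult_mono) auto
  show ?thesis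
  proof (rule that[of "min (1 / (pi * pi)) (f z / (pi * pi))"])
    show "min (1 / (pi * pi)) (f z / (pi * pi)) > 0" using fz by simp
    fix x assume x: "0 < x" "x < pi"
    have nn: "0 \<le> x * (pi - x)" using x by simp
    have end_le: "y * (pi - y) / (pi * pi) \<le> f y" if "0 < y" "y \<le> d" for y
    proof -
      have "y * (pi - y) / (pi * pi) \<le> y * pi / (pi * pi)"
        using that by (intro divide_right_mono mult_left_mono) auto
      then show ?thesis using dl[OF that] by simp
    qed
    have "min (1 / (pi * pi)) (f z / (pi * pi)) * (x * (pi - x)) \<le> 1 / (pi * pi) * (x * (pi - x))"
      "min (1 / (pi * pi)) (f z / (pi * pi)) * (x * (pi - x)) \<le> f z / (pi * pi) * (x * (pi - x))"
      by (rule mult_right_mono[OF min.cobounded1 nn], rule mult_right_mono[OF min.cobounded2 nn])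
    moreover have "1 / (pi * pi) * (x * (pi - x)) \<le> f x \<or> f z / (pi * pi) * (x * (pi - x)) \<le> f x"
    proof -
      consider "x \<le> d" | "pi - x \<le> d" | "x \<in> {d..pi - d}" by fastforce
      then show ?thesis
      proof cases
        case 1
        then show ?thesis using end_le[of x] x by simp
      next
        case 2
        then show ?thesis using end_le[of "pi - x"] x by (simp add: f_refl mult.commute)
      next
        case 3
        have "f z / (pi * pi) * (x * (pi - x)) \<le> f z / (pi * pi) * (pi * pi)"
          using le[OF x] fz by (intro mult_left_mono) auto
        then show ?thesis using z(2)[OF 3] by simp
      qed
    qed
    ultimately show "min (1 / (pi * pi)) (f z / (pi * pi)) * (x * (pi - x)) \<le> f x" by linarith
  qed
qed

text \<open>On (0, y) with y < pi the weight is bounded by \<open>wt y\<close>, by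
  monotonicity.\<close>

lemma wt_scaleR_integrable:
  fixes g :: "real \<Rightarrow> 'b::euclidean_space"
  assumes g: "g absolutely_integrable_on {0..y}" and y: "y < pi"
  shows "(\<lambda>x. wt x *\<^sub>R g x) absolutely_integrable_on {0..y}"
proof -
  have bil: "bilinear (\<lambda>(a::real) (b::'b). a *\<^sub>R b)"
    by (simp add: bilinear_conv_bounded_bilinear bounded_bilinear_scaleR)
  have meas: "wt \<in> borel_measurable (lebesgue_on {0<..<y})"
    using y by (intro continuous_imp_measurable_on_sets_lebesgue continuous_at_imp_continuous_on)
      (auto intro: isCont_wt)
  have "\<bar>wt x\<bar> \<le> wt y" if "x \<in> {0<..<y}" for x
    using that wt_mono[of x y] wt_nonneg[of x] y by auto
  then have bdd: "bounded (wt ` {0<..<y})"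
    by (intro boundedI[where B="wt y"]) auto
  have gi: "g absolutely_integrable_on {0<..<y}"
    using g by (simp add: absolutely_integrable_on_Icc_iff_Ioo)
  have "(\<lambda>x. wt x *\<^sub>R g x) absolutely_integrable_on {0<..<y}"
    using absolutely_integrable_bounded_measurable_product[OF bil meas _ bdd gi] by simp
  then show ?thesis by (simp add: absolutely_integrable_on_Icc_iff_Ioo)
qed

lemma wt_square_integrable:
  assumes "y < pi"
  shows "(\<lambda>x. (wt x)\<^sup>2) integrable_on {0..y}" "wt integrable_on {0..y}"
proof -
  have "(\<lambda>x. 1::real) absolutely_integrable_on {0..y}"
    by (rule absolutely_integrable_on_const) simp
  from wt_scaleR_integrable[OF this assms] have w: "wt absolutely_integrable_on {0..y}" by simp
  then show "wt integrable_on {0..y}" by (simp add: absolutely_integrable_on_def)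
  from wt_scaleR_integrable[OF w assms] show "(\<lambda>x. (wt x)\<^sup>2) integrable_on {0..y}"
    by (simp add: absolutely_integrable_on_def power2_eq_square)
qed

end

lemma has_vector_derivative_integral_at:
  fixes g :: "real \<Rightarrow> 'a::banach"
  assumes g: "\<And>b. a \<le> b \<Longrightarrow> b < c \<Longrightarrow> g integrable_on {a..b}" and x: "a < x" "x < c" and "isCont g x"
  shows "((\<lambda>y. integral {a..y} g) has_vector_derivative g x) (at x)"
proof -
  obtain b where b: "x < b" "b < c" using x dense by blast
  have "((\<lambda>y. integral {a..y} g) has_vector_derivative g x) (at x within ({a..b} - {}))"
    using assms b by (intro integral_has_vector_derivative_continuous_at) (auto intro: continuous_at_imp_continuous_within)
  then show ?thesis using at_within_Icc_at[of a x b] x b by simp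
qed

context singular_ode
begin

text \<open>The Hardy-type estimate at the limit-circle end point \<open>\<pi>\<close>; this is where
  \<open>\<epsilon> < \<pi>\<close> enters: near \<open>\<pi>\<close> the derivative of \<open>(\<pi> - y) (wt y)\<^sup>2\<close> is at least a positive
  multiple of \<open>(wt y)\<^sup>2\<close>.\<close>

lemma wt_square_integral_bound:
  obtains C where "C > 0" "\<And>y. 0 < y \<Longrightarrow> y < pi \<Longrightarrow> integral {0..y} (\<lambda>r. (wt r)\<^sup>2) \<le> C * (y * (pi - y)) * (wt y)\<^sup>2"
proof -
  define G where "G y = integral {0..y} (\<lambda>r. (wt r)\<^sup>2)" for y
  have dG: "(G has_real_derivative (wt y)\<^sup>2) (at y)" if "0 < y" "y < pi" for y
    unfolding has_real_derivative_iff_has_vector_derivative G_def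
    using that isCont_wt[of y] wt_square_integrable
    by (intro has_vector_derivative_integral_at[where c=pi]) (auto intro!: continuous_intros)
  have G_le: "G y \<le> y * (wt y)\<^sup>2" if "0 < y" "y < pi" for y
  proof -
    have "G y \<le> integral {0..y} (\<lambda>_. (wt y)\<^sup>2)"
      unfolding G_def using that wt_square_integrable
      by (intro integral_le) (auto intro!: power_mono wt_mono wt_nonneg)
    then show ?thesis using that by simp
  qed
  \<comment> \<open>The ratio 2 (pi - y) / (\<epsilon> f y) tends to pi / \<epsilon> > 1 as y tends
    to pi, and 1 + \<kappa> is the midpoint between 1 and this limit. The corresponding slope bound
    for f at 0 is 4 / (\<epsilon> + pi), which exceeds 2 / pi.\<close>
  define \<kappa> where "\<kappa> = (pi / \<epsilon> - 1) / 2"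
  have \<kappa>: "\<kappa> > 0" unfolding \<kappa>_def using eps by simp
  have "\<forall>\<^sub>F x in at_right 0. f x / x < 4 / (\<epsilon> + pi)"
    using f_quotient_tendsto by (rule order_tendstoD) (use eps in \<open>simp add: field_simps\<close>)
  then obtain d0 where d0: "d0 > 0" "\<And>x. 0 < x \<Longrightarrow> x < d0 \<Longrightarrow> f x / x < 4 / (\<epsilon> + pi)"
    unfolding eventually_at_right_field by auto
  define y0 where "y0 = pi - min (d0 / 2) 1"
  have y0: "0 < y0" "y0 < pi" "pi - y0 < d0" using d0 pi_gt3 unfolding y0_def by auto
  have ratio: "2 * (pi - y) / (\<epsilon> * f y) \<ge> 1 + \<kappa>" if "y0 \<le> y" "y < pi" for y
  proof -
    have "f (pi - y) / (pi - y) < 4 / (\<epsilon> + pi)" using d0(2)[of "pi - y"] that y0 by auto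
    then have "f y * (\<epsilon> + pi) < 4 * (pi - y)"
      using that eps pi_gt_zero by (simp add: f_refl field_simps)
    then have "(\<epsilon> + pi) / 2 \<le> 2 * (pi - y) / f y"
      using f_pos[of y] that y0 by (simp add: pos_le_divide_eq mult.commute)
    then have "(\<epsilon> + pi) / 2 / \<epsilon> \<le> 2 * (pi - y) / f y / \<epsilon>"
      using eps by (intro divide_right_mono) auto
    moreover have "1 + \<kappa> = (\<epsilon> + pi) / 2 / \<epsilon>" unfolding \<kappa>_def using eps by (simp add: field_simps)
    ultimately show ?thesis by (simp add: mult.commute)
  qed
  \<comment> \<open>The first entry makes \<open>W\<close> nondecreasing on [y0, pi), the second
    makes \<open>W y0\<close> nonnegative.\<close>
  define C where "C = max (1 / \<kappa>) (y0 / (pi - y0))"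
  have C: "C > 0" "C * \<kappa> \<ge> 1" "C * (pi - y0) \<ge> y0"
    using \<kappa> y0 unfolding C_def
    by (auto simp: less_max_iff_disj pos_divide_le_eq[symmetric])
  define W where "W y = C * ((pi - y) * (wt y)\<^sup>2) - G y" for y
  have far: "G y \<le> C * ((pi - y) * (wt y)\<^sup>2)" if y: "y0 \<le> y" "y < pi" for y
  proof -
    have "W y0 \<le> W y"
    proof (rule DERIV_nonneg_imp_nondecreasing[OF y(1)])
      fix z assume "y0 \<le> z" "z \<le> y"
      then have z: "y0 \<le> z" "z < pi" "0 < z" using y y0 by auto
      have "(W has_real_derivative C * (- (wt z)\<^sup>2 + (pi - z) * (2 * (wt z) * (wt z / (\<epsilon> * f z)))) - (wt z)\<^sup>2) (at z)"
      proof -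
        have d1: "((\<lambda>y. pi - y) has_real_derivative -1) (at z)"
          by (auto intro!: derivative_eq_intros)
        have d2: "((\<lambda>y. (wt y)\<^sup>2) has_real_derivative 2 * wt z * (wt z / (\<epsilon> * f z))) (at z)"
          using DERIV_power[OF wt_deriv[OF z(3,2)], of 2] by (simp add: mult_ac)
        show ?thesis
          using DERIV_diff[OF DERIV_cmult[OF DERIV_mult[OF d1 d2], of C] dG[OF z(3,2)]]
          unfolding W_def by (simp add: mult_ac)
      qed
      moreover have "C * (- (wt z)\<^sup>2 + (pi - z) * (2 * (wt z) * (wt z / (\<epsilon> * f z)))) - (wt z)\<^sup>2
          = (wt z)\<^sup>2 * (C * (2 * (pi - z) / (\<epsilon> * f z) - 1) - 1)"
        by (simp add: algebra_simps power2_eq_square)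
      moreover have "C * (2 * (pi - z) / (\<epsilon> * f z) - 1) \<ge> C * \<kappa>"
        using ratio[OF z(1,2)] C(1) by (intro mult_left_mono) auto
      then have "(wt z)\<^sup>2 * (C * (2 * (pi - z) / (\<epsilon> * f z) - 1) - 1) \<ge> 0"
        using C(2) by (intro mult_nonneg_nonneg) auto
      ultimately show "\<exists>D. (W has_real_derivative D) (at z) \<and> 0 \<le> D" by metis
    qed
    moreover have "W y0 \<ge> 0"
      using G_le[of y0] y0 mult_right_mono[OF C(3), of "(wt y0)\<^sup>2"] unfolding W_def by (simp add: mult.assoc)
    ultimately show ?thesis unfolding W_def by simp
  qed
  \<comment> \<open>This inserts the factor that each regime lacks: y for y \<ge> y0, and pi - y for
    y < y0, where \<open>G_le\<close> already suffices.\<close>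
  define C' where "C' = max (1 / (pi - y0)) (C / y0)"
  have C': "C' > 0" "C / y0 \<le> C'" "1 / (pi - y0) \<le> C'"
    using C(1) y0 unfolding C'_def by (auto simp: less_max_iff_disj)
  show ?thesis
  proof (rule that[of C'])
    show "C' > 0" by (rule C')
    fix y :: real assume y: "0 < y" "y < pi"
    show "integral {0..y} (\<lambda>r. (wt r)\<^sup>2) \<le> C' * (y * (pi - y)) * (wt y)\<^sup>2"
    proof (cases "y0 \<le> y")
      case True
      have "C \<le> C' * y"
      proof -
        have "C / y0 * y0 \<le> C' * y"
          using True y0 C' by (intro mult_mono) auto
        then show ?thesis using y0 by simp
      qed
      then have "C * ((pi - y) * (wt y)\<^sup>2) \<le> C' * y * ((pi - y) * (wt y)\<^sup>2)"
        using y by (intro mult_right_mono) auto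
      then show ?thesis using far[OF True y(2)] unfolding G_def by (simp add: mult.assoc)
    next
      case False
      have "1 \<le> C' * (pi - y)"
      proof -
        have "1 / (pi - y0) * (pi - y0) \<le> C' * (pi - y)"
          using False y0 C' by (intro mult_mono) auto
        then show ?thesis using y0 by simp
      qed
      then have "1 * (y * (wt y)\<^sup>2) \<le> C' * (pi - y) * (y * (wt y)\<^sup>2)"
        using y by (intro mult_right_mono) auto
      then show ?thesis using G_le[OF y] unfolding G_def by (simp add: mult_ac)
    qed
  qed
qed

end

section \<open>Square integrable functions on a half interval\<close>

definition L2_half :: "(real \<Rightarrow> complex) \<Rightarrow> bool" where
  "L2_half g \<longleftrightarrow> g absolutely_integrable_on {0..pi} \<and> (\<lambda>x. (cmod (g x))\<^sup>2) integrable_on {0..pi}"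

definition norm_half :: "(real \<Rightarrow> complex) \<Rightarrow> real" where
  "norm_half g = sqrt (integral {0..pi} (\<lambda>x. (cmod (g x))\<^sup>2))"

text \<open>Integrate (Z a - X b)^2 \<ge> 0, where Z is the integral of a b. Working with an upper
  bound X > 0 in place of the integral of a^2 avoids the degenerate case.\<close>

lemma Cauchy_Schwarz_integral:
  fixes a b :: "real \<Rightarrow> real"
  assumes i: "(\<lambda>x. (a x)\<^sup>2) integrable_on S" "(\<lambda>x. (b x)\<^sup>2) integrable_on S" "(\<lambda>x. a x * b x) integrable_on S"
    and X: "integral S (\<lambda>x. (a x)\<^sup>2) \<le> X" "X > 0"
  shows "(integral S (\<lambda>x. a x * b x))\<^sup>2 \<le> X * integral S (\<lambda>x. (b x)\<^sup>2)"
proof -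
  define Z Y where "Z = integral S (\<lambda>x. a x * b x)" and "Y = integral S (\<lambda>x. (b x)\<^sup>2)"
  have "((\<lambda>x. Z\<^sup>2 * (a x)\<^sup>2 - 2 * Z * X * (a x * b x) + X\<^sup>2 * (b x)\<^sup>2) has_integral
      Z\<^sup>2 * integral S (\<lambda>x. (a x)\<^sup>2) - 2 * Z * X * Z + X\<^sup>2 * Y) S"
    unfolding Z_def Y_def
    by (intro has_integral_add has_integral_diff has_integral_mult_right integrable_integral i)
  moreover have "Z\<^sup>2 * (a x)\<^sup>2 - 2 * Z * X * (a x * b x) + X\<^sup>2 * (b x)\<^sup>2 = (Z * a x - X * b x)\<^sup>2" for x
    by (simp add: power2_eq_square algebra_simps)
  ultimately have "0 \<le> Z\<^sup>2 * integral S (\<lambda>x. (a x)\<^sup>2) - 2 * Z * X * Z + X\<^sup>2 * Y"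
    by (metis (no_types, lifting) has_integral_nonneg zero_le_power2)
  also have "\<dots> \<le> Z\<^sup>2 * X - 2 * Z * X * Z + X\<^sup>2 * Y"
    using X(1) by (simp add: mult_left_mono)
  also have "\<dots> = X * (X * Y - Z\<^sup>2)" by (simp add: power2_eq_square algebra_simps)
  finally show ?thesis using X(2) unfolding Z_def Y_def by (simp add: zero_le_mult_iff)
qed

section \<open>The Volterra operator\<close>

text \<open>An integrable majorant of \<open>1 / sqrt (y (\<pi> - y))\<close>, and its primitive.\<close>

definition hw :: "real \<Rightarrow> real" where
  "hw y = 1 / sqrt y + 1 / sqrt (pi - y)"

definition hw_int :: "real \<Rightarrow> real" where
  "hw_int y = 2 * sqrt y - 2 * sqrt (pi - y) + 2 * sqrt pi"

lemma hw_int_deriv: "0 < y \<Longrightarrow> y < pi \<Longrightarrow> (hw_int has_real_derivative hw y) (at y)"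
  unfolding hw_def hw_int_def
  by (auto intro!: derivative_eq_intros simp: field_simps)

lemma hw_int_0: "hw_int 0 = 0"
  unfolding hw_int_def by simp

lemma continuous_on_hw_int: "continuous_on S hw_int"
  unfolding hw_int_def by (intro continuous_intros)

lemma hw_int_mono: "0 \<le> x \<Longrightarrow> x \<le> y \<Longrightarrow> y \<le> pi \<Longrightarrow> hw_int x \<le> hw_int y"
  unfolding hw_int_def using real_sqrt_le_mono[of x y] real_sqrt_le_mono[of "pi - y" "pi - x"] by linarith

lemma hw_int_nonneg: "0 \<le> x \<Longrightarrow> x \<le> pi \<Longrightarrow> 0 \<le> hw_int x"
  using hw_int_mono[of 0 x] hw_int_0 by simp

lemma has_integral_hw_power:
  assumes "0 \<le> x" "x \<le> pi"
  shows "((\<lambda>y. hw y * hw_int y ^ n) has_integral hw_int x ^ Suc n / real (Suc n)) {0..x}"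
proof -
  have "((\<lambda>y. hw_int y ^ Suc n / real (Suc n)) has_real_derivative hw y * hw_int y ^ n) (at y)"
    if y: "y \<in> {0<..<x}" for y
  proof -
    have "0 < y" "y < pi" using y assms by auto
    from DERIV_cdivide[OF DERIV_power[OF hw_int_deriv[OF this], of "Suc n"], of "real (Suc n)"]
    show ?thesis by (simp add: field_simps del: of_nat_Suc)
  qed
  then have "((\<lambda>y. hw y * hw_int y ^ n) has_integral
      hw_int x ^ Suc n / real (Suc n) - hw_int 0 ^ Suc n / real (Suc n)) {0..x}"
    using assms by (intro fundamental_theorem_of_calculus_interior continuous_intros continuous_on_hw_int)
      (auto simp: has_real_derivative_iff_has_vector_derivative)
  then show ?thesis by (simp add: hw_int_0)
qed

text \<open>After multiplication by the common denominator this says 1 \<le> sqrt y + sqrt (pi - y),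
  and the square of the right side is at least pi.\<close>

lemma inverse_sqrt_le_hw:
  assumes "0 < y" "y < pi"
  shows "1 / sqrt (y * (pi - y)) \<le> hw y"
proof -
  have "(sqrt y + sqrt (pi - y))\<^sup>2 = pi + 2 * (sqrt y * sqrt (pi - y))"
    using assms by (simp add: power2_sum)
  also have "\<dots> \<ge> 1\<^sup>2" using assms pi_gt3 by (simp add: add_nonneg_nonneg order_trans[of 1 pi])
  finally have "1 \<le> sqrt y + sqrt (pi - y)"
    using assms by (intro power2_le_imp_le[of 1]) auto
  then have "1 / (sqrt y * sqrt (pi - y)) \<le> (sqrt y + sqrt (pi - y)) / (sqrt y * sqrt (pi - y))"
    using assms by (intro divide_right_mono) auto
  also have "\<dots> = hw y"
    using assms unfolding hw_def by (simp add: add_divide_distrib add.commute)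
  finally show ?thesis by (simp add: real_sqrt_mult)
qed

lemma L2_halfD: "L2_half g \<Longrightarrow> y \<le> pi \<Longrightarrow> g absolutely_integrable_on {0..y}"
  "L2_half g \<Longrightarrow> y \<le> pi \<Longrightarrow> (\<lambda>x. (cmod (g x))\<^sup>2) integrable_on {0..y}"
  unfolding L2_half_def
  by (auto intro: absolutely_integrable_on_subinterval integrable_on_subinterval)

lemma L2_half_continuous: "continuous_on {0..pi} g \<Longrightarrow> L2_half g"
  unfolding L2_half_def
  by (intro conjI absolutely_integrable_continuous_real integrable_continuous_real continuous_intros)

lemma L2_half_measurable: "L2_half g \<Longrightarrow> g \<in> borel_measurable (lebesgue_on {0..pi})"
  unfolding L2_half_def by (auto intro: absolutely_integrable_imp_borel_measurable)

lemma L2_halfI: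
  assumes "g \<in> borel_measurable (lebesgue_on {0..pi})" "(\<lambda>x. (cmod (g x))\<^sup>2) integrable_on {0..pi}"
  shows "L2_half g"
proof -
  have "g absolutely_integrable_on {0..pi}"
  proof (rule measurable_bounded_by_integrable_imp_absolutely_integrable[OF assms(1)])
    show "(\<lambda>x. 1 + (cmod (g x))\<^sup>2) integrable_on {0..pi}"
      by (intro integrable_add assms integrable_const_ivl)
    fix x
    have "0 \<le> (cmod (g x) - 1)\<^sup>2 + cmod (g x)" by simp
    then show "cmod (g x) \<le> 1 + (cmod (g x))\<^sup>2"
      by (simp add: power2_diff)
  qed simp
  then show ?thesis using assms unfolding L2_half_def by simp
qed

lemma L2_half_cmult: "L2_half g \<Longrightarrow> L2_half (\<lambda>x. c * g x)"
  unfolding L2_half_def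
  by (auto simp: norm_mult power_mult_distrib intro: set_integrable_mult_right integrable_on_mult_right)

lemma L2_half_add:
  assumes "L2_half g" "L2_half h"
  shows "L2_half (\<lambda>x. g x + h x)"
proof (rule L2_halfI)
  show m: "(\<lambda>x. g x + h x) \<in> borel_measurable (lebesgue_on {0..pi})"
    using assms by (intro borel_measurable_add L2_half_measurable)
  have "(\<lambda>x. (cmod (g x + h x))\<^sup>2) absolutely_integrable_on {0..pi}"
  proof (rule measurable_bounded_by_integrable_imp_absolutely_integrable)
    show "(\<lambda>x. (cmod (g x + h x))\<^sup>2) \<in> borel_measurable (lebesgue_on {0..pi})"
      using m by measurable
    show "(\<lambda>x. 2 * (cmod (g x))\<^sup>2 + 2 * (cmod (h x))\<^sup>2) integrable_on {0..pi}"
      using assms unfolding L2_half_def by (intro integrable_add integrable_on_mult_right) auto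
    fix x
    have "(cmod (g x + h x))\<^sup>2 \<le> (cmod (g x) + cmod (h x))\<^sup>2"
      by (intro power_mono norm_triangle_ineq) auto
    also have "\<dots> \<le> 2 * (cmod (g x))\<^sup>2 + 2 * (cmod (h x))\<^sup>2"
      using sum_squares_bound[of "cmod (g x)" "cmod (h x)"] by (simp add: power2_sum)
    finally show "norm ((cmod (g x + h x))\<^sup>2) \<le> 2 * (cmod (g x))\<^sup>2 + 2 * (cmod (h x))\<^sup>2" by simp
  qed simp
  then show "(\<lambda>x. (cmod (g x + h x))\<^sup>2) integrable_on {0..pi}"
    by (simp add: absolutely_integrable_on_def)
qed

lemma integral_le_norm_half:
  assumes "L2_half g" "0 \<le> y" "y \<le> pi"
  shows "integral {0..y} (\<lambda>x. (cmod (g x))\<^sup>2) \<le> (norm_half g)\<^sup>2"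
proof -
  have "integral {0..y} (\<lambda>x. (cmod (g x))\<^sup>2) \<le> integral {0..pi} (\<lambda>x. (cmod (g x))\<^sup>2)"
    using assms L2_halfD(2)[OF assms(1)] by (intro integral_subset_le) auto
  moreover have "0 \<le> integral {0..pi} (\<lambda>x. (cmod (g x))\<^sup>2)"
    by (rule Henstock_Kurzweil_Integration.integral_nonneg[OF L2_halfD(2)[OF assms(1)]]) auto
  ultimately show ?thesis unfolding norm_half_def by simp
qed

lemma norm_half_nonneg: "L2_half g \<Longrightarrow> 0 \<le> norm_half g"
  unfolding norm_half_def using L2_halfD(2)[of g pi]
  by (auto intro!: Henstock_Kurzweil_Integration.integral_nonneg)

context singular_ode
begin

text \<open>For a solution u of \<epsilon> (f u')' + u' = g whose flux f u' vanishes at 0,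
  \<open>J g\<close> is \<epsilon> \<open>wt\<close> f u', \<open>JP g\<close> is u', and
  \<open>K g\<close> is u - u(0).\<close>

definition J :: "(real \<Rightarrow> complex) \<Rightarrow> real \<Rightarrow> complex" where
  "J g y = integral {0..y} (\<lambda>r. of_real (wt r) * g r)"

definition JP :: "(real \<Rightarrow> complex) \<Rightarrow> real \<Rightarrow> complex" where
  "JP g y = J g y / of_real (\<epsilon> * wt y * f y)"

definition K :: "(real \<Rightarrow> complex) \<Rightarrow> real \<Rightarrow> complex" where
  "K g x = integral {0..x} (JP g)"

lemma wt_mult_integrable:
  fixes g :: "real \<Rightarrow> complex"
  assumes "g absolutely_integrable_on {0..y}" "y < pi"
  shows "(\<lambda>x. of_real (wt x) * g x) absolutely_integrable_on {0..y}"
  using wt_scaleR_integrable[OF assms] by (simp add: scaleR_conv_of_real)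

text \<open>Cauchy-Schwarz combined with the estimate for the integral of the squared weight.
  Measured against \<open>wt y\<close>, the bound is of order sqrt (y (pi - y)).\<close>

lemma J_bound_L2:
  assumes C: "\<And>y. 0 < y \<Longrightarrow> y < pi \<Longrightarrow> integral {0..y} (\<lambda>r. (wt r)\<^sup>2) \<le> C * (y * (pi - y)) * (wt y)\<^sup>2" "C > 0"
    and g: "L2_half g" and y: "0 < y" "y < pi"
  shows "cmod (J g y) \<le> sqrt C * sqrt (y * (pi - y)) * wt y * norm_half g"
proof -
  have gi: "g absolutely_integrable_on {0..y}" using L2_halfD(1)[OF g] y by simp
  have i: "(\<lambda>x. of_real (wt x) * g x) absolutely_integrable_on {0..y}"
    using gi y(2) by (rule wt_mult_integrable)
  have i': "(\<lambda>x. wt x * cmod (g x)) integrable_on {0..y}"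
  proof -
    have "(\<lambda>x. wt x *\<^sub>R cmod (g x)) absolutely_integrable_on {0..y}"
      using absolutely_integrable_norm[OF gi] y(2) by (intro wt_scaleR_integrable) (auto simp: comp_def)
    then show ?thesis by (simp add: absolutely_integrable_on_def)
  qed
  have "cmod (J g y) \<le> integral {0..y} (\<lambda>x. wt x * cmod (g x))"
    unfolding J_def
  proof (rule integral_norm_bound_integral)
    show "(\<lambda>x. of_real (wt x) * g x) integrable_on {0..y}"
      using i by (simp add: absolutely_integrable_on_def)
    show "cmod (of_real (wt x) * g x) \<le> wt x * cmod (g x)" if "x \<in> {0..y}" for x
      using that y wt_nonneg[of x] by (simp add: norm_mult)
  qed (rule i')
  moreover have "(integral {0..y} (\<lambda>x. wt x * cmod (g x)))\<^sup>2
      \<le> (C * (y * (pi - y)) * (wt y)\<^sup>2) * integral {0..y} (\<lambda>x. (cmod (g x))\<^sup>2)"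
    using y wt_square_integrable L2_halfD(2)[OF g] C wt_pos[OF y]
    by (intro Cauchy_Schwarz_integral i') auto
  then have "(integral {0..y} (\<lambda>x. wt x * cmod (g x)))\<^sup>2 \<le> (C * (y * (pi - y)) * (wt y)\<^sup>2) * (norm_half g)\<^sup>2"
    using integral_le_norm_half[OF g, of y] y C(2)
    by (meson order_trans mult_left_mono mult_nonneg_nonneg less_imp_le diff_ge_0_iff_ge zero_le_power2)
  then have "sqrt ((integral {0..y} (\<lambda>x. wt x * cmod (g x)))\<^sup>2) \<le> sqrt ((C * (y * (pi - y)) * (wt y)\<^sup>2) * (norm_half g)\<^sup>2)"
    by (rule real_sqrt_le_mono)
  then have "integral {0..y} (\<lambda>x. wt x * cmod (g x)) \<le> sqrt C * sqrt (y * (pi - y)) * wt y * norm_half g"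
    using wt_pos[OF y] norm_half_nonneg[OF g] by (simp add: real_sqrt_mult)
  ultimately show ?thesis by linarith
qed

lemma P_pos: "0 < y \<Longrightarrow> y < pi \<Longrightarrow> 0 < \<epsilon> * wt y * f y"
  using eps wt_pos f_pos by simp

definition KC :: real where
  "KC = (SOME C. 0 < C \<and> (\<forall>g y. L2_half g \<longrightarrow> 0 < y \<longrightarrow> y < pi \<longrightarrow> cmod (JP g y) \<le> C * norm_half g * hw y))"

text \<open>\<open>J g\<close> is at most of size sqrt (y (pi - y)) \<open>wt y\<close>, and f is at
  least of size y (pi - y). In the quotient the weight cancels, and 1 / sqrt (y (pi - y)) is left,
  which is integrable at both ends.\<close>

lemma KC_properties: "0 < KC" "\<And>g y. L2_half g \<Longrightarrow> 0 < y \<Longrightarrow> y < pi \<Longrightarrow> cmod (JP g y) \<le> KC * norm_half g * hw y"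
proof -
  obtain C where C: "C > 0" "\<And>y. 0 < y \<Longrightarrow> y < pi \<Longrightarrow> integral {0..y} (\<lambda>r. (wt r)\<^sup>2) \<le> C * (y * (pi - y)) * (wt y)\<^sup>2"
    using wt_square_integral_bound by blast
  obtain c where c: "c > 0" "\<And>x. 0 < x \<Longrightarrow> x < pi \<Longrightarrow> c * (x * (pi - x)) \<le> f x"
    using f_lower by blast
  define B where "B = sqrt C / (\<epsilon> * c)"
  have B: "B > 0" unfolding B_def using C c eps by simp
  have "cmod (JP g y) \<le> B * norm_half g * hw y" if g: "L2_half g" and y: "0 < y" "y < pi" for g y
  proof -
    define s where "s = sqrt (y * (pi - y))"
    have s: "s > 0" "s * s = y * (pi - y)" unfolding s_def using y by auto
    have "cmod (JP g y) = cmod (J g y) / (\<epsilon> * wt y * f y)"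
      unfolding JP_def using P_pos[OF y] by (simp add: norm_divide del: of_real_mult)
    also have "\<dots> \<le> (sqrt C * s * wt y * norm_half g) / (\<epsilon> * wt y * f y)"
      using J_bound_L2[OF C(2,1) g y] P_pos[OF y] unfolding s_def by (intro divide_right_mono) auto
    also have "\<dots> = (sqrt C * s * norm_half g) / (\<epsilon> * f y)"
      using wt_pos[OF y] by (simp add: field_simps)
    also have "\<dots> \<le> (sqrt C * s * norm_half g) / (\<epsilon> * (c * (s * s)))"
    proof (rule frac_le)
      show "0 < \<epsilon> * (c * (s * s))" using c(1) eps s(1) by simp
      show "\<epsilon> * (c * (s * s)) \<le> \<epsilon> * f y" using c(2)[OF y] eps s(2) by simp
    qed (use s norm_half_nonneg[OF g] C(1) in auto)
    also have "\<dots> = B * norm_half g * (1 / s)"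
      using s(1) unfolding B_def by (simp add: field_simps)
    also have "\<dots> \<le> B * norm_half g * hw y"
      using inverse_sqrt_le_hw[OF y] B norm_half_nonneg[OF g] unfolding s_def by (intro mult_left_mono) auto
    finally show ?thesis .
  qed
  with B have "0 < B \<and> (\<forall>g y. L2_half g \<longrightarrow> 0 < y \<longrightarrow> y < pi \<longrightarrow> cmod (JP g y) \<le> B * norm_half g * hw y)" by blast
  then have "0 < KC \<and> (\<forall>g y. L2_half g \<longrightarrow> 0 < y \<longrightarrow> y < pi \<longrightarrow> cmod (JP g y) \<le> KC * norm_half g * hw y)"
    unfolding KC_def by (rule someI)
  then show "0 < KC" "\<And>g y. L2_half g \<Longrightarrow> 0 < y \<Longrightarrow> y < pi \<Longrightarrow> cmod (JP g y) \<le> KC * norm_half g * hw y"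
    by blast+
qed

lemma J_primitive:
  assumes "L2_half g"
  shows "primitive_on {0..<pi} (J g) (\<lambda>r. of_real (wt r) * g r)"
  unfolding primitive_on_def
proof (intro ballI impI conjI)
  fix a b assume ab: "a \<in> {0..<pi}" "b \<in> {0..<pi}" "a \<le> b"
  have i: "(\<lambda>r. of_real (wt r) * g r) absolutely_integrable_on {0..b}"
    using ab L2_halfD(1)[OF assms] by (intro wt_mult_integrable) auto
  then show "(\<lambda>r. of_real (wt r) * g r) absolutely_integrable_on {a..b}"
    by (rule absolutely_integrable_on_subinterval) (use ab in auto)
  show "J g b - J g a = integral {a..b} (\<lambda>r. of_real (wt r) * g r)"
    using Henstock_Kurzweil_Integration.integral_combine[of 0 a b "\<lambda>r. of_real (wt r) * g r"] i ab
    unfolding J_def by (auto simp: absolutely_integrable_on_def algebra_simps)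
qed

lemma J_continuous:
  assumes "L2_half g" "b < pi"
  shows "continuous_on {0..b} (J g)"
  by (rule primitive_on_continuous, rule primitive_on_subset[OF J_primitive[OF assms(1)]]) (use assms in auto)

lemma continuous_on_Ioo_if_Icc:
  fixes h :: "real \<Rightarrow> 'z::topological_space"
  assumes "\<And>b. b < pi \<Longrightarrow> continuous_on {0..b} h"
  shows "continuous_on {0<..<pi} h"
proof (rule continuous_at_imp_continuous_on, rule)
  fix x :: real assume x: "x \<in> {0<..<pi}"
  then obtain b where b: "x < b" "b < pi" using dense by auto
  then have "continuous (at x within {0..b}) h"
    using assms[of b] x by (simp add: continuous_on_eq_continuous_within)
  then show "isCont h x" using at_within_Icc_at[of 0 x b] x b by simp
qed

lemma JP_integrable:
  assumes g: "L2_half g"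
  shows "JP g absolutely_integrable_on {0..pi}"
proof -
  have c: "continuous_on {0<..<pi} (\<lambda>y. complex_of_real (\<epsilon> * wt y * f y))"
    by (intro continuous_on_of_real continuous_on_mult continuous_on_const continuous_at_imp_continuous_on ballI isCont_wt isCont_f)
      auto
  have "continuous_on {0<..<pi} (\<lambda>y. J g y / of_real (\<epsilon> * wt y * f y))"
  proof (rule continuous_on_divide[OF continuous_on_Ioo_if_Icc[OF J_continuous[OF g]] c])
    show "\<forall>y\<in>{0<..<pi}. complex_of_real (\<epsilon> * wt y * f y) \<noteq> 0"
      using P_pos by (metis greaterThanLessThan_iff less_irrefl of_real_eq_0_iff)
  qed
  then have "continuous_on {0<..<pi} (JP g)" by (simp add: JP_def[abs_def])
  then have m: "JP g \<in> borel_measurable (lebesgue_on {0<..<pi})"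
    by (intro continuous_imp_measurable_on_sets_lebesgue) auto
  have "(\<lambda>y. KC * norm_half g * hw y) integrable_on {0..pi}"
    using has_integral_hw_power[of pi 0] by (intro integrable_on_mult_right) auto
  then have "(\<lambda>y. KC * norm_half g * hw y) integrable_on {0<..<pi}"
    by (simp add: integrable_on_Icc_iff_Ioo)
  then have "JP g absolutely_integrable_on {0<..<pi}"
    by (rule measurable_bounded_by_integrable_imp_absolutely_integrable[OF m, rotated])
      (use KC_properties(2)[OF g] in auto)
  then show ?thesis by (simp add: absolutely_integrable_on_Icc_iff_Ioo)
qed

lemma K_primitive:
  assumes g: "L2_half g"
  shows "primitive_on {0..pi} (K g) (JP g)"
  unfolding primitive_on_def
proof (intro ballI impI conjI)
  fix a b assume ab: "a \<in> {0..pi}" "b \<in> {0..pi}" "a \<le> b"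
  have i: "JP g absolutely_integrable_on {0..b}"
    using absolutely_integrable_on_subinterval[OF JP_integrable[OF g]] ab by simp
  then show "JP g absolutely_integrable_on {a..b}"
    by (rule absolutely_integrable_on_subinterval) (use ab in auto)
  show "K g b - K g a = integral {a..b} (JP g)"
    using Henstock_Kurzweil_Integration.integral_combine[of 0 a b "JP g"] i ab
    unfolding K_def by (auto simp: absolutely_integrable_on_def algebra_simps)
qed

lemma K_continuous: "L2_half g \<Longrightarrow> continuous_on {0..pi} (K g)"
  by (rule primitive_on_continuous[OF K_primitive])

lemma K_0: "K g 0 = 0" and J_0: "J g 0 = 0"
  unfolding K_def J_def by simp_all

lemma K_bound_L2:
  assumes g: "L2_half g" and x: "0 \<le> x" "x \<le> pi"
  shows "cmod (K g x) \<le> KC * norm_half g * hw_int pi"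
proof -
  have "cmod (K g x) \<le> integral {0..x} (\<lambda>y. KC * norm_half g * (hw y * hw_int y ^ 0))"
    unfolding K_def integral_open_interval_real[of 0 x]
  proof (rule integral_norm_bound_integral)
    show "JP g integrable_on {0<..<x}"
      using absolutely_integrable_on_subinterval[OF JP_integrable[OF g], of 0 x] x
      by (auto simp: absolutely_integrable_on_def integrable_on_Icc_iff_Ioo)
    have "(\<lambda>y. KC * norm_half g * (hw y * hw_int y ^ 0)) integrable_on {0..x}"
      using has_integral_hw_power[OF x, of 0] by (intro integrable_on_mult_right) blast
    then show "(\<lambda>y. KC * norm_half g * (hw y * hw_int y ^ 0)) integrable_on {0<..<x}"
      by (simp add: integrable_on_Icc_iff_Ioo)
  qed (use KC_properties(2)[OF g] x in auto)
  also have "\<dots> = KC * norm_half g * hw_int x"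
    using integral_unique[OF has_integral_mult_right[OF has_integral_hw_power[OF x, of 0]], of "KC * norm_half g"] by simp
  also have "\<dots> \<le> KC * norm_half g * hw_int pi"
    using KC_properties(1) norm_half_nonneg[OF g] hw_int_mono[of x pi] x by (intro mult_left_mono) auto
  finally show ?thesis .
qed

lemma J_bound:
  assumes g: "L2_half g" and y: "0 \<le> y" "y < pi" and B: "\<And>r. 0 < r \<Longrightarrow> r < y \<Longrightarrow> cmod (g r) \<le> B"
  shows "cmod (J g y) \<le> B * integral {0..y} wt"
proof -
  have "cmod (J g y) \<le> integral {0..y} (\<lambda>r. B * wt r)"
    unfolding J_def integral_open_interval_real[of 0 y]
  proof (rule integral_norm_bound_integral)
    show "(\<lambda>r. of_real (wt r) * g r) integrable_on {0<..<y}"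
      using wt_mult_integrable[OF L2_halfD(1)[OF g]] y
      by (auto simp: absolutely_integrable_on_def integrable_on_Icc_iff_Ioo)
    show "(\<lambda>r. B * wt r) integrable_on {0<..<y}"
      using wt_square_integrable(2)[OF y(2)] by (auto simp: integrable_on_Icc_iff_Ioo[symmetric] intro!: integrable_on_mult_right)
    show "cmod (of_real (wt r) * g r) \<le> B * wt r" if "r \<in> {0<..<y}" for r
      using B[of r] that y wt_nonneg[of r] mult_right_mono[of "cmod (g r)" B "wt r"] by (auto simp: norm_mult mult.commute)
  qed
  then show ?thesis by simp
qed

lemma integral_wt_le: "0 \<le> y \<Longrightarrow> y < pi \<Longrightarrow> integral {0..y} wt \<le> y * wt y"
proof -
  assume y: "0 \<le> y" "y < pi"
  have "integral {0..y} wt \<le> integral {0..y} (\<lambda>_. wt y)"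
    using y wt_square_integrable(2)[OF y(2)] by (intro integral_le) (auto intro!: wt_mono)
  then show ?thesis using y by simp
qed

text \<open>The constant in the bound of \<open>JP\<close> for the constant function 1. It
  propagates sup bounds, which the iteration of \<open>K\<close> requires, whereas \<open>KC\<close>
  converts an L2 norm into a sup bound.\<close>

definition KB :: real where "KB = KC * norm_half (\<lambda>_. 1)"

lemma KB_nonneg: "0 \<le> KB"
  unfolding KB_def using KC_properties(1) norm_half_nonneg[OF L2_half_continuous] by auto

lemma integral_wt_bound:
  assumes y: "0 < y" "y < pi"
  shows "integral {0..y} wt / (\<epsilon> * wt y * f y) \<le> KB * hw y"
proof -
  have "J (\<lambda>_. 1) y = of_real (integral {0..y} wt)"
    unfolding J_def using wt_square_integrable(2)[OF y(2)]
    by (metis (mono_tags, lifting) has_integral_of_real integrable_integral integral_unique mult.right_neutral integral_cong)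
  moreover have "integral {0..y} wt \<ge> 0"
    using y wt_square_integrable(2)[OF y(2)] by (intro Henstock_Kurzweil_Integration.integral_nonneg) (auto intro: wt_nonneg)
  ultimately have "cmod (JP (\<lambda>_. 1) y) = integral {0..y} wt / (\<epsilon> * wt y * f y)"
    unfolding JP_def using P_pos[OF y] by (simp add: norm_divide del: of_real_mult)
  then show ?thesis using KC_properties(2)[OF L2_half_continuous y, of "\<lambda>_. 1"] unfolding KB_def by simp
qed

text \<open>The Volterra gain: iterating \<open>K\<close> produces the factors \<open>1 / n!\<close>.\<close>

lemma K_bound_power:
  assumes g: "L2_half g" and B: "\<And>r. 0 \<le> r \<Longrightarrow> r \<le> pi \<Longrightarrow> cmod (g r) \<le> B * hw_int r ^ n" "B \<ge> 0"
    and x: "0 \<le> x" "x \<le> pi"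
  shows "cmod (K g x) \<le> B * KB / real (Suc n) * hw_int x ^ Suc n"
proof -
  have bound: "cmod (JP g y) \<le> B * KB * (hw y * hw_int y ^ n)" if y: "0 < y" "y < pi" for y
  proof -
    \<comment> \<open>As \<open>hw_int\<close> is increasing, its value at y majorizes the bound for
      g on (0, y) and leaves a multiple of the integral of \<open>wt\<close>. The remaining factor
      \<open>hw y * hw_int y ^ n\<close> integrates exactly and supplies the division by n +
      1.\<close>
    have "cmod (J g y) \<le> (B * hw_int y ^ n) * integral {0..y} wt"
    proof (rule J_bound[OF g])
      fix r assume r: "0 < r" "r < y"
      have "cmod (g r) \<le> B * hw_int r ^ n" using B(1)[of r] r y by simp
      also have "\<dots> \<le> B * hw_int y ^ n"
        using r y B(2) by (intro mult_left_mono power_mono hw_int_mono hw_int_nonneg) auto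
      finally show "cmod (g r) \<le> B * hw_int y ^ n" .
    qed (use y in auto)
    then have "cmod (JP g y) \<le> (B * hw_int y ^ n) * integral {0..y} wt / (\<epsilon> * wt y * f y)"
      unfolding JP_def using P_pos[OF y] by (simp add: norm_divide divide_right_mono del: of_real_mult)
    also have "\<dots> = (B * hw_int y ^ n) * (integral {0..y} wt / (\<epsilon> * wt y * f y))" by simp
    also have "\<dots> \<le> (B * hw_int y ^ n) * (KB * hw y)"
      using integral_wt_bound[OF y] B(2) hw_int_nonneg[of y] y by (intro mult_left_mono) auto
    finally show ?thesis by (simp add: mult_ac)
  qed
  have "cmod (K g x) \<le> integral {0..x} (\<lambda>y. B * KB * (hw y * hw_int y ^ n))"
    unfolding K_def integral_open_interval_real[of 0 x]
  proof (rule integral_norm_bound_integral)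
    show "JP g integrable_on {0<..<x}"
      using absolutely_integrable_on_subinterval[OF JP_integrable[OF g], of 0 x] x
      by (auto simp: absolutely_integrable_on_def integrable_on_Icc_iff_Ioo)
    have "(\<lambda>y. B * KB * (hw y * hw_int y ^ n)) integrable_on {0..x}"
      using has_integral_hw_power[OF x, of n] by (intro integrable_on_mult_right) blast
    then show "(\<lambda>y. B * KB * (hw y * hw_int y ^ n)) integrable_on {0<..<x}"
      by (simp add: integrable_on_Icc_iff_Ioo)
  qed (use bound x in auto)
  also have "\<dots> = B * KB * (hw_int x ^ Suc n / real (Suc n))"
    by (rule integral_unique[OF has_integral_mult_right[OF has_integral_hw_power[OF x]]])
  finally show ?thesis by simp
qed

lemma J_add: "L2_half g \<Longrightarrow> L2_half h \<Longrightarrow> y < pi \<Longrightarrow> J (\<lambda>x. g x + h x) y = J g y + J h y"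
  unfolding J_def distrib_left
  using wt_mult_integrable L2_halfD(1)
  by (intro Henstock_Kurzweil_Integration.integral_add) (auto simp: absolutely_integrable_on_def)

lemma J_cmult: "J (\<lambda>x. c * g x) y = c * J g y"
  unfolding J_def by (simp add: mult.left_commute)

lemma K_add:
  assumes "L2_half g" "L2_half h" "x \<le> pi"
  shows "K (\<lambda>x. g x + h x) x = K g x + K h x"
proof -
  have "integral {0<..<x} (JP (\<lambda>x. g x + h x)) = integral {0<..<x} (\<lambda>y. JP g y + JP h y)"
    using assms J_add unfolding JP_def by (intro integral_cong) (auto simp: add_divide_distrib)
  then have "K (\<lambda>x. g x + h x) x = integral {0..x} (\<lambda>y. JP g y + JP h y)"
    unfolding K_def integral_open_interval_real[of 0 x] .
  also have "\<dots> = K g x + K h x"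
    unfolding K_def using absolutely_integrable_on_subinterval[OF JP_integrable, of _ 0 x] assms
    by (intro Henstock_Kurzweil_Integration.integral_add) (auto simp: absolutely_integrable_on_def)
  finally show ?thesis .
qed

lemma K_cmult: "K (\<lambda>x. c * g x) x = c * K g x"
  unfolding K_def JP_def J_cmult by (simp flip: times_divide_eq_right)

lemma J_cong:
  assumes "negligible N" "\<And>x. x \<in> {0..pi} - N \<Longrightarrow> g x = h x" "y \<le> pi"
  shows "J g y = J h y"
  unfolding J_def by (rule integral_spike[OF assms(1)]) (use assms in auto)

lemma K_cong:
  assumes "negligible N" "\<And>x. x \<in> {0..pi} - N \<Longrightarrow> g x = h x" "x \<le> pi"
  shows "K g x = K h x"
  unfolding K_def
  by (rule integral_cong) (use J_cong[OF assms(1,2)] assms(3) in \<open>auto simp: JP_def\<close>)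

end

section \<open>Solutions of the Volterra equation\<close>

context singular_ode
begin

lemma continuous_K_power:
  assumes "continuous_on {0..pi} y0"
  shows "continuous_on {0..pi} ((K ^^ n) y0)"
  using assms by (induction n) (auto intro: K_continuous L2_half_continuous)

lemma K_power_bound:
  assumes y0: "continuous_on {0..pi} y0" and B: "\<And>x. 0 \<le> x \<Longrightarrow> x \<le> pi \<Longrightarrow> cmod (y0 x) \<le> B" "B \<ge> 0"
    and x: "0 \<le> x" "x \<le> pi"
  shows "cmod ((K ^^ n) y0 x) \<le> B * KB ^ n / fact n * hw_int x ^ n"
  using x
proof (induction n arbitrary: x)
  case (Suc n)
  have "cmod (K ((K ^^ n) y0) x) \<le> B * KB ^ n / fact n * KB / real (Suc n) * hw_int x ^ Suc n"
    using Suc B(2) KB_nonneg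
    by (intro K_bound_power L2_half_continuous continuous_K_power y0) auto
  then show ?case by (simp add: field_simps)
qed (use B in auto)

definition KM :: real where "KM = KB * hw_int pi"

lemma KM_nonneg: "0 \<le> KM"
  unfolding KM_def using KB_nonneg hw_int_nonneg[of pi] by simp

lemma K_power_bound':
  assumes y0: "continuous_on {0..pi} y0" and B: "\<And>x. 0 \<le> x \<Longrightarrow> x \<le> pi \<Longrightarrow> cmod (y0 x) \<le> B" "B \<ge> 0"
    and x: "0 \<le> x" "x \<le> pi"
  shows "cmod (z ^ n * (K ^^ n) y0 x) \<le> B * ((cmod z * KM) ^ n / fact n)"
proof -
  have "cmod ((K ^^ n) y0 x) \<le> B * KB ^ n / fact n * hw_int x ^ n"
    by (rule K_power_bound[OF assms])
  also have "\<dots> \<le> B * KB ^ n / fact n * hw_int pi ^ n"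
    using B(2) KB_nonneg x hw_int_nonneg hw_int_mono by (intro mult_left_mono power_mono) auto
  also have "\<dots> = B * (KM ^ n / fact n)"
    unfolding KM_def by (simp add: power_mult_distrib)
  finally have "cmod z ^ n * cmod ((K ^^ n) y0 x) \<le> cmod z ^ n * (B * (KM ^ n / fact n))"
    by (intro mult_left_mono) auto
  then show ?thesis by (simp add: norm_mult norm_power power_mult_distrib mult_ac)
qed

text \<open>The Neumann series of the inverse of 1 - z K, applied to \<open>y0\<close>.\<close>

definition S :: "complex \<Rightarrow> (real \<Rightarrow> complex) \<Rightarrow> real \<Rightarrow> complex" where
  "S z y0 x = (\<Sum>n. z ^ n * (K ^^ n) y0 x)"

lemma exp_series:
  fixes t :: real
  shows "(\<lambda>n. B * (t ^ n / fact n)) sums (B * exp t)"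
  using sums_mult[OF exp_converges[of t], of B] by (simp add: divide_inverse mult.commute)

lemma continuous_bounded:
  assumes "continuous_on {0..pi} (g :: real \<Rightarrow> complex)"
  obtains B where "B \<ge> 0" "\<And>x. 0 \<le> x \<Longrightarrow> x \<le> pi \<Longrightarrow> cmod (g x) \<le> B"
proof -
  have "bounded (g ` {0..pi})"
    using assms by (intro compact_imp_bounded compact_continuous_image) auto
  then obtain B where "B > 0" "\<forall>x\<in>g ` {0..pi}. cmod x \<le> B" unfolding bounded_pos by blast
  then show ?thesis using that[of B] by auto
qed

lemma S_sums:
  assumes y0: "continuous_on {0..pi} y0" and x: "0 \<le> x" "x \<le> pi"
  shows "(\<lambda>n. z ^ n * (K ^^ n) y0 x) sums S z y0 x"
proof -
  obtain B where B: "B \<ge> 0" "\<And>x. 0 \<le> x \<Longrightarrow> x \<le> pi \<Longrightarrow> cmod (y0 x) \<le> B"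
    using continuous_bounded[OF y0] by blast
  have "summable (\<lambda>n. z ^ n * (K ^^ n) y0 x)"
    by (rule summable_comparison_test'[OF sums_summable[OF exp_series[of B "cmod z * KM"]]])
      (rule K_power_bound'[OF y0 B(2,1) x])
  then show ?thesis unfolding S_def by (rule summable_sums)
qed

lemma S_bound:
  assumes y0: "continuous_on {0..pi} y0" and B: "\<And>x. 0 \<le> x \<Longrightarrow> x \<le> pi \<Longrightarrow> cmod (y0 x) \<le> B" "B \<ge> 0"
    and x: "0 \<le> x" "x \<le> pi"
  shows "cmod (S z y0 x) \<le> B * exp (cmod z * KM)"
  unfolding S_def sums_unique[OF exp_series]
  by (intro norm_suminf_le sums_summable[OF exp_series] K_power_bound'[OF assms])

lemma S_uniform_limit:
  assumes y0: "continuous_on {0..pi} y0"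
  shows "uniform_limit {0..pi} (\<lambda>N x. \<Sum>n<N. z ^ n * (K ^^ n) y0 x) (S z y0) sequentially"
proof -
  obtain B where B: "B \<ge> 0" "\<And>x. 0 \<le> x \<Longrightarrow> x \<le> pi \<Longrightarrow> cmod (y0 x) \<le> B"
    using continuous_bounded[OF y0] by blast
  show ?thesis
    unfolding S_def[abs_def]
    by (rule Weierstrass_m_test[OF K_power_bound'[OF y0 B(2,1)] sums_summable[OF exp_series]]) auto
qed

lemma S_continuous:
  assumes y0: "continuous_on {0..pi} y0"
  shows "continuous_on {0..pi} (S z y0)"
  by (rule uniform_limit_theorem[OF _ S_uniform_limit[OF y0]])
    (auto intro!: always_eventually continuous_intros continuous_K_power y0)

lemma K_sum:
  fixes N :: nat
  assumes "\<And>n. L2_half (g n)" "x \<le> pi"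
  shows "K (\<lambda>x. \<Sum>n<N. c n * g n x) x = (\<Sum>n<N. c n * K (g n) x) \<and> L2_half (\<lambda>x. \<Sum>n<N. c n * g n x)"
proof (induction N)
  case 0
  then show ?case using K_cmult[of 0 "\<lambda>_. 0" x] by (simp add: L2_half_continuous)
next
  case (Suc N)
  have "L2_half (\<lambda>x. c N * g N x)" using assms(1) by (rule L2_half_cmult)
  with Suc show ?case using assms by (simp add: K_add K_cmult L2_half_add)
qed

lemma K_diff:
  assumes "L2_half g" "L2_half h" "x \<le> pi"
  shows "K (\<lambda>x. g x - h x) x = K g x - K h x"
  using K_add[OF assms(1) L2_half_cmult[OF assms(2), of "-1"] assms(3)] K_cmult[of "-1" h x] by simp

lemma L2_half_diff: "L2_half g \<Longrightarrow> L2_half h \<Longrightarrow> L2_half (\<lambda>x. g x - h x)"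
  using L2_half_add[OF _ L2_half_cmult[of h "-1"]] by simp

lemma K_bound:
  assumes g: "L2_half g" and B: "\<And>r. 0 \<le> r \<Longrightarrow> r \<le> pi \<Longrightarrow> cmod (g r) \<le> B" "B \<ge> 0" and x: "0 \<le> x" "x \<le> pi"
  shows "cmod (K g x) \<le> B * KM"
proof -
  have "cmod (K g x) \<le> B * KB / real (Suc 0) * hw_int x ^ Suc 0"
    using B by (intro K_bound_power[OF g _ _ x]) auto
  also have "\<dots> \<le> B * KB * hw_int pi"
    using B(2) KB_nonneg x hw_int_mono[of x pi] by (simp add: mult_left_mono)
  finally show ?thesis unfolding KM_def by (simp add: mult.assoc)
qed

text \<open>The partial sums satisfy p (N + 1) = y0 + z K (p N). They converge uniformly, and K is
  bounded in the sup norm by \<open>KM\<close>, so the recursion passes to the limit.\<close>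

lemma S_equation:
  assumes y0: "continuous_on {0..pi} y0" and x: "0 \<le> x" "x \<le> pi"
  shows "S z y0 x = y0 x + z * K (S z y0) x"
proof -
  define p where "p N x = (\<Sum>n<N. z ^ n * (K ^^ n) y0 x)" for N x
  have L: "L2_half ((K ^^ n) y0)" for n by (intro L2_half_continuous continuous_K_power y0)
  have Lp: "L2_half (p N)" and Kp: "K (p N) x = (\<Sum>n<N. z ^ n * K ((K ^^ n) y0) x)" for N
    using K_sum[of "\<lambda>n. (K ^^ n) y0" x "\<lambda>n. z ^ n" N, OF L x(2)] unfolding p_def by auto
  have LS: "L2_half (S z y0)" by (intro L2_half_continuous S_continuous y0)
  have "(\<lambda>N. K (p N) x) \<longlonglongrightarrow> K (S z y0) x"
  proof (rule LIMSEQ_I)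
    fix r :: real assume r: "r > 0"
    \<comment> \<open>The summand 1 covers the case \<open>KM = 0\<close>.\<close>
    define e where "e = r / (2 * (KM + 1))"
    have e: "e > 0" "e * KM < r"
    proof -
      show "e > 0" unfolding e_def using r KM_nonneg by simp
      have "e * KM \<le> e * (KM + 1)" using \<open>e > 0\<close> by simp
      also have "\<dots> = r / 2" unfolding e_def using KM_nonneg by (simp add: field_simps)
      finally show "e * KM < r" using r by simp
    qed
    have "\<forall>\<^sub>F N in sequentially. \<forall>y\<in>{0..pi}. dist (p N y) (S z y0 y) < e"
      using S_uniform_limit[OF y0, of z] e(1) unfolding uniform_limit_iff p_def by blast
    then obtain N0 where N0: "\<And>N y. N \<ge> N0 \<Longrightarrow> y \<in> {0..pi} \<Longrightarrow> dist (p N y) (S z y0 y) < e"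
      unfolding eventually_sequentially by blast
    have "norm (K (p N) x - K (S z y0) x) < r" if "N \<ge> N0" for N
    proof -
      have "cmod (K (\<lambda>x. p N x - S z y0 x) x) \<le> e * KM"
        using N0[OF that] e(1) by (intro K_bound[OF L2_half_diff[OF Lp LS] _ _ x]) (auto simp: dist_norm less_imp_le)
      then show ?thesis using e(2) K_diff[OF Lp LS x(2)] by simp
    qed
    then show "\<exists>no. \<forall>n\<ge>no. norm (K (p n) x - K (S z y0) x) < r" by blast
  qed
  then have l1: "(\<lambda>N. y0 x + z * K (p N) x) \<longlonglongrightarrow> y0 x + z * K (S z y0) x"
    by (intro tendsto_intros)
  have "y0 x + z * K (p N) x = (\<Sum>n<Suc N. z ^ n * (K ^^ n) y0 x)" for N
    unfolding Kp sum.lessThan_Suc_shift by (simp add: sum_distrib_left mult.assoc)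
  moreover have "(\<lambda>N. \<Sum>n<Suc N. z ^ n * (K ^^ n) y0 x) \<longlonglongrightarrow> S z y0 x"
    using S_sums[OF y0 x, of z] unfolding sums_def by (rule LIMSEQ_Suc)
  ultimately have "(\<lambda>N. y0 x + z * K (p N) x) \<longlonglongrightarrow> S z y0 x" by simp
  then show ?thesis using l1 LIMSEQ_unique by blast
qed

text \<open>One application of the equation turns the L2 norm of Y into a sup bound. Each further
  one gains a factor of order 1 / n, so |Y| is below the terms of a convergent exponential
  series.\<close>

lemma Volterra_homogeneous:
  assumes Y: "L2_half Y" and eq: "\<And>x. 0 \<le> x \<Longrightarrow> x \<le> pi \<Longrightarrow> Y x = z * K Y x"
    and x: "0 \<le> x" "x \<le> pi"
  shows "Y x = 0"
proof -
  define B where "B = cmod z * (KC * norm_half Y * hw_int pi)"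
  have B0: "B \<ge> 0" unfolding B_def using KC_properties(1) norm_half_nonneg[OF Y] hw_int_nonneg[of pi] by simp
  have bound: "cmod (Y x) \<le> B * (cmod z * KB) ^ n / fact n * hw_int x ^ n" if "0 \<le> x" "x \<le> pi" for n x
    using that
  proof (induction n arbitrary: x)
    case 0
    then show ?case
      using eq[of x] K_bound_L2[OF Y, of x] unfolding B_def by (simp add: norm_mult mult_left_mono)
  next
    case (Suc n)
    have "cmod (K Y x) \<le> B * (cmod z * KB) ^ n / fact n * KB / real (Suc n) * hw_int x ^ Suc n"
      using Suc B0 KB_nonneg by (intro K_bound_power[OF Y]) auto
    then have "cmod z * cmod (K Y x) \<le> cmod z * (B * (cmod z * KB) ^ n / fact n * KB / real (Suc n) * hw_int x ^ Suc n)"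
      by (rule mult_left_mono) simp
    then show ?case using eq[of x] Suc.prems by (simp add: norm_mult field_simps)
  qed
  have "(\<lambda>n. B * ((cmod z * KB * hw_int x) ^ n / fact n)) \<longlonglongrightarrow> 0"
    using sums_summable[OF exp_series] by (rule summable_LIMSEQ_zero)
  moreover have "cmod (Y x) \<le> B * ((cmod z * KB * hw_int x) ^ n / fact n)" for n
    using bound[OF x, of n] by (simp add: power_mult_distrib)
  ultimately have "cmod (Y x) \<le> 0"
    by (intro LIMSEQ_le_const) auto
  then show ?thesis by simp
qed

lemma Volterra_unique:
  assumes Y: "L2_half Y" and y0: "continuous_on {0..pi} y0"
    and eq: "\<And>x. 0 \<le> x \<Longrightarrow> x \<le> pi \<Longrightarrow> Y x = y0 x + z * K Y x"
    and x: "0 \<le> x" "x \<le> pi"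
  shows "Y x = S z y0 x"
proof -
  have LS: "L2_half (S z y0)" by (intro L2_half_continuous S_continuous y0)
  have "Y x - S z y0 x = 0"
  proof (rule Volterra_homogeneous[OF L2_half_diff[OF Y LS] _ x])
    fix x :: real assume "0 \<le> x" "x \<le> pi"
    then show "Y x - S z y0 x = z * K (\<lambda>x. Y x - S z y0 x) x"
      using eq[of x] S_equation[OF y0, of x z] by (simp add: K_diff[OF Y LS] right_diff_distrib)
  qed
  then show ?thesis by simp
qed

section \<open>The solution normalized at 0 and its dependence on the parameter\<close>

definition \<phi> :: "complex \<Rightarrow> real \<Rightarrow> complex" where
  "\<phi> z = S z (\<lambda>_. 1)"

lemma \<phi>_continuous: "continuous_on {0..pi} (\<phi> z)"
  unfolding \<phi>_def by (rule S_continuous) simp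

lemma \<phi>_L2: "L2_half (\<phi> z)"
  by (rule L2_half_continuous[OF \<phi>_continuous])

lemma \<phi>_equation: "0 \<le> x \<Longrightarrow> x \<le> pi \<Longrightarrow> \<phi> z x = 1 + z * K (\<phi> z) x"
  unfolding \<phi>_def by (rule S_equation) auto

lemma \<phi>_0: "\<phi> z 0 = 1"
  using \<phi>_equation[of 0 z] by (simp add: K_0)

lemma S_add_const:
  assumes k: "continuous_on {0..pi} k" and x: "0 \<le> x" "x \<le> pi"
  shows "S z (\<lambda>x. c + k x) x = c * \<phi> z x + S z k x"
proof -
  have L: "L2_half (S z k)" "L2_half (\<lambda>x. c * \<phi> z x)"
    by (intro L2_half_continuous S_continuous k) (rule L2_half_cmult[OF \<phi>_L2])
  have "c * \<phi> z x + S z k x = S z (\<lambda>x. c + k x) x"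
  proof (rule Volterra_unique[OF L2_half_add[OF L(2,1)] _ _ x])
    show "continuous_on {0..pi} (\<lambda>x. c + k x)" using k by (intro continuous_intros)
    fix x :: real assume "0 \<le> x" "x \<le> pi"
    then show "c * \<phi> z x + S z k x = c + k x + z * K (\<lambda>x. c * \<phi> z x + S z k x) x"
      using S_equation[OF k, of x z] \<phi>_equation[of x z] by (simp add: K_add[OF L(2,1)] K_cmult distrib_left)
  qed
  then show ?thesis ..
qed

lemma S_cmult:
  assumes k: "continuous_on {0..pi} k" and x: "0 \<le> x" "x \<le> pi"
  shows "S z (\<lambda>x. c * k x) x = c * S z k x"
proof -
  have L: "L2_half (S z k)" by (intro L2_half_continuous S_continuous k)
  have "c * S z k x = S z (\<lambda>x. c * k x) x"
  proof (rule Volterra_unique[OF L2_half_cmult[OF L] _ _ x])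
    show "continuous_on {0..pi} (\<lambda>x. c * k x)" using k by (intro continuous_intros)
    fix x :: real assume "0 \<le> x" "x \<le> pi"
    then show "c * S z k x = c * k x + z * K (\<lambda>x. c * S z k x) x"
      using S_equation[OF k, of x z] by (simp add: K_cmult algebra_simps)
  qed
  then show ?thesis ..
qed

lemma cnj_K: "cnj (K g x) = K (\<lambda>x. cnj (g x)) x"
proof -
  have "cnj (J g y) = J (\<lambda>x. cnj (g x)) y" for y
    unfolding J_def Henstock_Kurzweil_Integration.integral_cnj by simp
  then have "cnj (JP g y) = JP (\<lambda>x. cnj (g x)) y" for y unfolding JP_def by simp
  then show ?thesis unfolding K_def Henstock_Kurzweil_Integration.integral_cnj by simp
qed

text \<open>The kernel of K is real, so the conjugate solves the Volterra equation with conjugate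
  parameter and data; uniqueness identifies it.\<close>

lemma cnj_S:
  assumes k: "continuous_on {0..pi} k" and x: "0 \<le> x" "x \<le> pi"
  shows "cnj (S z k x) = S (cnj z) (\<lambda>x. cnj (k x)) x"
proof (rule Volterra_unique[OF _ _ _ x])
  show "L2_half (\<lambda>x. cnj (S z k x))" "continuous_on {0..pi} (\<lambda>x. cnj (k x))"
    by (intro L2_half_continuous continuous_intros S_continuous k)+
  show "cnj (S z k x) = cnj (k x) + cnj z * K (\<lambda>x. cnj (S z k x)) x" if "0 \<le> x" "x \<le> pi" for x
    using S_equation[OF k that, of z] by (simp add: cnj_K)
qed

lemma S_cong:
  assumes "continuous_on {0..pi} h" "\<And>x. 0 \<le> x \<Longrightarrow> x \<le> pi \<Longrightarrow> g x = h x" "0 \<le> x" "x \<le> pi"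
  shows "S z g x = S z h x"
proof -
  have g: "continuous_on {0..pi} g" using assms(1,2) by (auto intro: continuous_on_eq)
  show ?thesis
    by (rule Volterra_unique[OF L2_half_continuous[OF S_continuous[OF g]] assms(1) _ assms(3,4)])
      (use S_equation[OF g] assms(2) in auto)
qed

lemma cnj_\<phi>: "0 \<le> x \<Longrightarrow> x \<le> pi \<Longrightarrow> cnj (\<phi> z x) = \<phi> (cnj z) x"
  unfolding \<phi>_def using cnj_S[of "\<lambda>_. 1" x z] by simp

text \<open>At x = pi the Neumann series is a power series in z that converges everywhere.\<close>

lemma \<phi>_entire: "(\<lambda>z. \<phi> z pi) holomorphic_on UNIV"
proof -
  have "(\<lambda>z. \<phi> z pi) holomorphic_on ball 0 r" for r
  proof (rule power_series_holomorphic)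
    fix w :: complex
    show "(\<lambda>n. (K ^^ n) (\<lambda>_. 1) pi * (w - 0) ^ n) sums \<phi> w pi"
      using S_sums[of "\<lambda>_. 1" pi w] unfolding \<phi>_def by (simp add: mult.commute)
  qed
  then have "(\<lambda>z. \<phi> z pi) field_differentiable (at z)" for z
    by (rule holomorphic_on_imp_differentiable_at[of _ "ball 0 (cmod z + 1)"]) auto
  then show ?thesis by (simp add: holomorphic_on_def field_differentiable_at_within)
qed

end

section \<open>A comparison theorem\<close>

context singular_ode
begin

lemma isCont_J_integrand:
  assumes "continuous_on {0..pi} g" "0 < x" "x < pi"
  shows "isCont (\<lambda>r. complex_of_real (wt r) * g r) x"
proof -
  have "isCont g x"
    using assms continuous_on_interior[of "{0..pi}" g x] by simp
  then show ?thesis using isCont_wt[OF assms(2,3)] by (intro continuous_intros)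
qed

lemma J_deriv:
  assumes g: "continuous_on {0..pi} g" and x: "0 < x" "x < pi"
  shows "(J g has_vector_derivative of_real (wt x) * g x) (at x)"
  unfolding J_def[abs_def]
proof (rule has_vector_derivative_integral_at[OF _ x isCont_J_integrand[OF g x]])
  show "(\<lambda>r. complex_of_real (wt r) * g r) integrable_on {0..b}" if "0 \<le> b" "b < pi" for b
    using wt_mult_integrable[OF L2_halfD(1)[OF L2_half_continuous[OF g]], of b] that
    by (simp add: absolutely_integrable_on_def)
qed

lemma K_deriv:
  assumes g: "continuous_on {0..pi} g" and x: "0 < x" "x < pi"
  shows "(K g has_vector_derivative JP g x) (at x)"
  unfolding K_def[abs_def]
proof (rule has_vector_derivative_integral_at[OF _ x])
  show "JP g integrable_on {0..b}" if "0 \<le> b" "b < pi" for b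
    using absolutely_integrable_on_subinterval[OF JP_integrable[OF L2_half_continuous[OF g]], of 0 b] that
    by (simp add: absolutely_integrable_on_def)
  have "isCont (J g) x" using J_deriv[OF g x] by (rule has_vector_derivative_continuous)
  moreover have "complex_of_real (\<epsilon> * wt x * f x) \<noteq> 0" using P_pos[OF x] by (metis less_irrefl of_real_eq_0_iff)
  moreover have "isCont (\<lambda>x. complex_of_real (\<epsilon> * wt x * f x)) x"
    by (intro continuous_of_real continuous_mult continuous_const isCont_wt[OF x] isCont_f)
  ultimately show "isCont (JP g) x"
    unfolding JP_def[abs_def] by (intro isCont_divide)
qed

text \<open>A cooperative system: as long as \<open>q\<close> is nonnegative all other components are, and then \<open>q\<close>
  increases. Near the singular end point \<open>0\<close> the source term \<open>a\<close> dominates \<open>\<tau>\<close>.\<close>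

lemma cooperative_positivity:
  fixes q r \<sigma> \<tau> a b :: "real \<Rightarrow> real" and \<kappa> :: real
  assumes cont: "\<And>c. c < pi \<Longrightarrow> continuous_on {0..c} q" "\<And>c. c < pi \<Longrightarrow> continuous_on {0..c} r"
      "\<And>c. c < pi \<Longrightarrow> continuous_on {0..c} \<sigma>" "\<And>c. c < pi \<Longrightarrow> continuous_on {0..c} \<tau>"
    and zero: "q 0 = 0" "r 0 = 0" "\<sigma> 0 = 0" "\<tau> 0 = 0"
    and \<kappa>: "\<kappa> \<ge> 0"
    and dq: "\<And>x. 0 < x \<Longrightarrow> x < pi \<Longrightarrow> (q has_real_derivative 2 * r x / (\<epsilon> * wt x * f x)) (at x)"
    and dr: "\<And>x. 0 < x \<Longrightarrow> x < pi \<Longrightarrow> (r has_real_derivative \<tau> x / (\<epsilon> * wt x * f x) + wt x * a x) (at x)"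
    and d\<sigma>: "\<And>x. 0 < x \<Longrightarrow> x < pi \<Longrightarrow> (\<sigma> has_real_derivative \<kappa> * wt x * q x) (at x)"
    and d\<tau>: "\<And>x. 0 < x \<Longrightarrow> x < pi \<Longrightarrow> (\<tau> has_real_derivative 2 * wt x * (b x + \<sigma> x)) (at x)"
    and a: "\<And>x. 0 < x \<Longrightarrow> x < pi \<Longrightarrow> a x \<ge> 0"
    and a0: "a0 > 0" "\<forall>\<^sub>F x in at_right 0. a x \<ge> a0"
    and b: "\<And>x. 0 < x \<Longrightarrow> x < pi \<Longrightarrow> (\<And>y. 0 < y \<Longrightarrow> y < x \<Longrightarrow> q y \<ge> 0) \<Longrightarrow> b x \<ge> 0"
    and C: "C > 0" "\<And>x. 0 < x \<Longrightarrow> x < 1 \<Longrightarrow> \<bar>\<tau> x\<bar> \<le> C * (x * wt x)\<^sup>2"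
    and x: "0 < x" "x < pi"
  shows "q x > 0 \<and> r x > 0"
proof -
  obtain c where c: "c > 0" "\<And>x. 0 < x \<Longrightarrow> x < pi \<Longrightarrow> c * (x * (pi - x)) \<le> f x"
    using f_lower by blast
  obtain d0 where d0: "d0 > 0" "\<And>x. 0 < x \<Longrightarrow> x < d0 \<Longrightarrow> a x \<ge> a0"
    using a0(2) unfolding eventually_at_right_field by auto
  \<comment> \<open>On (0, \<delta>) one has f y \<ge> c y, because pi - y \<ge> 1. The term with
    \<tau> is then at most \<open>wt y\<close> C y / (\<epsilon> c), and the last entry keeps this
    below \<open>wt y\<close> a0.\<close>
  define \<delta> where "\<delta> = min (min d0 1) (a0 * \<epsilon> * c / C)"
  have \<delta>: "\<delta> > 0" "\<delta> \<le> d0" "\<delta> \<le> 1" "\<delta> \<le> a0 * \<epsilon> * c / C"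
    using d0(1) a0(1) C(1) c(1) eps unfolding \<delta>_def by auto
  have dr_pos: "\<tau> y / (\<epsilon> * wt y * f y) + wt y * a y > 0" if y: "0 < y" "y < \<delta>" for y
  proof -
    have y': "y < pi" "y < 1" "y < d0" using y \<delta> pi_gt3 by auto
    have w: "wt y > 0" using wt_pos y y' by simp
    have P: "\<epsilon> * wt y * f y > 0" using P_pos y y' by simp
    have "c * (y * 1) \<le> c * (y * (pi - y))" using y y' c(1) pi_gt3 by (intro mult_left_mono) auto
    then have fy: "c * y \<le> f y" using c(2)[of y] y y' by simp
    have "\<bar>\<tau> y\<bar> / (\<epsilon> * wt y * f y) \<le> C * (y * wt y)\<^sup>2 / (\<epsilon> * wt y * f y)"
      using C(2)[of y] y y' P by (intro divide_right_mono) auto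
    also have "\<dots> \<le> C * (y * wt y)\<^sup>2 / (\<epsilon> * wt y * (c * y))"
      using fy eps w c(1) y C(1) by (intro frac_le mult_left_mono) auto
    also have "\<dots> = wt y * (C * y / (\<epsilon> * c))"
      using w y eps c(1) by (simp add: field_simps power2_eq_square)
    also have "\<dots> < wt y * a0"
    proof (rule mult_strict_left_mono[OF _ w])
      have "y < a0 * \<epsilon> * c / C" using y \<delta> by simp
      then show "C * y / (\<epsilon> * c) < a0" using C(1) eps c(1) by (simp add: field_simps)
    qed
    also have "\<dots> \<le> wt y * a y" using d0(2)[of y] y y' w by simp
    finally have "\<bar>\<tau> y\<bar> / (\<epsilon> * wt y * f y) < wt y * a y" .
    moreover have "\<bar>\<tau> y\<bar> / (\<epsilon> * wt y * f y) = \<bar>\<tau> y / (\<epsilon> * wt y * f y)\<bar>"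
      using P by (simp add: abs_divide)
    ultimately show ?thesis by linarith
  qed
  have r_near: "r y > 0" if y: "0 < y" "y < \<delta>" for y
  proof -
    have "r 0 < r y"
    proof (rule DERIV_pos_imp_increasing_open[OF y(1)])
      fix z assume "0 < z" "z < y"
      then show "\<exists>D. (r has_real_derivative D) (at z) \<and> D > 0"
        using dr[of z] dr_pos[of z] y \<delta> pi_gt3 by (intro exI[of _ "\<tau> z / (\<epsilon> * wt z * f z) + wt z * a z"]) auto
    qed (rule cont(2), use y \<delta> pi_gt3 in auto)
    then show ?thesis by (simp add: zero)
  qed
  have q_from: "q y > 0" if y: "0 < y" "y < pi" and r: "\<And>z. 0 < z \<Longrightarrow> z < y \<Longrightarrow> r z > 0" for y
  proof -
    have "q 0 < q y"
    proof (rule DERIV_pos_imp_increasing_open[OF y(1)])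
      fix z assume z: "0 < z" "z < y"
      then show "\<exists>D. (q has_real_derivative D) (at z) \<and> D > 0"
        using dq[of z] r[OF z] P_pos[of z] y by (intro exI[of _ "2 * r z / (\<epsilon> * wt z * f z)"]) auto
    qed (rule cont(1), use y in auto)
    then show ?thesis by (simp add: zero)
  qed
  have mono0: "g y \<ge> 0"
    if "g 0 = 0" "\<And>c. c < pi \<Longrightarrow> continuous_on {0..c} g" "0 < y" "y < pi"
      "\<And>z. 0 < z \<Longrightarrow> z < y \<Longrightarrow> (g has_real_derivative g' z) (at z)" "\<And>z. 0 < z \<Longrightarrow> z < y \<Longrightarrow> g' z \<ge> 0"
    for g g' :: "real \<Rightarrow> real" and y
  proof -
    have "g 0 \<le> g y"
    proof (rule DERIV_nonneg_imp_increasing_open[where f=g])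
      show "\<exists>D. (g has_real_derivative D) (at z) \<and> D \<ge> 0" if "0 < z" "z < y" for z
        using that \<open>\<And>z. 0 < z \<Longrightarrow> z < y \<Longrightarrow> (g has_real_derivative g' z) (at z)\<close>
          \<open>\<And>z. 0 < z \<Longrightarrow> z < y \<Longrightarrow> g' z \<ge> 0\<close> by blast
    qed (use that in auto)
    then show ?thesis using that(1) by simp
  qed
  have r_from: "r y > 0" if y: "0 < y" "y < pi" and q: "\<And>z. 0 < z \<Longrightarrow> z < y \<Longrightarrow> q z \<ge> 0" for y
  proof (cases "y < \<delta>")
    case True
    then show ?thesis using r_near y by blast
  next
    case False
    have \<sigma>0: "\<sigma> z \<ge> 0" if z: "0 < z" "z < y" for z
      by (rule mono0[OF zero(3) cont(3) z(1) _ d\<sigma>])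
        (use z y q \<kappa> wt_pos in \<open>auto intro!: mult_nonneg_nonneg less_imp_le[OF wt_pos]\<close>)
    have \<tau>0: "\<tau> z \<ge> 0" if z: "0 < z" "z < y" for z
    proof (rule mono0[OF zero(4) cont(4) z(1) _ d\<tau>])
      show "0 \<le> 2 * wt w * (b w + \<sigma> w)" if "0 < w" "w < z" for w
        using b[of w] q \<sigma>0[of w] wt_pos[of w] that z y by auto
    qed (use z y in auto)
    have "r (\<delta> / 2) \<le> r y"
    proof (rule DERIV_nonneg_imp_increasing_open[where f=r])
      fix z assume "\<delta> / 2 < z" "z < y"
      then have z: "0 < z" "z < y" "z < pi" using \<delta>(1) y by auto
      show "\<exists>D. (r has_real_derivative D) (at z) \<and> D \<ge> 0"
        using dr[OF z(1,3)] \<tau>0[OF z(1,2)] a[OF z(1,3)] wt_pos[OF z(1,3)] P_pos[OF z(1,3)]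
        by (intro exI[of _ "\<tau> z / (\<epsilon> * wt z * f z) + wt z * a z"]) (auto intro!: add_nonneg_nonneg divide_nonneg_pos simp del: zero_le_divide_iff)
    next
      show "continuous_on {\<delta> / 2..y} r"
        by (rule continuous_on_subset[OF cont(2)[OF y(2)]]) (use \<delta> in auto)
    qed (use False \<delta> in auto)
    then show ?thesis using r_near[of "\<delta> / 2"] \<delta>(1) by simp
  qed
  have q_near: "q y > 0" if "0 < y" "y < \<delta>" for y
    by (rule q_from) (use that r_near \<delta> pi_gt3 in auto)
  have q_pos: "q y > 0" if y: "0 < y" "y < pi" for y
  proof (rule ccontr)
    assume neg: "\<not> q y > 0"
    \<comment> \<open>First-failure argument: at the least point m where q is not positive, q > 0 on
      (0, m) gives r > 0 there, and then q(m) > 0, a contradiction. Starting at \<delta> / 2 keeps m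
      away from q(0) = 0.\<close>
    define E where "E = {z \<in> {\<delta> / 2..y}. q z \<le> 0}"
    have yE: "y \<in> E" using neg q_near[of y] y \<delta>(1) unfolding E_def by (cases "y < \<delta>") auto
    have "continuous_on {\<delta> / 2..y} q"
      by (rule continuous_on_subset[OF cont(1)[OF y(2)]]) (use \<delta> in auto)
    then have "closed ({\<delta> / 2..y} \<inter> q -` {..0})"
      by (intro continuous_closed_preimage) auto
    moreover have "E = {\<delta> / 2..y} \<inter> q -` {..0}" unfolding E_def by auto
    ultimately have "closed E" by simp
    have bdd: "bdd_below E" unfolding E_def by (rule bdd_belowI[of _ "\<delta> / 2"]) auto
    define m where "m = Inf E"
    have mE: "m \<in> E" unfolding m_def using closed_contains_Inf[OF _ bdd \<open>closed E\<close>] yE by blast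
    have m: "0 < m" "m < pi" "m \<le> y" "q m \<le> 0" using mE \<delta>(1) y unfolding E_def by auto
    have "q z > 0" if z: "0 < z" "z < m" for z
    proof (cases "z < \<delta>")
      case True
      then show ?thesis using q_near z by blast
    next
      case False
      have "z \<notin> E" using cInf_lower[OF _ bdd, of z] z(2) unfolding m_def[symmetric] by auto
      then show ?thesis using False z \<delta>(1) m unfolding E_def by auto
    qed
    then have "r z > 0" if "0 < z" "z < m" for z
      using that m by (intro r_from) (auto simp: less_imp_le)
    then have "q m > 0" using m by (intro q_from) auto
    then show False using m by simp
  qed
  then have "r x > 0" using x by (intro r_from) (auto simp: less_imp_le)
  then show ?thesis using q_pos x by blast
qed

section \<open>The quadratic quantities of a solution and its flux\<close>

lemma cnj_mult_deriv:
  assumes "(u has_vector_derivative u') (at x)" "(v has_vector_derivative v') (at x)"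
  shows "((\<lambda>x. Re (cnj (u x) * v x)) has_real_derivative Re (cnj u' * v x + cnj (u x) * v')) (at x)"
    "((\<lambda>x. Im (cnj (u x) * v x)) has_real_derivative Im (cnj u' * v x + cnj (u x) * v')) (at x)"
proof -
  have "((\<lambda>x. cnj (u x) * v x) has_vector_derivative (cnj (u x) * v' + cnj u' * v x)) (at x)"
    by (intro has_vector_derivative_mult has_vector_derivative_cnj assms)
  from bounded_linear.has_vector_derivative[OF bounded_linear_Re this]
    bounded_linear.has_vector_derivative[OF bounded_linear_Im this]
  show "((\<lambda>x. Re (cnj (u x) * v x)) has_real_derivative Re (cnj u' * v x + cnj (u x) * v')) (at x)"
    "((\<lambda>x. Im (cnj (u x) * v x)) has_real_derivative Im (cnj u' * v x + cnj (u x) * v')) (at x)"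
    by (simp_all add: has_real_derivative_iff_has_vector_derivative add.commute)
qed

text \<open>The flux \<epsilon> \<open>wt\<close> f \<phi>', which turns the second-order equation
  into a first-order system for \<phi> and \<psi>.\<close>

definition \<psi> :: "complex \<Rightarrow> real \<Rightarrow> complex" where
  "\<psi> z y = z * J (\<phi> z) y"

lemma \<phi>_deriv:
  assumes x: "0 < x" "x < pi"
  shows "(\<phi> z has_vector_derivative \<psi> z x / of_real (\<epsilon> * wt x * f x)) (at x)"
proof -
  have "((\<lambda>x. 1 + z * K (\<phi> z) x) has_vector_derivative 0 + z * JP (\<phi> z) x) (at x)"
    by (intro has_vector_derivative_add has_vector_derivative_const has_vector_derivative_mult_right K_deriv \<phi>_continuous x)
  then have "(\<phi> z has_vector_derivative 0 + z * JP (\<phi> z) x) (at x)"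
    by (rule has_vector_derivative_transform_within_open[where S="{0<..<pi}"]) (use x \<phi>_equation in auto)
  then show ?thesis by (simp add: JP_def \<psi>_def del: of_real_mult)
qed

lemma \<psi>_deriv:
  assumes x: "0 < x" "x < pi"
  shows "(\<psi> z has_vector_derivative z * of_real (wt x) * \<phi> z x) (at x)"
  using has_vector_derivative_mult_right[OF J_deriv[OF \<phi>_continuous x], of z z]
  unfolding \<psi>_def[abs_def] by (simp add: mult.assoc)

lemma \<psi>_continuous: "b < pi \<Longrightarrow> continuous_on {0..b} (\<psi> z)"
  unfolding \<psi>_def[abs_def] by (intro continuous_intros J_continuous \<phi>_L2)

lemma \<phi>_continuous': "b < pi \<Longrightarrow> continuous_on {0..b} (\<phi> z)"
  by (rule continuous_on_subset[OF \<phi>_continuous]) auto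

definition Q where "Q z x = (cmod (\<phi> z x))\<^sup>2"
definition R where "R z x = Re (cnj (\<phi> z x) * \<psi> z x)"
definition I where "I z x = Im (cnj (\<phi> z x) * \<psi> z x)"
definition T where "T z x = (cmod (\<psi> z x))\<^sup>2"

lemma cmod_power2_Re: "(cmod w)\<^sup>2 = Re (cnj w * w)"
  unfolding cmod_power2 by (simp add: power2_eq_square)

text \<open>With P = \<epsilon> \<open>wt\<close> f the system is \<phi>' = \<psi> / P, \<psi>' = z
  \<open>wt\<close> \<phi>. As P is real, |\<psi>|^2 / P contributes to the derivative of the real
  part \<open>R\<close> only and drops out of that of \<open>I\<close>.\<close>

lemma QRIT_deriv:
  assumes x: "0 < x" "x < pi"
  shows "(Q z has_real_derivative 2 * R z x / (\<epsilon> * wt x * f x)) (at x)"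
    and "(R z has_real_derivative T z x / (\<epsilon> * wt x * f x) + wt x * (Re z * Q z x)) (at x)"
    and "(I z has_real_derivative Im z * wt x * Q z x) (at x)"
    and "(T z has_real_derivative 2 * wt x * (Re z * R z x + Im z * I z x)) (at x)"
proof -
  define P where "P = \<epsilon> * wt x * f x"
  have P: "P > 0" unfolding P_def by (rule P_pos[OF x])
  note d\<phi> = \<phi>_deriv[OF x, of z, folded P_def] and d\<psi> = \<psi>_deriv[OF x, of z]
  have e: "Re (w / of_real P) = Re w / P" "Im (w / of_real P) = Im w / P" for w
    by simp_all
  show "(Q z has_real_derivative 2 * R z x / (\<epsilon> * wt x * f x)) (at x)"
    using cnj_mult_deriv(1)[OF d\<phi> d\<phi>] unfolding Q_def[abs_def] cmod_power2_Re R_def P_def[symmetric]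
    by (simp add: e algebra_simps add_divide_distrib)
  show "(R z has_real_derivative T z x / (\<epsilon> * wt x * f x) + wt x * (Re z * Q z x)) (at x)"
    using cnj_mult_deriv(1)[OF d\<phi> d\<psi>] unfolding R_def[abs_def] T_def Q_def cmod_power2_Re P_def[symmetric]
    by (simp add: e algebra_simps add_divide_distrib)
  show "(I z has_real_derivative Im z * wt x * Q z x) (at x)"
    using cnj_mult_deriv(2)[OF d\<phi> d\<psi>] unfolding I_def[abs_def] T_def Q_def cmod_power2_Re P_def[symmetric]
    by (simp add: e algebra_simps add_divide_distrib)
  show "(T z has_real_derivative 2 * wt x * (Re z * R z x + Im z * I z x)) (at x)"
    using cnj_mult_deriv(1)[OF d\<psi> d\<psi>] unfolding T_def[abs_def] cmod_power2_Re R_def I_def P_def[symmetric]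
    by (simp add: e algebra_simps add_divide_distrib)
qed

lemma QRIT_continuous:
  assumes "b < pi"
  shows "continuous_on {0..b} (Q z)" "continuous_on {0..b} (R z)" "continuous_on {0..b} (I z)" "continuous_on {0..b} (T z)"
  unfolding Q_def[abs_def] R_def[abs_def] I_def[abs_def] T_def[abs_def]
  using assms by (auto intro!: continuous_intros \<phi>_continuous' \<psi>_continuous)

lemma QRIT_0: "Q z 0 = 1" "R z 0 = 0" "I z 0 = 0" "T z 0 = 0"
  unfolding Q_def R_def I_def T_def \<psi>_def by (simp_all add: \<phi>_0 J_0)

lemma Q_near_0: "\<forall>\<^sub>F x in at_right 0. Q z x > 1 / 2"
proof -
  have "continuous (at 0 within {0..1}) (Q z)"
    using QRIT_continuous(1)[of 1 z] pi_gt3 by (simp add: continuous_on_eq_continuous_within)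
  then have "(Q z \<longlongrightarrow> 1) (at_right 0)"
    using at_within_Icc_at_right[of 0 "1::real"] by (simp add: continuous_within QRIT_0)
  then show ?thesis by (rule order_tendstoD) simp
qed

text \<open>By monotonicity the integral of \<open>wt\<close> over (0, x) is at most x
  \<open>wt x\<close>. The extra factor x is what lets the source term win near 0 in
  \<open>cooperative_positivity\<close>.\<close>

lemma J_le_wt:
  assumes g: "continuous_on {0..pi} g"
  obtains C where "C > 0" "\<And>x. 0 < x \<Longrightarrow> x < pi \<Longrightarrow> cmod (J g x) \<le> C * (x * wt x)"
proof -
  obtain B where B: "B \<ge> 0" "\<And>x. 0 \<le> x \<Longrightarrow> x \<le> pi \<Longrightarrow> cmod (g x) \<le> B"
    using continuous_bounded[OF g] by blast
  show ?thesis
  proof (rule that[of "B + 1"])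
    fix x :: real assume x: "0 < x" "x < pi"
    have "cmod (J g x) \<le> B * integral {0..x} wt"
      using x B by (intro J_bound[OF L2_half_continuous[OF g]]) auto
    also have "\<dots> \<le> B * (x * wt x)" using integral_wt_le[of x] x B(1) by (intro mult_left_mono) auto
    also have "\<dots> \<le> (B + 1) * (x * wt x)" using x wt_pos[OF x] by (intro mult_right_mono) auto
    finally show "cmod (J g x) \<le> (B + 1) * (x * wt x)" .
  qed (use B in auto)
qed

lemma \<psi>_le_wt:
  obtains C where "C > 0" "\<And>x. 0 < x \<Longrightarrow> x < pi \<Longrightarrow> cmod (\<psi> z x) \<le> C * (x * wt x)"
proof -
  have "continuous_on {0..pi} (\<lambda>x. z * \<phi> z x)" by (intro continuous_intros \<phi>_continuous)
  from J_le_wt[OF this] show ?thesis using that unfolding \<psi>_def J_cmult by blast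
qed

text \<open>Subtracting the systems for z and - z turns the terms with coefficient Re z into sums,
  \<open>a\<close> and \<open>b\<close>. These are sources: \<open>a\<close> is nonnegative
  outright, \<open>b\<close> as long as the difference \<open>q\<close> is.\<close>

lemma cmod_\<phi>_less:
  assumes z: "Re z > 0"
  shows "cmod (\<phi> (- z) pi) < cmod (\<phi> z pi)"
proof -
  define q where "q x = Q z x - Q (- z) x" for x
  define r where "r x = R z x - R (- z) x" for x
  \<comment> \<open>Here the sum is taken instead of the difference, since Im z changes sign with z.
    The factor Im z makes the coefficient of \<open>q\<close> in the derivative the square (Im z)^2,
    whatever the sign of Im z.\<close>
  define \<sigma> where "\<sigma> x = Im z * (I z x + I (- z) x)" for x
  define \<tau> where "\<tau> x = T z x - T (- z) x" for x
  define a where "a x = Re z * (Q z x + Q (- z) x)" for x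
  define b where "b x = Re z * (R z x + R (- z) x)" for x
  obtain C1 where C1: "C1 > 0" "\<And>x. 0 < x \<Longrightarrow> x < pi \<Longrightarrow> cmod (\<psi> z x) \<le> C1 * (x * wt x)"
    using \<psi>_le_wt by blast
  obtain C2 where C2: "C2 > 0" "\<And>x. 0 < x \<Longrightarrow> x < pi \<Longrightarrow> cmod (\<psi> (- z) x) \<le> C2 * (x * wt x)"
    using \<psi>_le_wt by blast
  have Q0: "Q w x \<ge> 0" and T0: "T w x \<ge> 0" for w x unfolding Q_def T_def by auto
  have pos: "q x > 0 \<and> r x > 0" if x: "0 < x" "x < pi" for x
  proof (rule cooperative_positivity[where q=q and r=r and \<sigma>=\<sigma> and \<tau>=\<tau> and a=a and b=b
        and \<kappa>="(Im z)\<^sup>2" and C="C1\<^sup>2 + C2\<^sup>2" and ?a0.0="Re z / 2", OF _ _ _ _ _ _ _ _ _ _ _ _ _ _ _ _ _ _ _ x])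
    show "continuous_on {0..c} q" "continuous_on {0..c} r" "continuous_on {0..c} \<sigma>" "continuous_on {0..c} \<tau>"
      if "c < pi" for c
      using that unfolding q_def r_def \<sigma>_def \<tau>_def
      by (intro continuous_intros QRIT_continuous; simp)+
    show "q 0 = 0" "r 0 = 0" "\<sigma> 0 = 0" "\<tau> 0 = 0"
      unfolding q_def r_def \<sigma>_def \<tau>_def by (simp_all add: QRIT_0)
    show "(Im z)\<^sup>2 \<ge> 0" by simp
    show "(q has_real_derivative 2 * r x / (\<epsilon> * wt x * f x)) (at x)" if "0 < x" "x < pi" for x
      using DERIV_diff[OF QRIT_deriv(1)[OF that, of z] QRIT_deriv(1)[OF that, of "- z"]]
      unfolding q_def[abs_def] r_def by (simp add: diff_divide_distrib algebra_simps)
    show "(r has_real_derivative \<tau> x / (\<epsilon> * wt x * f x) + wt x * a x) (at x)" if "0 < x" "x < pi" for x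
      using DERIV_diff[OF QRIT_deriv(2)[OF that, of z] QRIT_deriv(2)[OF that, of "- z"]]
      unfolding r_def[abs_def] \<tau>_def a_def by (simp add: diff_divide_distrib algebra_simps)
    show "(\<sigma> has_real_derivative (Im z)\<^sup>2 * wt x * q x) (at x)" if "0 < x" "x < pi" for x
      using DERIV_cmult[OF DERIV_add[OF QRIT_deriv(3)[OF that, of z] QRIT_deriv(3)[OF that, of "- z"]], of "Im z"]
      unfolding \<sigma>_def[abs_def] q_def by (simp add: algebra_simps power2_eq_square)
    show "(\<tau> has_real_derivative 2 * wt x * (b x + \<sigma> x)) (at x)" if "0 < x" "x < pi" for x
      using DERIV_diff[OF QRIT_deriv(4)[OF that, of z] QRIT_deriv(4)[OF that, of "- z"]]
      unfolding \<tau>_def[abs_def] b_def \<sigma>_def by (simp add: algebra_simps)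
    show "a x \<ge> 0" for x unfolding a_def using z Q0[of z x] Q0[of "-z" x] by simp
    show "Re z / 2 > 0" using z by simp
    show "\<forall>\<^sub>F x in at_right 0. a x \<ge> Re z / 2"
    proof -
      from Q_near_0[of z] show ?thesis
      proof (rule eventually_mono)
        fix x assume "Q z x > 1 / 2"
        then have "Re z * (1 / 2) \<le> Re z * (Q z x + Q (- z) x)"
          using z Q0[of "-z" x] by (intro mult_left_mono) auto
        then show "a x \<ge> Re z / 2" unfolding a_def by simp
      qed
    qed
    show "b x \<ge> 0" if x: "0 < x" "x < pi" and q: "\<And>y. 0 < y \<Longrightarrow> y < x \<Longrightarrow> q y \<ge> 0" for x
    proof -
      \<comment> \<open>The sum of the two \<open>R\<close> has derivative (T z + T (- z)) / P +
        \<open>wt\<close> (Re z) q, which is nonnegative while \<open>q\<close> is.\<close>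
      have "R z 0 + R (- z) 0 \<le> R z x + R (- z) x"
      proof (rule DERIV_nonneg_imp_increasing_open[where f="\<lambda>x. R z x + R (- z) x"])
        fix y assume "0 < y" "y < x"
        then have y: "0 < y" "y < pi" "0 \<le> q y" using x q by auto
        have "(T z y / (\<epsilon> * wt y * f y) + wt y * (Re z * Q z y)) + (T (- z) y / (\<epsilon> * wt y * f y) + wt y * (Re (- z) * Q (- z) y))
          = T z y / (\<epsilon> * wt y * f y) + T (- z) y / (\<epsilon> * wt y * f y) + wt y * Re z * q y"
          unfolding q_def by (simp add: algebra_simps)
        also have "\<dots> \<ge> 0"
          using T0 P_pos[OF y(1,2)] y(3) z wt_pos[OF y(1,2)] by (intro add_nonneg_nonneg divide_nonneg_pos mult_nonneg_nonneg) auto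
        finally show "\<exists>D. ((\<lambda>x. R z x + R (- z) x) has_real_derivative D) (at y) \<and> D \<ge> 0"
          using DERIV_add[OF QRIT_deriv(2)[OF y(1,2), of z] QRIT_deriv(2)[OF y(1,2), of "- z"]] by blast
      next
        show "continuous_on {0..x} (\<lambda>x. R z x + R (- z) x)"
          using x by (intro continuous_intros QRIT_continuous)
      qed (use x in auto)
      then show ?thesis unfolding b_def using z by (simp add: QRIT_0)
    qed
    show "C1\<^sup>2 + C2\<^sup>2 > 0" using C1(1) by (simp add: add_pos_nonneg)
    show "\<bar>\<tau> x\<bar> \<le> (C1\<^sup>2 + C2\<^sup>2) * (x * wt x)\<^sup>2" if "0 < x" "x < 1" for x
    proof -
      have x: "0 < x" "x < pi" using that pi_gt3 by auto
      have "T z x \<le> (C1 * (x * wt x))\<^sup>2" "T (- z) x \<le> (C2 * (x * wt x))\<^sup>2"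
        unfolding T_def using C1(2)[OF x] C2(2)[OF x] by (auto intro: power_mono)
      then show ?thesis unfolding \<tau>_def using T0[of z x] T0[of "-z" x]
        by (simp add: power_mult_distrib algebra_simps)
    qed
  qed
  \<comment> \<open>The differential equations hold only on the open interval. Since
    \<open>q\<close> increases there and is continuous up to pi, the strict inequality at 1 survives
    at pi.\<close>
  have "q 1 \<le> q pi"
  proof (rule DERIV_nonneg_imp_increasing_open[where f=q])
    fix y :: real assume "1 < y" "y < pi"
    then have y: "0 < y" "y < pi" by auto
    have "2 * r y / (\<epsilon> * wt y * f y) \<ge> 0" using pos[OF y] P_pos[OF y] by simp
    moreover have "(q has_real_derivative 2 * r y / (\<epsilon> * wt y * f y)) (at y)"
      using DERIV_diff[OF QRIT_deriv(1)[OF y, of z] QRIT_deriv(1)[OF y, of "- z"]]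
      unfolding q_def[abs_def] r_def by (simp add: diff_divide_distrib algebra_simps)
    ultimately show "\<exists>D. (q has_real_derivative D) (at y) \<and> D \<ge> 0" by blast
  next
    show "continuous_on {1..pi} q" unfolding q_def Q_def
      by (intro continuous_intros continuous_on_subset[OF \<phi>_continuous]) auto
  qed (use pi_gt3 in auto)
  moreover have "q 1 > 0" using pos[of 1] pi_gt3 by simp
  ultimately have "(cmod (\<phi> (- z) pi))\<^sup>2 < (cmod (\<phi> z pi))\<^sup>2" unfolding q_def Q_def by simp
  then show ?thesis by (rule power2_less_imp_less) simp
qed

lemma \<phi>_minus_neq:
  assumes "Re z \<noteq> 0"
  shows "\<phi> z pi \<noteq> \<phi> (- z) pi"
  using cmod_\<phi>_less[of z] cmod_\<phi>_less[of "- z"] assms by (cases "Re z > 0") auto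

section \<open>Linearization in the spectral parameter\<close>

definition \<eta> :: "complex \<Rightarrow> real \<Rightarrow> complex" where
  "\<eta> z = S z (K (\<phi> z))"

lemma K\<phi>_continuous: "continuous_on {0..pi} (K (\<phi> z))"
  by (rule K_continuous[OF \<phi>_L2])

lemma \<eta>_continuous: "continuous_on {0..pi} (\<eta> z)"
  unfolding \<eta>_def by (rule S_continuous[OF K\<phi>_continuous])

text \<open>Differentiating \<phi> = 1 + z K \<phi> formally in z gives \<eta> = K \<phi> + z K
  \<eta>; this is the equation that \<open>S\<close> solves for the data K \<phi>.\<close>

lemma \<eta>_equation:
  assumes "0 \<le> x" "x \<le> pi"
  shows "\<eta> z x = K (\<lambda>x. \<phi> z x + z * \<eta> z x) x"
  using S_equation[OF K\<phi>_continuous assms, of z z] assms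
  by (simp add: \<eta>_def[symmetric] K_add[OF \<phi>_L2 L2_half_cmult[OF L2_half_continuous[OF \<eta>_continuous]]] K_cmult)

text \<open>The same comparison for the linearization \<open>\<eta> = \<partial>\<phi>/\<partial>z\<close> on the imaginary axis.\<close>

lemma Re_cnj_\<phi>_\<eta>_pos:
  assumes z: "Re z = 0"
  shows "Re (cnj (\<phi> z pi) * \<eta> z pi) > 0"
proof -
  define g where "g x = \<phi> z x + z * \<eta> z x" for x
  define Y where "Y = J g"
  have g: "continuous_on {0..pi} g"
    unfolding g_def by (intro continuous_intros \<phi>_continuous \<eta>_continuous)
  have d\<eta>: "(\<eta> z has_vector_derivative Y x / of_real (\<epsilon> * wt x * f x)) (at x)" if x: "0 < x" "x < pi" for x
  proof -
    have "(\<eta> z has_vector_derivative JP g x) (at x)"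
      by (rule has_vector_derivative_transform_within_open[OF K_deriv[OF g x], where S="{0<..<pi}"])
        (use x \<eta>_equation in \<open>auto simp: g_def[abs_def]\<close>)
    then show ?thesis unfolding JP_def Y_def .
  qed
  have dY: "(Y has_vector_derivative of_real (wt x) * g x) (at x)" if x: "0 < x" "x < pi" for x
    unfolding Y_def by (rule J_deriv[OF g x])
  \<comment> \<open>\<open>q\<close>, \<open>r\<close> and \<open>\<tau>\<close> are the formal
    derivatives of \<open>Q\<close>, \<open>R\<close> and \<open>T\<close> with respect to Re z at
    Re z = 0, and \<open>\<sigma>\<close> is Im z times that of \<open>I\<close>; \<open>Y\<close>
    is the linearized flux. Differentiating the system itself produces the sources
    \<open>Q z\<close> and \<open>R z\<close>.\<close>
  define q where "q x = 2 * Re (cnj (\<phi> z x) * \<eta> z x)" for x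
  define r where "r x = Re (cnj (\<psi> z x) * \<eta> z x) + Re (cnj (\<phi> z x) * Y x)" for x
  define \<sigma> where "\<sigma> x = Im z * (Im (cnj (\<phi> z x) * Y x) - Im (cnj (\<psi> z x) * \<eta> z x))" for x
  define \<tau> where "\<tau> x = 2 * Re (cnj (\<psi> z x) * Y x)" for x
  obtain C1 where C1: "C1 > 0" "\<And>x. 0 < x \<Longrightarrow> x < pi \<Longrightarrow> cmod (\<psi> z x) \<le> C1 * (x * wt x)"
    using \<psi>_le_wt by blast
  obtain C2 where C2: "C2 > 0" "\<And>x. 0 < x \<Longrightarrow> x < pi \<Longrightarrow> cmod (Y x) \<le> C2 * (x * wt x)"
    using J_le_wt[OF g] unfolding Y_def by blast
  have Q0: "Q w x \<ge> 0" and T0: "T w x \<ge> 0" for w x unfolding Q_def T_def by auto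
  have c\<eta>: "continuous_on {0..c} (\<eta> z)" if "c < pi" for c
    by (rule continuous_on_subset[OF \<eta>_continuous]) (use that in auto)
  have cY: "continuous_on {0..c} Y" if "c < pi" for c
    unfolding Y_def by (rule J_continuous[OF L2_half_continuous[OF g] that])
  have Y0: "Y 0 = 0" "\<eta> z 0 = 0" using J_0 \<eta>_equation[of 0 z] K_0 unfolding Y_def by auto
  have dq: "(q has_real_derivative 2 * r x / (\<epsilon> * wt x * f x)) (at x)"
    and dr: "(r has_real_derivative \<tau> x / (\<epsilon> * wt x * f x) + wt x * Q z x) (at x)"
    and d\<sigma>: "(\<sigma> has_real_derivative (Im z)\<^sup>2 * wt x * q x) (at x)"
    and d\<tau>: "(\<tau> has_real_derivative 2 * wt x * (R z x + \<sigma> x)) (at x)" if x: "0 < x" "x < pi" for x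
  proof -
    define P where "P = \<epsilon> * wt x * f x"
    have P: "P > 0" unfolding P_def by (rule P_pos[OF x])
    note d = \<phi>_deriv[OF x, of z, folded P_def] \<psi>_deriv[OF x, of z] d\<eta>[OF x, folded P_def] dY[OF x]
    have e: "Re (w / of_real P) = Re w / P" "Im (w / of_real P) = Im w / P" for w
      by simp_all
    show "(q has_real_derivative 2 * r x / (\<epsilon> * wt x * f x)) (at x)"
      using DERIV_cmult[OF cnj_mult_deriv(1)[OF d(1,3)], of 2] unfolding q_def[abs_def] r_def P_def[symmetric]
      by (simp add: e z algebra_simps add_divide_distrib diff_divide_distrib)
    show "(r has_real_derivative \<tau> x / (\<epsilon> * wt x * f x) + wt x * Q z x) (at x)"
      using DERIV_add[OF cnj_mult_deriv(1)[OF d(2,3)] cnj_mult_deriv(1)[OF d(1,4)]]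
      unfolding r_def[abs_def] \<tau>_def P_def[symmetric] Q_def cmod_power2_Re g_def
      by (simp add: e z algebra_simps add_divide_distrib diff_divide_distrib)
    show "(\<sigma> has_real_derivative (Im z)\<^sup>2 * wt x * q x) (at x)"
      using DERIV_cmult[OF DERIV_diff[OF cnj_mult_deriv(2)[OF d(1,4)] cnj_mult_deriv(2)[OF d(2,3)]], of "Im z"]
      unfolding \<sigma>_def[abs_def] q_def P_def[symmetric] g_def
      by (simp add: e z algebra_simps add_divide_distrib diff_divide_distrib power2_eq_square)
    show "(\<tau> has_real_derivative 2 * wt x * (R z x + \<sigma> x)) (at x)"
      using DERIV_cmult[OF cnj_mult_deriv(1)[OF d(2,4)], of 2]
      unfolding \<tau>_def[abs_def] R_def \<sigma>_def P_def[symmetric] g_def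
      by (simp add: e z algebra_simps add_divide_distrib diff_divide_distrib)
  qed
  have pos: "q x > 0 \<and> r x > 0" if x: "0 < x" "x < pi" for x
  proof (rule cooperative_positivity[where q=q and r=r and \<sigma>=\<sigma> and \<tau>=\<tau> and a="Q z" and b="R z"
        and \<kappa>="(Im z)\<^sup>2" and C="2 * (C1 * C2)" and ?a0.0="1 / 2", OF _ _ _ _ _ _ _ _ _ dq dr d\<sigma> d\<tau> _ _ _ _ _ _ x])
    show "continuous_on {0..c} q" "continuous_on {0..c} r" "continuous_on {0..c} \<sigma>" "continuous_on {0..c} \<tau>"
      if "c < pi" for c
      using that unfolding q_def r_def \<sigma>_def \<tau>_def
      by (intro continuous_intros \<phi>_continuous' \<psi>_continuous c\<eta> cY; simp)+
    show "q 0 = 0" "r 0 = 0" "\<sigma> 0 = 0" "\<tau> 0 = 0"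
      unfolding q_def r_def \<sigma>_def \<tau>_def by (simp_all add: Y0)
    show "\<forall>\<^sub>F x in at_right 0. Q z x \<ge> 1 / 2"
      using Q_near_0[of z] by (rule eventually_mono) simp
    show "R z x \<ge> 0" if x: "0 < x" "x < pi" for x
    proof -
      \<comment> \<open>For Re z = 0 only the term T / P \<ge> 0 is left in the derivative of
        \<open>R\<close>.\<close>
      have "R z 0 \<le> R z x"
      proof (rule DERIV_nonneg_imp_increasing_open[where f="R z"])
        fix y assume "0 < y" "y < x"
        then have y: "0 < y" "y < pi" using x by auto
        have "T z y / (\<epsilon> * wt y * f y) + wt y * (Re z * Q z y) \<ge> 0"
          using T0[of z y] P_pos[OF y] z by simp
        then show "\<exists>D. (R z has_real_derivative D) (at y) \<and> D \<ge> 0"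
          using QRIT_deriv(2)[OF y, of z] by blast
      qed (use x QRIT_continuous(2) in auto)
      then show ?thesis by (simp add: QRIT_0)
    qed
    show "2 * (C1 * C2) > 0" using C1(1) C2(1) by simp
    show "\<bar>\<tau> x\<bar> \<le> 2 * (C1 * C2) * (x * wt x)\<^sup>2" if "0 < x" "x < 1" for x
    proof -
      have x: "0 < x" "x < pi" using that pi_gt3 by auto
      have "\<bar>\<tau> x\<bar> \<le> 2 * cmod (cnj (\<psi> z x) * Y x)"
        unfolding \<tau>_def using abs_Re_le_cmod[of "cnj (\<psi> z x) * Y x"] by simp
      also have "\<dots> = 2 * (cmod (\<psi> z x) * cmod (Y x))" by (simp add: norm_mult)
      also have "\<dots> \<le> 2 * (C1 * (x * wt x) * (C2 * (x * wt x)))"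
        using C1(2)[OF x] C2(2)[OF x] C1(1) x wt_pos[OF x] by (intro mult_left_mono mult_mono) auto
      finally show ?thesis by (simp add: power2_eq_square mult_ac)
    qed
  qed (use Q0 in auto)
  have "q 1 \<le> q pi"
  proof (rule DERIV_nonneg_imp_increasing_open[where f=q])
    fix y :: real assume "1 < y" "y < pi"
    then have y: "0 < y" "y < pi" by auto
    have "2 * r y / (\<epsilon> * wt y * f y) \<ge> 0" using pos[OF y] P_pos[OF y] by simp
    then show "\<exists>D. (q has_real_derivative D) (at y) \<and> D \<ge> 0" using dq[OF y] by blast
  next
    show "continuous_on {1..pi} q" unfolding q_def
      by (intro continuous_intros continuous_on_subset[OF \<phi>_continuous] continuous_on_subset[OF \<eta>_continuous]) auto
  qed (use pi_gt3 in auto)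
  moreover have "q 1 > 0" using pos[of 1] pi_gt3 by simp
  ultimately show ?thesis unfolding q_def by simp
qed

text \<open>At an eigenvalue \<open>\<phi> z \<pi> = \<phi> (- z) \<pi>\<close> is real, so the preceding lemma is about \<open>Re (\<eta> z \<pi>)\<close>.\<close>

lemma \<eta>_sum_neq_0:
  assumes z: "Re z = 0" and e: "\<phi> z pi = \<phi> (- z) pi"
  shows "\<eta> z pi + \<eta> (- z) pi \<noteq> 0"
proof
  assume 0: "\<eta> z pi + \<eta> (- z) pi = 0"
  have cz: "cnj z = - z" using z by (simp add: complex_eq_iff)
  have "cnj (\<phi> z pi) = \<phi> z pi" using cnj_\<phi>[of pi z] e cz by simp
  then have im: "Im (\<phi> z pi) = 0" by (simp add: complex_eq_iff)
  have "cnj (\<eta> z pi) = S (cnj z) (\<lambda>x. cnj (K (\<phi> z) x)) pi"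
    unfolding \<eta>_def by (rule cnj_S[OF K\<phi>_continuous]) auto
  also have "\<dots> = \<eta> (- z) pi"
    unfolding \<eta>_def cz
  proof (rule S_cong[OF K\<phi>_continuous])
    fix x :: real assume "0 \<le> x" "x \<le> pi"
    show "cnj (K (\<phi> z) x) = K (\<phi> (- z)) x"
      unfolding cnj_K by (rule K_cong[where N="{}"]) (use \<open>x \<le> pi\<close> cnj_\<phi> cz in auto)
  qed auto
  \<comment> \<open>On the imaginary axis \<eta> at - z is the conjugate of \<eta> at z, so the
    vanishing sum is twice the real part.\<close>
  finally have "Re (\<eta> z pi) = 0" using 0 by (simp add: complex_eq_iff)
  then have "Re (cnj (\<phi> z pi) * \<eta> z pi) = 0" using im by simp
  then show False using Re_cnj_\<phi>_\<eta>_pos[OF z] by simp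
qed

end

section \<open>The equation on a half interval\<close>

lemma negligible_uminus_image:
  fixes N :: "real set"
  assumes "negligible N"
  shows "negligible (uminus ` N)"
  by (rule negligible_differentiable_image_negligible[OF _ assms]) (auto intro!: derivative_intros)

lemma primitive_on_reflect:
  assumes "primitive_on per_interval U v"
  shows "primitive_on per_interval (\<lambda>x. U (- x)) (\<lambda>x. - v (- x))"
  unfolding primitive_on_def
proof (intro ballI impI conjI)
  fix a b assume ab: "a \<in> per_interval" "b \<in> per_interval" "a \<le> b"
  then have "-b \<in> per_interval" "-a \<in> per_interval" "-b \<le> -a" by auto
  from primitive_onD[OF assms this]
  have v: "v absolutely_integrable_on {-b..-a}" "U (- a) - U (- b) = integral {-b..-a} v" by auto
  have "(\<lambda>x. v (- x)) absolutely_integrable_on {a..b}"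
    using v(1) absolutely_integrable_reflect_real[where f=v and a="-b" and b="-a"] by simp
  from absolutely_integrable_continuous_mult[OF continuous_on_const this, of "-1"]
  show "(\<lambda>x. - v (- x)) absolutely_integrable_on {a..b}" by simp
  have "integral {a..b} (\<lambda>x. v (- x)) = integral {-b..-a} v"
    using Henstock_Kurzweil_Integration.integral_reflect_real[where f=v and a="-b" and b="-a"] by simp
  then show "U (- b) - U (- a) = integral {a..b} (\<lambda>x. - v (- x))"
    using v(2) by (simp add: algebra_simps)
qed

lemma primitive_on_glue:
  assumes A: "primitive_on {0..<pi} A a" and B: "primitive_on {0..<pi} B b" and AB: "A 0 = B 0"
  shows "primitive_on per_interval (\<lambda>x. if 0 \<le> x then A x else B (- x)) (\<lambda>x. if 0 \<le> x then a x else - b (- x))"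
    (is "primitive_on _ ?U ?v")
proof -
  have pos: "?v absolutely_integrable_on {x..y} \<and> ?U y - ?U x = integral {x..y} ?v"
    if xy: "0 \<le> x" "x \<le> y" "y < pi" for x y
  proof -
    have m: "x \<in> {0..<pi}" "y \<in> {0..<pi}" using xy by auto
    note p = primitive_onD[OF A m xy(2)]
    have "?v absolutely_integrable_on {x..y}"
      by (rule absolutely_integrable_spike[OF p(1) negligible_empty]) (use xy in auto)
    moreover have "integral {x..y} ?v = integral {x..y} a"
      by (rule integral_cong) (use xy in auto)
    ultimately show ?thesis using p(3) xy by simp
  qed
  have neg: "?v absolutely_integrable_on {x..y} \<and> ?U y - ?U x = integral {x..y} ?v"
    if xy: "-pi < x" "x \<le> y" "y \<le> 0" for x y
  proof -
    have m: "-y \<in> {0..<pi}" "-x \<in> {0..<pi}" "-y \<le> -x" using xy by auto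
    note p = primitive_onD[OF B m]
    have "(\<lambda>x. b (- x)) absolutely_integrable_on {x..y}"
      using p(1) absolutely_integrable_reflect_real[where f=b and a="-y" and b="-x"] by simp
    from absolutely_integrable_continuous_mult[OF continuous_on_const this, of "-1"]
    have i: "(\<lambda>x. - b (- x)) absolutely_integrable_on {x..y}" by simp
    have 1: "?v absolutely_integrable_on {x..y}"
      by (rule absolutely_integrable_spike[OF i, of "{0}"]) (use xy in auto)
    have "integral {x..y} ?v = integral {x..y} (\<lambda>x. - b (- x))"
      by (rule integral_spike[of "{0}"]) (use xy in auto)
    also have "\<dots> = - integral {-y..-x} b"
      using Henstock_Kurzweil_Integration.integral_reflect_real[where f=b and a="-y" and b="-x"] by simp
    finally have "integral {x..y} ?v = B (- y) - B (- x)" using p(3) by (metis minus_diff_eq)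
    then show ?thesis using 1 xy AB by auto
  qed
  show ?thesis
    unfolding primitive_on_def
  proof (intro ballI impI)
    fix x y assume xy: "x \<in> per_interval" "y \<in> per_interval" "x \<le> y"
    consider "0 \<le> x" | "y \<le> 0" | "x < 0" "0 < y" by linarith
    then show "?v absolutely_integrable_on {x..y} \<and> ?U y - ?U x = integral {x..y} ?v"
    proof cases
      case 1
      with pos xy show ?thesis by simp
    next
      case 2
      with neg xy show ?thesis by simp
    next
      case 3
      note l = neg[of x 0] and r = pos[of 0 y]
      have i: "?v absolutely_integrable_on {x..y}"
        using absolutely_integrable_on_combine[where f="?v" and a=x and c=0 and b=y] l r 3 xy by auto
      have "integral {x..0} ?v + integral {0..y} ?v = integral {x..y} ?v"
        using 3 i by (intro Henstock_Kurzweil_Integration.integral_combine) (auto simp: absolutely_integrable_on_def)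
      then show ?thesis using i l r 3 xy by (auto simp: algebra_simps)
    qed
  qed
qed

text \<open>Let a tend to 0 in V b - V a, using continuity of V and of the indefinite integral. This
  is how the product rule with \<open>wt\<close> or its reciprocal, valid only for x > 0, reaches
  the end point.\<close>

lemma primitive_on_extend_0:
  assumes P: "primitive_on {0<..<pi} V q" and q: "\<And>b. b < pi \<Longrightarrow> q absolutely_integrable_on {0..b}"
    and lim: "(V \<longlongrightarrow> V 0) (at_right 0)"
  shows "primitive_on {0..<pi} V q"
proof -
  have from0: "V b - V 0 = integral {0..b} q" if b: "0 < b" "b < pi" for b
  proof -
    have qi: "q integrable_on {0..b}" using q[OF b(2)] by (simp add: absolutely_integrable_on_def)
    have "V b - V a = integral {0..b} q - integral {0..a} q" if a: "0 < a" "a < b" for a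
    proof -
      have m: "a \<in> {0<..<pi}" "b \<in> {0<..<pi}" "a \<le> b" using a b by auto
      show ?thesis
        using primitive_onD(3)[OF P m] Henstock_Kurzweil_Integration.integral_combine[of 0 a b q] a qi by (simp add: algebra_simps)
    qed
    then have "\<forall>\<^sub>F a in at_right 0. V b - integral {0..b} q = V a - integral {0..a} q"
      unfolding eventually_at_right_field using b by (intro exI[of _ b]) (auto simp: algebra_simps)
    moreover have "continuous (at 0 within {0..b}) (\<lambda>a. integral {0..a} q)"
      using indefinite_integral_continuous_1[OF qi] b by (simp add: continuous_on_eq_continuous_within)
    then have "((\<lambda>a. integral {0..a} q) \<longlongrightarrow> 0) (at_right 0)"
      using at_within_Icc_at_right[OF b(1)] by (simp add: continuous_within)
    then have "((\<lambda>a. V a - integral {0..a} q) \<longlongrightarrow> V 0 - 0) (at_right 0)"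
      by (intro tendsto_diff lim)
    ultimately have "((\<lambda>a::real. V b - integral {0..b} q) \<longlongrightarrow> V 0 - 0) (at_right 0)"
      by (simp add: tendsto_cong)
    then have "V b - integral {0..b} q = V 0" by (simp add: tendsto_const_iff)
    then show ?thesis by (simp add: algebra_simps)
  qed
  show ?thesis
    unfolding primitive_on_def
  proof (intro ballI impI conjI)
    fix a b assume ab: "a \<in> {0..<pi}" "b \<in> {0..<pi}" "a \<le> b"
    show "q absolutely_integrable_on {a..b}"
      using ab by (intro absolutely_integrable_on_subinterval[OF q[of b]]) auto
    show "V b - V a = integral {a..b} q"
    proof (cases "a = 0")
      case True
      then show ?thesis using from0[of b] ab by (cases "b = 0") auto
    next
      case False
      then show ?thesis using primitive_onD(3)[OF P, of a b] ab by auto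
    qed
  qed
qed

section \<open>Vanishing flux at 0 and reduction to the Volterra operator\<close>

context singular_ode
begin

lemma wt_mult_null:
  assumes V: "(V \<longlongrightarrow> 0) (at_right 0)"
  shows "((\<lambda>x. complex_of_real (wt x) * V x) \<longlongrightarrow> 0) (at_right 0)"
proof (rule Lim_null_comparison)
  show "\<forall>\<^sub>F x in at_right 0. norm (complex_of_real (wt x) * V x) \<le> wt 1 * cmod (V x)"
    unfolding eventually_at_right_field
  proof (intro exI[of _ 1] conjI allI impI)
    fix y :: real assume y: "0 < y" "y < 1"
    then have "wt y \<le> wt 1" "0 \<le> wt y" using pi_gt3 by (auto intro: wt_mono wt_nonneg)
    then show "norm (complex_of_real (wt y) * V y) \<le> wt 1 * cmod (V y)"
      by (simp add: norm_mult mult_right_mono)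
  qed simp
  show "((\<lambda>x. wt 1 * cmod (V x)) \<longlongrightarrow> 0) (at_right 0)"
    using tendsto_mult[OF tendsto_const tendsto_norm[OF V], of "wt 1"] by simp
qed

lemma primitive_on_tendsto_0:
  assumes "primitive_on {0..<pi} V q"
  shows "(V \<longlongrightarrow> V 0) (at_right 0)"
proof -
  have "primitive_on {0..1} V q" by (rule primitive_on_subset[OF assms]) (use pi_gt3 in auto)
  then have "continuous_on {0..1} V" by (rule primitive_on_continuous)
  then have "continuous (at 0 within {0..1}) V" by (simp add: continuous_on_eq_continuous_within)
  then show ?thesis using at_within_Icc_at_right[of 0 "1::real"] by (simp add: continuous_within)
qed

text \<open>\<open>1 / x\<close> is not integrable at \<open>0\<close>.\<close>

lemma flux_vanishes_at_0:
  assumes V: "primitive_on {0..<pi} V q" and U: "primitive_on {0..<pi} U (\<lambda>x. V x / of_real (f x))"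
  shows "V 0 = 0"
proof (rule ccontr)
  assume nz: "V 0 \<noteq> 0"
  define c where "c = cmod (V 0) / 2"
  have c: "c > 0" "c < cmod (V 0)" using nz unfolding c_def by auto
  have "\<forall>\<^sub>F x in at_right 0. f x / x < 1"
    using f_quotient_tendsto by (rule order_tendstoD) (use pi_gt3 in simp)
  moreover have "\<forall>\<^sub>F x in at_right 0. c < cmod (V x)"
    using tendsto_norm[OF primitive_on_tendsto_0[OF V]] c(2) by (rule order_tendstoD)
  ultimately have "\<forall>\<^sub>F x in at_right 0. f x / x < 1 \<and> c < cmod (V x)" by (rule eventually_conj)
  then obtain d0 where d0: "d0 > 0" "\<And>x. 0 < x \<Longrightarrow> x < d0 \<Longrightarrow> f x / x < 1 \<and> c < cmod (V x)"
    unfolding eventually_at_right_field by auto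
  define d where "d = min (d0 / 2) 1"
  have d: "d > 0" "d < d0" "d < pi" using d0(1) pi_gt3 unfolding d_def by auto
  define m where "m x = cmod (V x / of_real (f x))" for x
  have mi: "m integrable_on {0..d}"
    using primitive_onD(1)[OF U, of 0 d] d unfolding m_def by (simp add: absolutely_integrable_on_def)
  define M where "M = integral {0..d} m"
  have M0: "M \<ge> 0" unfolding M_def by (rule Henstock_Kurzweil_Integration.integral_nonneg[OF mi]) (simp add: m_def)
  \<comment> \<open>Chosen so that c (ln d - ln a) = M + 1 exceeds the total integral M.\<close>
  define a where "a = d * exp (- (M + 1) / c)"
  have a: "0 < a" "a < d" unfolding a_def using d(1) M0 c(1) by (auto simp: mult_less_cancel_left2 divide_neg_pos)
  have I: "((\<lambda>x. c * (1 / x)) has_integral c * (ln d - ln a)) {a..d}"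
    using a by (intro has_integral_mult_right fundamental_theorem_of_calculus)
      (auto simp: has_real_derivative_iff_has_vector_derivative[symmetric] intro!: derivative_eq_intros)
  have "integral {a..d} (\<lambda>x. c * (1 / x)) \<le> integral {a..d} m"
  proof (rule integral_le)
    show "(\<lambda>x. c * (1 / x)) integrable_on {a..d}" using I by blast
    show "m integrable_on {a..d}" by (rule integrable_on_subinterval[OF mi]) (use a in auto)
    fix x assume "x \<in> {a..d}"
    then have x: "0 < x" "x < d0" "x < pi" using a d by auto
    have fx: "0 < f x" "f x \<le> x" using d0(2)[OF x(1,2)] x f_pos[OF x(1,3)] by (auto simp: divide_less_eq)
    have "c * (1 / x) \<le> cmod (V x) * (1 / f x)"
      using d0(2)[OF x(1,2)] c fx x by (intro mult_mono) (auto intro: divide_left_mono)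
    then show "c * (1 / x) \<le> m x" unfolding m_def using fx by (simp add: norm_divide)
  qed
  also have "\<dots> \<le> M" unfolding M_def
    by (rule integral_subset_le) (use a mi in \<open>auto simp: m_def intro: integrable_on_subinterval\<close>)
  finally have "c * (ln d - ln a) \<le> M" using integral_unique[OF I] by simp
  moreover have "ln a = ln d - (M + 1) / c"
    unfolding a_def using d(1) by (simp add: ln_mult minus_divide_left)
  ultimately show False using c(1) by simp
qed

text \<open>\<open>V\<close> is the flux f U'. It vanishes at 0, so integrating (wt V)' = wt g /
  \<epsilon> gives wt V = J g / \<epsilon> with no free constant. Hence U' = JP g, and U 0 is the
  only constant of integration.\<close>

lemma half_line_solution:
  assumes g: "L2_half g"
    and U: "primitive_on {0..<pi} U u1" and V: "primitive_on {0..<pi} V q1" and N: "negligible N"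
    and e1: "\<And>x. 0 < x \<Longrightarrow> x < pi \<Longrightarrow> x \<notin> N \<Longrightarrow> of_real (f x) * u1 x = V x"
    and e2: "\<And>x. 0 < x \<Longrightarrow> x < pi \<Longrightarrow> x \<notin> N \<Longrightarrow> of_real \<epsilon> * q1 x + u1 x = g x"
    and x: "0 \<le> x" "x < pi"
  shows "U x = U 0 + K g x"
proof -
  have N': "negligible (insert 0 N)" using N by simp
  have fnz: "complex_of_real (f x) \<noteq> 0" if "0 < x" "x < pi" for x using f_pos[OF that] by simp
  have U2: "primitive_on {0..<pi} U (\<lambda>x. V x / of_real (f x))"
    by (rule primitive_on_spike[OF U N' is_interval_co]) (use e1 fnz in \<open>auto simp: field_simps\<close>)
  have V0: "V 0 = 0" using V U2 by (rule flux_vanishes_at_0)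
  have V2: "primitive_on {0..<pi} V (\<lambda>x. (g x - V x / of_real (f x)) / of_real \<epsilon>)"
  proof (rule primitive_on_spike[OF V N' is_interval_co])
    fix x assume "x \<in> {0..<pi} - insert 0 N"
    then have x: "0 < x" "x < pi" "x \<notin> N" by auto
    show "q1 x = (g x - V x / of_real (f x)) / of_real \<epsilon>"
    proof -
      have "V x / of_real (f x) = u1 x" using e1[OF x] fnz[OF x(1,2)] by (simp add: field_simps)
      then show ?thesis using e2[OF x] eps by (simp add: field_simps)
    qed
  qed
  have "primitive_on {0<..<pi} (\<lambda>x. of_real (wt x) * V x)
      (\<lambda>x. of_real (wt x) * ((g x - V x / of_real (f x)) / of_real \<epsilon>) + of_real (wt x / (\<epsilon> * f x)) * V x)"
  proof (rule primitive_on_mult)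
    show "primitive_on {0<..<pi} V (\<lambda>x. (g x - V x / of_real (f x)) / of_real \<epsilon>)"
      by (rule primitive_on_subset[OF V2]) auto
    show "(wt has_real_derivative wt x / (\<epsilon> * f x)) (at x within {0<..<pi})" if "x \<in> {0<..<pi}" for x
      using that by (intro DERIV_subset[OF wt_deriv]) auto
    show "continuous_on {0<..<pi} (\<lambda>x. wt x / (\<epsilon> * f x))"
      using isCont_wt isCont_f f_pos eps
      by (intro continuous_at_imp_continuous_on ballI isCont_divide isCont_mult) force+
  qed (rule is_interval_oo)
  then have "primitive_on {0<..<pi} (\<lambda>x. of_real (wt x) * V x) (\<lambda>x. 1 / of_real \<epsilon> * (of_real (wt x) * g x))"
  proof (rule primitive_on_spike[OF _ negligible_empty is_interval_oo])
    fix x assume "x \<in> {0<..<pi} - {}"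
    then have x: "0 < x" "x < pi" by auto
    show "of_real (wt x) * ((g x - V x / of_real (f x)) / of_real \<epsilon>) + of_real (wt x / (\<epsilon> * f x)) * V x
      = 1 / of_real \<epsilon> * (of_real (wt x) * g x)"
      using fnz[OF x] eps by (simp add: field_simps)
  qed
  then have wV: "primitive_on {0..<pi} (\<lambda>x. of_real (wt x) * V x) (\<lambda>x. 1 / of_real \<epsilon> * (of_real (wt x) * g x))"
  proof (rule primitive_on_extend_0)
    show "(\<lambda>x. 1 / of_real \<epsilon> * (of_real (wt x) * g x)) absolutely_integrable_on {0..b}" if "b < pi" for b
      using that by (intro absolutely_integrable_continuous_mult continuous_on_const wt_mult_integrable L2_halfD(1)[OF g]) auto
    show "((\<lambda>x. of_real (wt x) * V x) \<longlongrightarrow> of_real (wt 0) * V 0) (at_right 0)"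
      using wt_mult_null primitive_on_tendsto_0[OF V] by (simp add: V0)
  qed
  have wVJ: "V y / of_real (f y) = JP g y" if y: "0 < y" "y < pi" for y
  proof -
    have m: "0 \<in> {0..<pi}" "y \<in> {0..<pi}" "0 \<le> y" using y by auto
    have "of_real (wt y) * V y = J g y / of_real \<epsilon>"
      using primitive_onD(3)[OF wV m] unfolding J_def by (simp add: V0)
    then show ?thesis unfolding JP_def using wt_pos[OF y] eps fnz[OF y] by (simp add: field_simps)
  qed
  have "primitive_on {0..<pi} U (JP g)"
    by (rule primitive_on_spike[OF U2, of "{0}"]) (use wVJ is_interval_co in auto)
  then have "U x - U 0 = integral {0..x} (JP g)"
    using x pi_gt_zero by (intro primitive_onD(3)) auto
  then show ?thesis unfolding K_def by (simp add: algebra_simps)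
qed

text \<open>The function f u' for u = \<open>K g\<close>. At 0, division by zero yields the value 0,
  which is also the limit.\<close>

definition flux :: "(real \<Rightarrow> complex) \<Rightarrow> real \<Rightarrow> complex" where
  "flux g x = J g x / of_real (\<epsilon> * wt x)"

lemma f_JP: "0 \<le> x \<Longrightarrow> x < pi \<Longrightarrow> of_real (f x) * JP g x = flux g x"
  unfolding JP_def flux_def using f_pos[of x] by (cases "x = 0") (auto simp: f_0 wt_0)

lemma flux_0: "flux g 0 = 0"
  unfolding flux_def by (simp add: wt_0)

text \<open>This is \<epsilon> (f u')' = g - u' for u = \<open>K g\<close>. On the open interval it
  is the product rule with 1 / (\<epsilon> wt). At 0 the L2 bound of \<open>J g\<close> makes the
  flux O(sqrt x), so it is continuous there.\<close>

lemma flux_primitive: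
  assumes g: "L2_half g"
  shows "primitive_on {0..<pi} (flux g) (\<lambda>x. (g x - JP g x) / of_real \<epsilon>)"
proof (rule primitive_on_extend_0)
  have "primitive_on {0<..<pi} (\<lambda>x. of_real (1 / (\<epsilon> * wt x)) * J g x)
     (\<lambda>x. of_real (1 / (\<epsilon> * wt x)) * (of_real (wt x) * g x) + of_real (- 1 / (\<epsilon>\<^sup>2 * wt x * f x)) * J g x)"
  proof (rule primitive_on_mult)
    show "primitive_on {0<..<pi} (J g) (\<lambda>x. of_real (wt x) * g x)"
      by (rule primitive_on_subset[OF J_primitive[OF g]]) auto
    show "((\<lambda>x. 1 / (\<epsilon> * wt x)) has_real_derivative - 1 / (\<epsilon>\<^sup>2 * wt x * f x)) (at x within {0<..<pi})"
      if "x \<in> {0<..<pi}" for x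
    proof -
      have x: "0 < x" "x < pi" using that by auto
      have nz: "\<epsilon> * wt x \<noteq> 0" using eps wt_pos[OF x] by simp
      have "((\<lambda>x. inverse (\<epsilon> * wt x)) has_real_derivative - (\<epsilon> * (wt x / (\<epsilon> * f x)) * inverse ((\<epsilon> * wt x)\<^sup>2))) (at x)"
        using DERIV_inverse_fun[OF DERIV_cmult[OF wt_deriv[OF x], of \<epsilon>] nz] by (simp add: power2_eq_square)
      moreover have "- (\<epsilon> * (wt x / (\<epsilon> * f x)) * inverse ((\<epsilon> * wt x)\<^sup>2)) = - 1 / (\<epsilon>\<^sup>2 * wt x * f x)"
        using eps wt_pos[OF x] f_pos[OF x] by (simp add: field_simps power2_eq_square)
      ultimately have "((\<lambda>x. 1 / (\<epsilon> * wt x)) has_real_derivative - 1 / (\<epsilon>\<^sup>2 * wt x * f x)) (at x)"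
        by (simp add: inverse_eq_divide)
      then show ?thesis by (rule DERIV_subset) simp
    qed
    have "isCont (\<lambda>x. - 1 / (\<epsilon>\<^sup>2 * wt x * f x)) x" if "x \<in> {0<..<pi}" for x
      using that eps wt_pos[of x] f_pos[of x]
      by (intro isCont_divide isCont_mult isCont_wt isCont_f continuous_const) auto
    then show "continuous_on {0<..<pi} (\<lambda>x. - 1 / (\<epsilon>\<^sup>2 * wt x * f x))"
      by (intro continuous_at_imp_continuous_on) auto
  qed (rule is_interval_oo)
  then have "primitive_on {0<..<pi} (\<lambda>x. of_real (1 / (\<epsilon> * wt x)) * J g x) (\<lambda>x. (g x - JP g x) / of_real \<epsilon>)"
  proof (rule primitive_on_spike[OF _ negligible_empty is_interval_oo])
    fix x assume "x \<in> {0<..<pi} - {}"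
    then have x: "0 < x" "x < pi" by auto
    show "of_real (1 / (\<epsilon> * wt x)) * (of_real (wt x) * g x) + of_real (- 1 / (\<epsilon>\<^sup>2 * wt x * f x)) * J g x
      = (g x - JP g x) / of_real \<epsilon>"
      using wt_pos[OF x] f_pos[OF x] eps unfolding JP_def by (simp add: field_simps power2_eq_square)
  qed
  then show "primitive_on {0<..<pi} (flux g) (\<lambda>x. (g x - JP g x) / of_real \<epsilon>)"
    unfolding flux_def[abs_def] by (simp add: mult.commute)
  show "(\<lambda>x. (g x - JP g x) / of_real \<epsilon>) absolutely_integrable_on {0..b}" if "b < pi" for b
  proof -
    have "(\<lambda>x. 1 / of_real \<epsilon> * (g x - JP g x)) absolutely_integrable_on {0..b}"
      using that L2_halfD(1)[OF g] absolutely_integrable_on_subinterval[OF JP_integrable[OF g], of 0 b]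
      by (intro absolutely_integrable_continuous_mult continuous_on_const set_integral_diff(1)) auto
    then show ?thesis by simp
  qed
  obtain C where C: "C > 0" "\<And>y. 0 < y \<Longrightarrow> y < pi \<Longrightarrow> integral {0..y} (\<lambda>r. (wt r)\<^sup>2) \<le> C * (y * (pi - y)) * (wt y)\<^sup>2"
    using wt_square_integral_bound by blast
  show "(flux g \<longlongrightarrow> flux g 0) (at_right 0)"
    unfolding flux_0
  proof (rule Lim_null_comparison)
    show "\<forall>\<^sub>F x in at_right 0. norm (flux g x) \<le> sqrt C * sqrt (x * (pi - x)) * norm_half g / \<epsilon>"
      unfolding eventually_at_right_field
    proof (intro exI[of _ 1] conjI allI impI)
      fix y :: real assume "0 < y" "y < 1"
      then have y: "0 < y" "y < pi" using pi_gt3 by auto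
      have "norm (flux g y) = cmod (J g y) / (\<epsilon> * wt y)"
        unfolding flux_def using eps wt_pos[OF y] by (simp add: norm_divide norm_mult)
      also have "\<dots> \<le> sqrt C * sqrt (y * (pi - y)) * wt y * norm_half g / (\<epsilon> * wt y)"
        using J_bound_L2[OF C(2,1) g y] eps wt_pos[OF y] by (intro divide_right_mono) auto
      also have "\<dots> = sqrt C * sqrt (y * (pi - y)) * norm_half g / \<epsilon>"
        using wt_pos[OF y] by simp
      finally show "norm (flux g y) \<le> sqrt C * sqrt (y * (pi - y)) * norm_half g / \<epsilon>" .
    qed simp
    have "isCont (\<lambda>x. sqrt C * sqrt (x * (pi - x)) * norm_half g / \<epsilon>) 0"
      using eps by (intro continuous_intros) auto
    then show "((\<lambda>x. sqrt C * sqrt (x * (pi - x)) * norm_half g / \<epsilon>) \<longlongrightarrow> 0) (at_right 0)"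
      by (simp add: isCont_def filterlim_at_split)
  qed
qed

end

section \<open>The operator as an integral operator\<close>

lemma L2D:
  assumes "w \<in> L2"
  shows "w absolutely_integrable_on {-pi..pi}" "(\<lambda>x. (cmod (w x))\<^sup>2) integrable_on {-pi..pi}"
    "(norm_L2 w)\<^sup>2 = integral {-pi..pi} (\<lambda>x. (cmod (w x))\<^sup>2)"
proof -
  have m: "w \<in> borel_measurable per_measure" and i: "integrable per_measure (\<lambda>x. (cmod (w x))\<^sup>2)"
    using assms unfolding L2_def by auto
  have sq: "(\<lambda>x. (cmod (w x))\<^sup>2) integrable_on per_interval"
    by (rule integrable_on_lebesgue_on[OF i]) simp
  have one: "(\<lambda>x. 1::real) integrable_on per_interval"
    using integrable_on_Icc_iff_Ioo[of "\<lambda>_. 1::real" "-pi" pi] integrable_const_ivl[of "1::real" "-pi" pi] by blast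
  have "w absolutely_integrable_on per_interval"
  proof (rule measurable_bounded_by_integrable_imp_absolutely_integrable[OF m])
    show "(\<lambda>x. 1 + (cmod (w x))\<^sup>2) integrable_on per_interval"
      by (rule integrable_add[OF one sq])
    fix x
    have "0 \<le> (cmod (w x) - 1)\<^sup>2 + cmod (w x)" by simp
    then show "cmod (w x) \<le> 1 + (cmod (w x))\<^sup>2" by (simp add: power2_diff)
  qed simp
  then show "w absolutely_integrable_on {-pi..pi}" by (simp add: absolutely_integrable_on_Icc_iff_Ioo)
  show "(\<lambda>x. (cmod (w x))\<^sup>2) integrable_on {-pi..pi}" using sq by (simp add: integrable_on_Icc_iff_Ioo)
  have "(norm_L2 w)\<^sup>2 = (LINT x|per_measure. (cmod (w x))\<^sup>2)"
    unfolding norm_L2_def by (simp add: integral_nonneg_AE)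
  also have "\<dots> = integral per_interval (\<lambda>x. (cmod (w x))\<^sup>2)"
    by (rule lebesgue_integral_eq_integral[OF i]) simp
  also have "\<dots> = integral {-pi..pi} (\<lambda>x. (cmod (w x))\<^sup>2)"
    by (simp add: integral_open_interval_real)
  finally show "(norm_L2 w)\<^sup>2 = integral {-pi..pi} (\<lambda>x. (cmod (w x))\<^sup>2)" .
qed

lemma norm_L2_nonneg: "0 \<le> norm_L2 w"
  unfolding norm_L2_def by (simp add: integral_nonneg_AE)

lemma L2I:
  assumes "w absolutely_integrable_on {-pi..pi}" "(\<lambda>x. (cmod (w x))\<^sup>2) integrable_on {-pi..pi}"
  shows "w \<in> L2"
proof -
  have "w absolutely_integrable_on per_interval"
    using assms(1) by (simp add: absolutely_integrable_on_Icc_iff_Ioo)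
  then have m: "w \<in> borel_measurable per_measure"
    by (rule absolutely_integrable_imp_borel_measurable) simp
  have "(\<lambda>x. (cmod (w x))\<^sup>2) absolutely_integrable_on per_interval"
    using assms(2) by (intro nonnegative_absolutely_integrable_1) (auto simp: integrable_on_Icc_iff_Ioo)
  then have "integrable per_measure (\<lambda>x. (cmod (w x))\<^sup>2)"
    by (rule absolutely_integrable_imp_integrable) simp
  with m show ?thesis unfolding L2_def by simp
qed

lemma L2_half_reflect_L2:
  assumes "w \<in> L2"
  shows "L2_half w" "L2_half (\<lambda>x. w (- x))"
    "norm_half w \<le> norm_L2 w" "norm_half (\<lambda>x. w (- x)) \<le> norm_L2 w"
proof -
  note w = L2D[OF assms]
  show "L2_half w"
    unfolding L2_half_def
    using absolutely_integrable_on_subinterval[OF w(1), of 0 pi] integrable_on_subinterval[OF w(2), of 0 pi] by auto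
  have r1: "w absolutely_integrable_on {-pi..0}" and r2: "(\<lambda>x. (cmod (w x))\<^sup>2) integrable_on {-pi..0}"
    using absolutely_integrable_on_subinterval[OF w(1), of "-pi" 0] integrable_on_subinterval[OF w(2), of "-pi" 0] by auto
  show "L2_half (\<lambda>x. w (- x))"
    unfolding L2_half_def
    using r1 r2 absolutely_integrable_reflect_real[where f=w and a="-pi" and b=0]
      Henstock_Kurzweil_Integration.integrable_reflect_real[where f="\<lambda>x. (cmod (w x))\<^sup>2" and a="-pi" and b=0] by simp
  have "integral {0..pi} (\<lambda>x. (cmod (w x))\<^sup>2) \<le> (norm_L2 w)\<^sup>2"
    unfolding w(3) by (rule integral_subset_le) (use w(2) in \<open>auto intro: integrable_on_subinterval\<close>)
  then have "norm_half w \<le> sqrt ((norm_L2 w)\<^sup>2)" unfolding norm_half_def by (rule real_sqrt_le_mono)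
  then show "norm_half w \<le> norm_L2 w" using norm_L2_nonneg by simp
  have "integral {0..pi} (\<lambda>x. (cmod (w (- x)))\<^sup>2) = integral {-pi..0} (\<lambda>x. (cmod (w x))\<^sup>2)"
    using Henstock_Kurzweil_Integration.integral_reflect_real[where f="\<lambda>x. (cmod (w x))\<^sup>2" and a="-pi" and b=0] by simp
  also have "\<dots> \<le> (norm_L2 w)\<^sup>2"
    unfolding w(3) by (rule integral_subset_le) (use w(2) in \<open>auto intro: integrable_on_subinterval\<close>)
  finally have "norm_half (\<lambda>x. w (- x)) \<le> sqrt ((norm_L2 w)\<^sup>2)" unfolding norm_half_def by (rule real_sqrt_le_mono)
  then show "norm_half (\<lambda>x. w (- x)) \<le> norm_L2 w" using norm_L2_nonneg by simp
qed

lemma L2_ae_continuous: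
  assumes U: "continuous_on {-pi..pi} U" and e: "ae_eq u U"
  shows "u \<in> L2"
    and "\<And>B. B \<ge> 0 \<Longrightarrow> (\<And>x. -pi < x \<Longrightarrow> x < pi \<Longrightarrow> cmod (U x) \<le> B) \<Longrightarrow> norm_L2 u \<le> sqrt (2 * pi) * B"
proof -
  define N where "N = {x \<in> per_interval. u x \<noteq> U x} \<union> {-pi, pi}"
  have N: "negligible N" using e unfolding N_def ae_eq_iff_negligible by simp
  have uU: "u x = U x" if "x \<in> {-pi..pi} - N" for x using that unfolding N_def by auto
  have i: "u absolutely_integrable_on {-pi..pi}"
    by (rule absolutely_integrable_spike[OF absolutely_integrable_continuous_real[OF U] N]) (rule uU)
  have i2: "(\<lambda>x. (cmod (U x))\<^sup>2) integrable_on {-pi..pi}"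
    by (intro integrable_continuous_real continuous_intros U)
  have "(\<lambda>x. (cmod (u x))\<^sup>2) integrable_on {-pi..pi}"
    by (rule integrable_spike[OF i2 N]) (simp add: uU)
  with i show L2: "u \<in> L2" by (rule L2I)
  fix B :: real assume B: "B \<ge> 0" "\<And>x. -pi < x \<Longrightarrow> x < pi \<Longrightarrow> cmod (U x) \<le> B"
  have "(norm_L2 u)\<^sup>2 = integral {-pi..pi} (\<lambda>x. (cmod (u x))\<^sup>2)" by (rule L2D(3)[OF L2])
  also have "\<dots> = integral {-pi..pi} (\<lambda>x. (cmod (U x))\<^sup>2)"
    by (rule integral_spike[OF N]) (simp add: uU)
  also have "\<dots> = integral {-pi<..<pi} (\<lambda>x. (cmod (U x))\<^sup>2)" by (rule integral_open_interval_real)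
  also have "\<dots> \<le> integral {-pi<..<pi} (\<lambda>_. B\<^sup>2)"
  proof (rule integral_le)
    show "(\<lambda>x. (cmod (U x))\<^sup>2) integrable_on per_interval"
      using i2 by (simp add: integrable_on_Icc_iff_Ioo)
    show "(\<lambda>x. B\<^sup>2) integrable_on per_interval"
      using integrable_on_Icc_iff_Ioo[of "\<lambda>_. B\<^sup>2" "-pi" pi] integrable_const_ivl[of "B\<^sup>2" "-pi" pi] by blast
  qed (use B in \<open>auto intro: power_mono\<close>)
  also have "\<dots> = 2 * pi * B\<^sup>2" unfolding integral_open_interval_real[symmetric] by simp
  also have "\<dots> = (sqrt (2 * pi) * B)\<^sup>2" by (simp add: power_mult_distrib)
  finally show "norm_L2 u \<le> sqrt (2 * pi) * B"
    by (rule power2_le_imp_le) (use B in simp)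
qed

lemma weak_deriv_cong:
  assumes W: "weak_deriv U v" and e: "ae_eq u U"
  shows "weak_deriv u v"
proof -
  define N where "N = {x \<in> per_interval. u x \<noteq> U x}"
  have N: "negligible N" using e unfolding N_def ae_eq_iff_negligible .
  have U: "loc_integrable U" and v: "loc_integrable v" using W unfolding weak_deriv_def by auto
  have u: "loc_integrable u"
  proof (rule loc_integrableI)
    fix a b assume ab: "- pi < a" "a < b" "b < pi"
    show "u absolutely_integrable_on {a..b}"
      by (rule absolutely_integrable_spike[OF loc_integrableD[OF U ab(1,3)] N]) (use ab in \<open>auto simp: N_def\<close>)
  qed
  have "(LINT x|per_measure. u x * of_real (deriv \<phi> x)) = (LINT x|per_measure. U x * of_real (deriv \<phi> x))"
    if T: "test_function \<phi>" for \<phi>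
  proof -
    obtain A B where AB: "-pi < A" "B < pi"
      "\<forall>x. x \<notin> {A..B} \<longrightarrow> deriv \<phi> x = 0" "continuous_on UNIV (deriv \<phi>)"
      using test_functionE[OF T] by metis
    have "integral {A..B} (\<lambda>x. u x * of_real (deriv \<phi> x)) = integral {A..B} (\<lambda>x. U x * of_real (deriv \<phi> x))"
      by (rule integral_spike[OF N]) (use AB in \<open>auto simp: N_def\<close>)
    then show ?thesis
      using loc_integrable_mult(2)[OF u AB(4,1,2,3)] loc_integrable_mult(2)[OF U AB(4,1,2,3)] by simp
  qed
  then show ?thesis using W u v unfolding weak_deriv_def by simp
qed

lemma ae_eq_continuous_imp_eq:
  assumes U: "continuous_on per_interval U" and W: "continuous_on per_interval W"
    and e: "ae_eq U W" and x: "x \<in> per_interval"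
  shows "U x = W x"
proof (rule ccontr)
  assume ne: "U x \<noteq> W x"
  have "open {x \<in> per_interval. U x - W x \<in> - {0}}"
    using continuous_open_preimage[of per_interval "\<lambda>x. U x - W x" "- {0}"] U W
    by (auto intro!: continuous_intros simp: vimage_def Int_def)
  moreover have "x \<in> {x \<in> per_interval. U x - W x \<in> - {0}}" using ne x by auto
  ultimately have "\<not> negligible {x \<in> per_interval. U x - W x \<in> - {0}}"
    using open_not_negligible by blast
  then show False using e unfolding ae_eq_iff_negligible by simp
qed

lemma ae_eq_sym: "ae_eq u v \<Longrightarrow> ae_eq v u"
  unfolding ae_eq_def by (auto elim: eventually_mono)

lemma ae_eq_trans: "ae_eq u v \<Longrightarrow> ae_eq v w \<Longrightarrow> ae_eq u w"
  unfolding ae_eq_def by (auto elim: eventually_elim2)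

context singular_ode
begin

text \<open>Dividing \<i>\<epsilon>(f u')' + \<i> u' = w by \<i> gives the right side - \<i> w.
  Since f is odd, v(x) = u(-x) makes \<epsilon> (f v')' + v' the negative of the reflected
  expression for u, so the equation keeps its form and the data change sign.\<close>

definition gR :: "(real \<Rightarrow> complex) \<Rightarrow> real \<Rightarrow> complex" where "gR w x = - \<i> * w x"
definition gL :: "(real \<Rightarrow> complex) \<Rightarrow> real \<Rightarrow> complex" where "gL w x = \<i> * w (- x)"

lemma L2_half_gR: "w \<in> L2 \<Longrightarrow> L2_half (gR w)"
  unfolding gR_def[abs_def] by (rule L2_half_cmult, rule L2_half_reflect_L2)

lemma L2_half_gL: "w \<in> L2 \<Longrightarrow> L2_half (gL w)"
  unfolding gL_def[abs_def] by (rule L2_half_cmult, rule L2_half_reflect_L2)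

definition glue :: "(real \<Rightarrow> complex) \<Rightarrow> (real \<Rightarrow> complex) \<Rightarrow> real \<Rightarrow> complex" where
  "glue A B x = (if 0 \<le> x then A x else B (- x))"

lemma continuous_on_glue:
  assumes A: "continuous_on {0..pi} A" and B: "continuous_on {0..pi} B" and "A 0 = B 0"
  shows "continuous_on {-pi..pi} (glue A B)"
proof -
  have "continuous_on {-pi..0} (\<lambda>x. B (- x))"
    by (rule continuous_on_compose2[OF B]) (auto intro!: continuous_intros)
  then have "continuous_on ({0..pi} \<union> {-pi..0}) (\<lambda>x. if 0 \<le> x then A x else B (- x))"
    using A assms(3) by (intro continuous_on_If) auto
  moreover have "{0..pi} \<union> {-pi..0} = {-pi..pi}" by auto
  ultimately show ?thesis unfolding glue_def[abs_def] by simp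
qed

text \<open>Integrating the equation twice turns \<open>L_per\<close> into an integral operator on each half of
  the interval; the two halves are coupled by the values at \<open>0\<close> and at \<open>\<plusminus>\<pi>\<close>.\<close>

lemma L_per_imp:
  assumes uw: "(u, w) \<in> L_per \<epsilon> f"
  obtains c where "ae_eq u (glue (\<lambda>x. c + K (gR w) x) (\<lambda>x. c + K (gL w) x))" "K (gR w) pi = K (gL w) pi"
proof -
  from uw obtain u' q where w: "w \<in> L2" and bc: "periodic_bc u" and W1: "weak_deriv u u'"
    and W2: "weak_deriv (\<lambda>x. of_real (f x) * u' x) q"
    and we: "ae_eq w (\<lambda>x. \<i> * of_real \<epsilon> * q x + \<i> * u' x)"
    unfolding L_per_def L_per_dom_def L_expr_def by auto
  obtain U where U: "primitive_on per_interval U u'" "ae_eq u U"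
    using primitive_on_if_weak_deriv[OF W1] .
  obtain V where V: "primitive_on per_interval V q" "ae_eq (\<lambda>x. of_real (f x) * u' x) V"
    using primitive_on_if_weak_deriv[OF W2] .
  define N where "N = {x \<in> per_interval. of_real (f x) * u' x \<noteq> V x} \<union>
    {x \<in> per_interval. w x \<noteq> \<i> * of_real \<epsilon> * q x + \<i> * u' x}"
  have N: "negligible N" using V(2) we unfolding N_def ae_eq_iff_negligible by simp
  have e1: "of_real (f x) * u' x = V x" and e2: "of_real \<epsilon> * q x + u' x = - \<i> * w x"
    if "x \<in> per_interval" "x \<notin> N" for x
    using that unfolding N_def by (auto simp: algebra_simps)
  have sub: "{0..<pi} \<subseteq> per_interval" using pi_gt_zero by auto
  have right: "U x = U 0 + K (gR w) x" if "0 \<le> x" "x < pi" for x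
  proof (rule half_line_solution[OF L2_half_gR[OF w] primitive_on_subset[OF U(1) sub] primitive_on_subset[OF V(1) sub] N _ _ that])
    fix x assume "0 < x" "x < pi" "x \<notin> N"
    then show "of_real (f x) * u' x = V x" "of_real \<epsilon> * q x + u' x = gR w x"
      using e1[of x] e2[of x] unfolding gR_def by auto
  qed
  have left: "U (- x) = U 0 + K (gL w) x" if "0 \<le> x" "x < pi" for x
  proof -
    have "U (- x) = U (- 0) + K (gL w) x"
    proof (rule half_line_solution[where U="\<lambda>x. U (- x)" and V="\<lambda>x. V (- x)", OF L2_half_gL[OF w]
          primitive_on_subset[OF primitive_on_reflect[OF U(1)] sub]
          primitive_on_subset[OF primitive_on_reflect[OF V(1)] sub] negligible_uminus_image[OF N] _ _ that])
      fix x assume x: "0 < x" "x < pi" "x \<notin> uminus ` N"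
      have "- x \<notin> N"
      proof
        assume "- x \<in> N"
        then have "- (- x) \<in> uminus ` N" by (rule imageI)
        then show False using x(3) by simp
      qed
      then have e: "of_real (f (- x)) * u' (- x) = V (- x)" "of_real \<epsilon> * q (- x) + u' (- x) = - \<i> * w (- x)"
        using e1[of "- x"] e2[of "- x"] x by auto
      show "of_real (f x) * - u' (- x) = V (- x)" using e(1) by (simp add: f_odd)
      have "of_real \<epsilon> * - q (- x) + - u' (- x) = - (of_real \<epsilon> * q (- x) + u' (- x))" by simp
      then show "of_real \<epsilon> * - q (- x) + - u' (- x) = gL w x"
        unfolding e(2) gL_def by simp
    qed
    then show ?thesis by simp
  qed
  define A where "A x = U 0 + K (gR w) x" for x
  define B where "B x = U 0 + K (gL w) x" for x
  have cA: "continuous_on {0..pi} A" and cB: "continuous_on {0..pi} B"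
    unfolding A_def B_def by (intro continuous_intros K_continuous L2_half_gR L2_half_gL w)+
  have AB0: "A 0 = B 0" unfolding A_def B_def by (simp add: K_0)
  have UG: "U x = glue A B x" if "x \<in> per_interval" for x
    using right[of x] left[of "- x"] that unfolding glue_def A_def B_def by auto
  have cG: "continuous_on {-pi..pi} (glue A B)" by (rule continuous_on_glue[OF cA cB AB0])
  have uG: "ae_eq u (glue A B)"
    using U(2) UG unfolding ae_eq_iff_negligible by (auto elim!: negligible_subset)
  \<comment> \<open>The boundary condition speaks of some continuous representative
    \<open>W\<close>. It agrees with the glued function on the open interval, hence by continuity
    also at both end points.\<close>
  obtain W where W: "continuous_on {-pi..pi} W" "ae_eq u W" "W (- pi) = W pi"
    using bc unfolding periodic_bc_def by blast
  have WG: "W x = glue A B x" if "x \<in> per_interval" for x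
    by (rule ae_eq_continuous_imp_eq[OF _ _ ae_eq_trans[OF ae_eq_sym[OF W(2)] uG] that])
      (auto intro: continuous_on_subset[OF W(1)] continuous_on_subset[OF cG])
  have cl: "closure per_interval = {-pi..pi}" by simp
  have "W x - glue A B x = 0" if "x \<in> {-pi..pi}" for x
    by (rule continuous_constant_on_closure[where S=per_interval and f="\<lambda>x. W x - glue A B x"])
      (use WG that in \<open>auto simp: cl intro!: continuous_intros W(1) cG\<close>)
  from this[of pi] this[of "- pi"] W(3) have "glue A B pi = glue A B (- pi)" by simp
  then have "K (gR w) pi = K (gL w) pi" unfolding glue_def A_def B_def using pi_gt_zero by simp
  then show ?thesis using that uG unfolding A_def B_def by blast
qed

text \<open>The two functions match at 0 by the common constant \<open>c\<close>, and their fluxes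
  match because both vanish there. So \<open>u\<close> and f u' both have weak derivatives across 0,
  given piecewise.\<close>

lemma L_per_if:
  assumes w: "w \<in> L2" and u: "ae_eq u (glue (\<lambda>x. c + K (gR w) x) (\<lambda>x. c + K (gL w) x))"
    and bc: "K (gR w) pi = K (gL w) pi"
  shows "(u, w) \<in> L_per \<epsilon> f"
proof -
  define A where "A x = c + K (gR w) x" for x
  define B where "B x = c + K (gL w) x" for x
  note gR = L2_half_gR[OF w] and gL = L2_half_gL[OF w]
  have cA: "continuous_on {0..pi} A" and cB: "continuous_on {0..pi} B"
    unfolding A_def B_def by (intro continuous_intros K_continuous gR gL)+
  have AB0: "A 0 = B 0" unfolding A_def B_def by (simp add: K_0)
  have cG: "continuous_on {-pi..pi} (glue A B)" by (rule continuous_on_glue[OF cA cB AB0])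
  have uG: "ae_eq u (glue A B)" using u unfolding A_def[abs_def] B_def[abs_def] .
  define u' where "u' x = (if 0 \<le> x then JP (gR w) x else - JP (gL w) (- x))" for x
  define q where "q x = (if 0 \<le> x then (gR w x - JP (gR w) x) / of_real \<epsilon>
      else - ((gL w (- x) - JP (gL w) (- x)) / of_real \<epsilon>))" for x
  have "primitive_on {0..<pi} (K (gR w)) (JP (gR w))" "primitive_on {0..<pi} (K (gL w)) (JP (gL w))"
    by (rule primitive_on_subset[OF K_primitive[OF gR]], force)
      (rule primitive_on_subset[OF K_primitive[OF gL]], force)
  then have "primitive_on {0..<pi} A (JP (gR w))" "primitive_on {0..<pi} B (JP (gL w))"
    unfolding A_def B_def primitive_on_def by simp_all
  then have "primitive_on per_interval (glue A B) u'"
    unfolding glue_def[abs_def] u'_def[abs_def] by (rule primitive_on_glue) (rule AB0)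
  then have W1: "weak_deriv u u'" using weak_deriv_cong[OF weak_deriv_if_primitive_on uG] by blast
  have "primitive_on per_interval (glue (flux (gR w)) (flux (gL w))) q"
    unfolding glue_def[abs_def] q_def[abs_def]
    by (rule primitive_on_glue[OF flux_primitive[OF gR] flux_primitive[OF gL]]) (simp add: flux_0)
  moreover have fu': "of_real (f x) * u' x = glue (flux (gR w)) (flux (gL w)) x" if "x \<in> per_interval" for x
    using f_JP[of x "gR w"] f_JP[of "- x" "gL w"] f_odd[of x] that unfolding u'_def glue_def by auto
  then have "ae_eq (\<lambda>x. of_real (f x) * u' x) (glue (flux (gR w)) (flux (gL w)))"
    unfolding ae_eq_iff_negligible by (simp cong: conj_cong)
  ultimately have W2: "weak_deriv (\<lambda>x. of_real (f x) * u' x) q"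
    using weak_deriv_cong[OF weak_deriv_if_primitive_on] by blast
  have "w x = \<i> * of_real \<epsilon> * q x + \<i> * u' x" for x
    unfolding q_def u'_def gR_def gL_def using eps by (auto simp: field_simps)
  then have we: "ae_eq w (\<lambda>x. \<i> * of_real \<epsilon> * q x + \<i> * u' x)"
    unfolding ae_eq_def by simp
  have "L_expr \<epsilon> f u w" unfolding L_expr_def using W1 W2 we by blast
  moreover have "periodic_bc u"
    unfolding periodic_bc_def
  proof (intro exI conjI)
    show "glue A B (- pi) = glue A B pi"
    proof -
      have "\<not> pi \<le> 0" using pi_gt_zero by linarith
      then show ?thesis unfolding glue_def A_def B_def using bc by simp
    qed
  qed (rule cG, rule uG)
  moreover have "u \<in> L2" by (rule L2_ae_continuous(1)[OF cG uG])
  ultimately show ?thesis unfolding L_per_def L_per_dom_def using w by blast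
qed

end

section \<open>The spectrum\<close>

lemma L2_add_cmult:
  assumes "w \<in> L2" "u \<in> L2"
  shows "(\<lambda>x. w x + c * u x) \<in> L2"
proof -
  have m: "w \<in> borel_measurable per_measure" "u \<in> borel_measurable per_measure"
    and i: "integrable per_measure (\<lambda>x. (cmod (w x))\<^sup>2)" "integrable per_measure (\<lambda>x. (cmod (u x))\<^sup>2)"
    using assms unfolding L2_def by auto
  have m': "(\<lambda>x. w x + c * u x) \<in> borel_measurable per_measure"
    using m by measurable
  have "integrable per_measure (\<lambda>x. (cmod (w x + c * u x))\<^sup>2)"
  proof (rule Bochner_Integration.integrable_bound)
    show "integrable per_measure (\<lambda>x. 2 * (cmod (w x))\<^sup>2 + 2 * (cmod c)\<^sup>2 * (cmod (u x))\<^sup>2)"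
      using i by simp
    show "(\<lambda>x. (cmod (w x + c * u x))\<^sup>2) \<in> borel_measurable per_measure"
      using m' by measurable
    have "(cmod (w x + c * u x))\<^sup>2 \<le> 2 * (cmod (w x))\<^sup>2 + 2 * (cmod c)\<^sup>2 * (cmod (u x))\<^sup>2" for x
    proof -
      have "(cmod (w x + c * u x))\<^sup>2 \<le> (cmod (w x) + cmod (c * u x))\<^sup>2"
        by (intro power_mono norm_triangle_ineq) auto
      also have "\<dots> \<le> 2 * (cmod (w x))\<^sup>2 + 2 * (cmod (c * u x))\<^sup>2"
        using sum_squares_bound[of "cmod (w x)" "cmod (c * u x)"] by (simp add: power2_sum)
      finally show ?thesis by (simp add: norm_mult power_mult_distrib mult.assoc)
    qed
    then show "AE x in per_measure. norm ((cmod (w x + c * u x))\<^sup>2) \<le>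
        norm (2 * (cmod (w x))\<^sup>2 + 2 * (cmod c)\<^sup>2 * (cmod (u x))\<^sup>2)"
      by (intro AE_I2) (auto intro: order_trans[OF _ abs_ge_self])
  qed
  with m' show ?thesis unfolding L2_def by simp
qed

section \<open>Matching the two halves\<close>

context singular_ode
begin

text \<open>\<open>YR\<close> and \<open>YL\<close> solve (L - l) u = y on the right and, in the
  reflected variable, on the left half, with value \<open>c\<close> at 0: a multiple of the
  homogeneous solution plus the solution with value 0 at 0.\<close>

definition YR :: "complex \<Rightarrow> complex \<Rightarrow> (real \<Rightarrow> complex) \<Rightarrow> real \<Rightarrow> complex" where
  "YR l c y x = c * \<phi> (- \<i> * l) x + S (- \<i> * l) (K (gR y)) x"

definition YL :: "complex \<Rightarrow> complex \<Rightarrow> (real \<Rightarrow> complex) \<Rightarrow> real \<Rightarrow> complex" where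
  "YL l c y x = c * \<phi> (\<i> * l) x + S (\<i> * l) (K (gL y)) x"

definition \<Delta> :: "complex \<Rightarrow> complex" where
  "\<Delta> l = \<phi> (- \<i> * l) pi - \<phi> (\<i> * l) pi"

lemma YR_YL_continuous:
  assumes "y \<in> L2"
  shows "continuous_on {0..pi} (YR l c y)" "continuous_on {0..pi} (YL l c y)"
  unfolding YR_def[abs_def] YL_def[abs_def]
  by (intro continuous_intros \<phi>_continuous S_continuous K_continuous L2_half_gR L2_half_gL assms)+

lemma YR_YL_equation:
  assumes y: "y \<in> L2" and x: "0 \<le> x" "x \<le> pi"
  shows "YR l c y x = c + K (gR y) x + - \<i> * l * K (YR l c y) x"
    and "YL l c y x = c + K (gL y) x + \<i> * l * K (YL l c y) x"
proof -
  have cR: "continuous_on {0..pi} (K (gR y))" and cL: "continuous_on {0..pi} (K (gL y))"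
    by (intro K_continuous L2_half_gR L2_half_gL y)+
  have cR': "continuous_on {0..pi} (\<lambda>x. c + K (gR y) x)" and cL': "continuous_on {0..pi} (\<lambda>x. c + K (gL y) x)"
    by (intro continuous_intros cR cL)+
  have R: "YR l c y x = S (- \<i> * l) (\<lambda>x. c + K (gR y) x) x" if "0 \<le> x" "x \<le> pi" for x
    unfolding YR_def using S_add_const[OF cR that] by simp
  have L: "YL l c y x = S (\<i> * l) (\<lambda>x. c + K (gL y) x) x" if "0 \<le> x" "x \<le> pi" for x
    unfolding YL_def using S_add_const[OF cL that] by simp
  have "K (YR l c y) x = K (S (- \<i> * l) (\<lambda>x. c + K (gR y) x)) x"
    by (rule K_cong[where N="{}"]) (use R x in auto)
  then show "YR l c y x = c + K (gR y) x + - \<i> * l * K (YR l c y) x"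
    using S_equation[OF cR' x] R[OF x] by simp
  have "K (YL l c y) x = K (S (\<i> * l) (\<lambda>x. c + K (gL y) x)) x"
    by (rule K_cong[where N="{}"]) (use L x in auto)
  then show "YL l c y x = c + K (gL y) x + \<i> * l * K (YL l c y) x"
    using S_equation[OF cL' x] L[OF x] by simp
qed

lemma YR_YL_0: "y \<in> L2 \<Longrightarrow> YR l c y 0 = c" "y \<in> L2 \<Longrightarrow> YL l c y 0 = c"
  using YR_YL_equation[of y 0 l c] by (simp_all add: K_0)

lemma glue_ae_half:
  assumes "ae_eq u (glue A B)"
  obtains N where "negligible N" "\<And>x. x \<in> {0..pi} - N \<Longrightarrow> u x = A x" "\<And>x. x \<in> {0..pi} - N \<Longrightarrow> u (- x) = B x"
proof -
  define N0 where "N0 = {x \<in> per_interval. u x \<noteq> glue A B x}"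
  have N0: "negligible N0" using assms unfolding N0_def ae_eq_iff_negligible .
  show ?thesis
  proof (rule that[of "N0 \<union> uminus ` N0 \<union> {0, pi}"])
    show "negligible (N0 \<union> uminus ` N0 \<union> {0, pi})"
      using N0 negligible_uminus_image[OF N0] by simp
    fix x assume x: "x \<in> {0..pi} - (N0 \<union> uminus ` N0 \<union> {0, pi})"
    then have "x \<in> per_interval" "- x \<in> per_interval" "0 < x" by auto
    moreover have "- x \<notin> N0" using x by (metis DiffE UnCI imageI minus_minus)
    ultimately show "u x = A x" "u (- x) = B x"
      using x unfolding N0_def glue_def by auto
  qed
qed

text \<open>(L - l) u = y means L u = y + l u. Splitting the data this way turns the integral
  representation of u into a Volterra equation, with parameter - \<i> l on the right and \<i> l on
  the left.\<close>

lemma K_gR_gL_shift: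
  assumes y: "y \<in> L2" and AB: "L2_half A" "L2_half B" and u: "ae_eq u (glue A B)" and x: "x \<le> pi"
  shows "K (gR (\<lambda>x. y x + l * u x)) x = K (gR y) x + - \<i> * l * K A x"
    and "K (gL (\<lambda>x. y x + l * u x)) x = K (gL y) x + \<i> * l * K B x"
proof -
  obtain N where N: "negligible N" "\<And>x. x \<in> {0..pi} - N \<Longrightarrow> u x = A x" "\<And>x. x \<in> {0..pi} - N \<Longrightarrow> u (- x) = B x"
    using glue_ae_half[OF u] by blast
  have "K (gR (\<lambda>x. y x + l * u x)) x = K (\<lambda>x. gR y x + (- \<i> * l) * A x) x"
    by (rule K_cong[OF N(1) _ x]) (use N(2) in \<open>simp add: gR_def algebra_simps\<close>)
  then show "K (gR (\<lambda>x. y x + l * u x)) x = K (gR y) x + - \<i> * l * K A x"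
    using K_add[OF L2_half_gR[OF y] L2_half_cmult[OF AB(1)] x, of "- \<i> * l"] K_cmult[of "- \<i> * l" A x] by simp
  have "K (gL (\<lambda>x. y x + l * u x)) x = K (\<lambda>x. gL y x + (\<i> * l) * B x) x"
    by (rule K_cong[OF N(1) _ x]) (use N(3) in \<open>simp add: gL_def algebra_simps\<close>)
  then show "K (gL (\<lambda>x. y x + l * u x)) x = K (gL y) x + \<i> * l * K B x"
    using K_add[OF L2_half_gL[OF y] L2_half_cmult[OF AB(2)] x, of "\<i> * l"] K_cmult[of "\<i> * l" B x] by simp
qed

lemma op_minus_imp:
  assumes "(u, y) \<in> op_minus (L_per \<epsilon> f) l"
  obtains c where "y \<in> L2" "ae_eq u (glue (YR l c y) (YL l c y))" "YR l c y pi = YL l c y pi"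
proof -
  from assms obtain w where w: "(u, w) \<in> L_per \<epsilon> f" and y: "y = (\<lambda>x. w x - l * u x)"
    unfolding op_minus_def by auto
  then have L2: "w \<in> L2" "u \<in> L2" unfolding L_per_def L_per_dom_def by auto
  have yL2: "y \<in> L2" using L2_add_cmult[OF L2, of "- l"] unfolding y by simp
  have wy: "w = (\<lambda>x. y x + l * u x)" unfolding y by simp
  obtain c where c: "ae_eq u (glue (\<lambda>x. c + K (gR w) x) (\<lambda>x. c + K (gL w) x))" "K (gR w) pi = K (gL w) pi"
    using L_per_imp[OF w] .
  define A where "A x = c + K (gR w) x" for x
  define B where "B x = c + K (gL w) x" for x
  have cAB: "continuous_on {0..pi} A" "continuous_on {0..pi} B"
    unfolding A_def B_def by (intro continuous_intros K_continuous L2_half_gR L2_half_gL L2)+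
  have cR: "continuous_on {0..pi} (K (gR y))" and cL: "continuous_on {0..pi} (K (gL y))"
    by (intro K_continuous L2_half_gR L2_half_gL yL2)+
  have u: "ae_eq u (glue A B)" using c(1) unfolding A_def[abs_def] B_def[abs_def] .
  note shift = K_gR_gL_shift[OF yL2 L2_half_continuous[OF cAB(1)] L2_half_continuous[OF cAB(2)] u, where l=l, folded wy]
  have A: "A x = YR l c y x" if "0 \<le> x" "x \<le> pi" for x
  proof -
    have "A x = S (- \<i> * l) (\<lambda>x. c + K (gR y) x) x"
    proof (rule Volterra_unique[OF L2_half_continuous[OF cAB(1)] _ _ that])
      show "continuous_on {0..pi} (\<lambda>x. c + K (gR y) x)" by (intro continuous_intros cR)
      show "A x = c + K (gR y) x + - \<i> * l * K A x" if "0 \<le> x" "x \<le> pi" for x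
        using shift(1)[OF that(2)] unfolding A_def by simp
    qed
    then show ?thesis unfolding YR_def using S_add_const[OF cR that] by simp
  qed
  have B: "B x = YL l c y x" if "0 \<le> x" "x \<le> pi" for x
  proof -
    have "B x = S (\<i> * l) (\<lambda>x. c + K (gL y) x) x"
    proof (rule Volterra_unique[OF L2_half_continuous[OF cAB(2)] _ _ that])
      show "continuous_on {0..pi} (\<lambda>x. c + K (gL y) x)" by (intro continuous_intros cL)
      show "B x = c + K (gL y) x + \<i> * l * K B x" if "0 \<le> x" "x \<le> pi" for x
        using shift(2)[OF that(2)] unfolding B_def by simp
    qed
    then show ?thesis unfolding YL_def using S_add_const[OF cL that] by simp
  qed
  have "glue A B x = glue (YR l c y) (YL l c y) x" if "x \<in> per_interval" for x
    using A[of x] B[of "- x"] that unfolding glue_def by auto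
  then have "ae_eq u (glue (YR l c y) (YL l c y))"
    using u unfolding ae_eq_iff_negligible by (auto elim!: negligible_subset)
  moreover have "YR l c y pi = YL l c y pi"
    using A[of pi] B[of pi] c(2) unfolding A_def B_def by simp
  ultimately show ?thesis using that yL2 by blast
qed

lemma op_minus_if:
  assumes y: "y \<in> L2" and u: "ae_eq u (glue (YR l c y) (YL l c y))" and bc: "YR l c y pi = YL l c y pi"
  shows "(u, y) \<in> op_minus (L_per \<epsilon> f) l"
proof -
  note cY = YR_YL_continuous[OF y, of l c]
  have cG: "continuous_on {-pi..pi} (glue (YR l c y) (YL l c y))"
    by (rule continuous_on_glue[OF cY]) (simp add: YR_YL_0[OF y])
  have uL2: "u \<in> L2" by (rule L2_ae_continuous(1)[OF cG u])
  define w where "w x = y x + l * u x" for x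
  have w: "w \<in> L2" unfolding w_def by (rule L2_add_cmult[OF y uL2])
  have R: "c + K (gR w) x = YR l c y x" and L: "c + K (gL w) x = YL l c y x" if "0 \<le> x" "x \<le> pi" for x
    using K_gR_gL_shift[OF y L2_half_continuous[OF cY(1)] L2_half_continuous[OF cY(2)] u that(2), of l]
      YR_YL_equation[OF y that, of l c] unfolding w_def[abs_def] by simp_all
  have "glue (\<lambda>x. c + K (gR w) x) (\<lambda>x. c + K (gL w) x) x = glue (YR l c y) (YL l c y) x" if "x \<in> per_interval" for x
    using R[of x] L[of "- x"] that unfolding glue_def by auto
  then have "ae_eq u (glue (\<lambda>x. c + K (gR w) x) (\<lambda>x. c + K (gL w) x))"
    using u unfolding ae_eq_iff_negligible by (auto elim!: negligible_subset)
  moreover have "K (gR w) pi = K (gL w) pi"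
    using R[OF pi_ge_zero order_refl] L[OF pi_ge_zero order_refl] bc by (metis add_left_cancel)
  ultimately have "(u, w) \<in> L_per \<epsilon> f" by (rule L_per_if[OF w])
  moreover have "y = (\<lambda>x. w x - l * u x)" unfolding w_def by simp
  ultimately show ?thesis unfolding op_minus_def by blast
qed

text \<open>The value \<open>c\<close> at 0 is the only free constant, and periodicity is one scalar
  linear equation for it with coefficient \<open>\<Delta> l\<close>.\<close>

lemma YR_YL_pi: "YR l c y pi = YL l c y pi \<longleftrightarrow> c * \<Delta> l = S (\<i> * l) (K (gL y)) pi - S (- \<i> * l) (K (gR y)) pi"
  unfolding YR_def YL_def \<Delta>_def by (auto simp: algebra_simps)

text \<open>If \<open>\<Delta> l\<close> is nonzero, the matching equation determines
  \<open>c = C y\<close>, so every y has exactly one preimage up to null sets. The bound holds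
  because \<open>C y\<close> and both particular solutions are controlled in the sup norm by the L2
  norm of y.\<close>

lemma resolvent_set_if:
  assumes D: "\<Delta> l \<noteq> 0"
  shows "l \<in> resolvent_set (L_per \<epsilon> f)"
proof -
  define C where "C y = (S (\<i> * l) (K (gL y)) pi - S (- \<i> * l) (K (gR y)) pi) / \<Delta> l" for y
  have bc: "YR l c y pi = YL l c y pi \<longleftrightarrow> c = C y" for c y
    unfolding YR_YL_pi C_def using D by (auto simp: field_simps)
  have op: "(u, y) \<in> op_minus (L_per \<epsilon> f) l \<longleftrightarrow> y \<in> L2 \<and> ae_eq u (glue (YR l (C y) y) (YL l (C y) y))" for u y
  proof
    assume "(u, y) \<in> op_minus (L_per \<epsilon> f) l"
    then obtain c where c: "y \<in> L2" "ae_eq u (glue (YR l c y) (YL l c y))" "YR l c y pi = YL l c y pi"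
      using op_minus_imp by blast
    moreover have "c = C y" using c(3) bc by blast
    ultimately show "y \<in> L2 \<and> ae_eq u (glue (YR l (C y) y) (YL l (C y) y))" by simp
  next
    assume "y \<in> L2 \<and> ae_eq u (glue (YR l (C y) y) (YL l (C y) y))"
    then show "(u, y) \<in> op_minus (L_per \<epsilon> f) l" using op_minus_if bc by blast
  qed
  define k where "k = KC * hw_int pi"
  have k: "k \<ge> 0" unfolding k_def using KC_properties(1) hw_int_nonneg[of pi] by simp
  define E where "E = exp (cmod l * KM)"
  have E: "E > 0" unfolding E_def by simp
  \<comment> \<open>The first summand bounds \<open>C y\<close> times the homogeneous solution, the
    second the particular solution; \<open>E\<close> bounds \<phi> and the amplification by
    \<open>S\<close>.\<close>
  define M where "M = 2 * k * E / cmod (\<Delta> l) * E + k * E"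
  have M0: "M \<ge> 0" unfolding M_def using k E by simp
  have bound: "norm_L2 u \<le> sqrt (2 * pi) * (M * norm_L2 y)" if "(u, y) \<in> op_minus (L_per \<epsilon> f) l" for u y
  proof -
    have y: "y \<in> L2" and u: "ae_eq u (glue (YR l (C y) y) (YL l (C y) y))" using that op by auto
    have n: "norm_half (gR y) \<le> norm_L2 y" "norm_half (gL y) \<le> norm_L2 y"
      using L2_half_reflect_L2(3,4)[OF y] unfolding gR_def gL_def norm_half_def by (simp_all add: norm_mult)
    note gR = L2_half_gR[OF y] and gL = L2_half_gL[OF y]
    have "cmod (K (gR y) x) \<le> k * norm_L2 y" "cmod (K (gL y) x) \<le> k * norm_L2 y" if x: "0 \<le> x" "x \<le> pi" for x
      using K_bound_L2[OF gR x] K_bound_L2[OF gL x] mult_left_mono[OF n(1) k] mult_left_mono[OF n(2) k]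
      unfolding k_def by (simp_all add: mult_ac)
    then have Sb: "cmod (S (- \<i> * l) (K (gR y)) x) \<le> k * norm_L2 y * E" "cmod (S (\<i> * l) (K (gL y)) x) \<le> k * norm_L2 y * E"
      if x: "0 \<le> x" "x \<le> pi" for x
      using S_bound[OF K_continuous[OF gR] _ _ x, of "k * norm_L2 y" "- \<i> * l"]
        S_bound[OF K_continuous[OF gL] _ _ x, of "k * norm_L2 y" "\<i> * l"] k norm_L2_nonneg[of y]
      unfolding E_def by (simp_all add: norm_mult)
    have \<phi>b: "cmod (\<phi> (- \<i> * l) x) \<le> E" "cmod (\<phi> (\<i> * l) x) \<le> E" if x: "0 \<le> x" "x \<le> pi" for x
      using S_bound[OF continuous_on_const _ _ x, of 1 1 "- \<i> * l"] S_bound[OF continuous_on_const _ _ x, of 1 1 "\<i> * l"]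
      unfolding E_def \<phi>_def by (simp_all add: norm_mult)
    have "cmod (C y) \<le> (k * norm_L2 y * E + k * norm_L2 y * E) / cmod (\<Delta> l)"
      unfolding C_def norm_divide
    proof (rule divide_right_mono)
      show "cmod (S (\<i> * l) (K (gL y)) pi - S (- \<i> * l) (K (gR y)) pi) \<le> k * norm_L2 y * E + k * norm_L2 y * E"
        using Sb[OF pi_ge_zero order_refl] norm_triangle_ineq4[of "S (\<i> * l) (K (gL y)) pi" "S (- \<i> * l) (K (gR y)) pi"]
        by linarith
    qed simp
    then have Cb: "cmod (C y) \<le> 2 * k * E / cmod (\<Delta> l) * norm_L2 y" by (simp add: field_simps)
    have CE: "cmod (C y) * a + b \<le> M * norm_L2 y" if "a \<le> E" "0 \<le> a" "b \<le> k * norm_L2 y * E" for a b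
    proof -
      have "cmod (C y) * a \<le> 2 * k * E / cmod (\<Delta> l) * norm_L2 y * E"
        using Cb that k E norm_L2_nonneg[of y] by (intro mult_mono) auto
      then show ?thesis using that(3) unfolding M_def by (simp add: algebra_simps)
    qed
    have "cmod (glue (YR l (C y) y) (YL l (C y) y) x) \<le> M * norm_L2 y" if x: "-pi < x" "x < pi" for x
    proof (cases "0 \<le> x")
      case True
      then show ?thesis
        unfolding glue_def YR_def using x \<phi>b(1)[of x] Sb(1)[of x] CE[of "cmod (\<phi> (- \<i> * l) x)" "cmod (S (- \<i> * l) (K (gR y)) x)"]
          norm_triangle_ineq[of "C y * \<phi> (- \<i> * l) x" "S (- \<i> * l) (K (gR y)) x"] by (simp add: norm_mult)
    next
      case False
      then show ?thesis
        unfolding glue_def YL_def using x \<phi>b(2)[of "- x"] Sb(2)[of "- x"] CE[of "cmod (\<phi> (\<i> * l) (- x))" "cmod (S (\<i> * l) (K (gL y)) (- x))"]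
          norm_triangle_ineq[of "C y * \<phi> (\<i> * l) (- x)" "S (\<i> * l) (K (gL y)) (- x)"] by (simp add: norm_mult)
    qed
    then show ?thesis
      using M0 norm_L2_nonneg[of y]
      by (intro L2_ae_continuous(2)[OF continuous_on_glue[OF YR_YL_continuous[OF y, of l "C y"]] u]) (auto simp: YR_YL_0[OF y])
  qed
  show ?thesis
    unfolding resolvent_set_def
  proof (intro CollectI conjI)
    show "\<forall>w\<in>L2. \<exists>u. (u, w) \<in> op_minus (L_per \<epsilon> f) l"
    proof
      fix w assume "w \<in> L2"
      then have "(glue (YR l (C w) w) (YL l (C w) w), w) \<in> op_minus (L_per \<epsilon> f) l"
        unfolding op by (simp add: ae_eq_def)
      then show "\<exists>u. (u, w) \<in> op_minus (L_per \<epsilon> f) l" by blast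
    qed
    show "\<forall>u v w. (u, w) \<in> op_minus (L_per \<epsilon> f) l \<and> (v, w) \<in> op_minus (L_per \<epsilon> f) l \<longrightarrow> ae_eq u v"
      unfolding op using ae_eq_trans ae_eq_sym by blast
    show "\<exists>C. \<forall>u w. (u, w) \<in> op_minus (L_per \<epsilon> f) l \<longrightarrow> norm_L2 u \<le> C * norm_L2 w"
      using bound by (intro exI[of _ "sqrt (2 * pi) * M"]) (auto simp: mult.assoc)
  qed
qed

section \<open>Eigenfunctions and root spaces\<close>

definition eigfun :: "complex \<Rightarrow> real \<Rightarrow> complex" where
  "eigfun l = glue (\<phi> (- \<i> * l)) (\<phi> (\<i> * l))"

lemma zero_in_L2: "(\<lambda>x. 0) \<in> L2"
  unfolding L2_def by simp

text \<open>For data proportional to the eigenfunction the particular solutions are multiples of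
  \<eta>, the linearized solution: this is one step up a Jordan chain. The case d = 0 gives the
  homogeneous equation.\<close>

lemma S_K_gR_gL:
  assumes y: "ae_eq y (\<lambda>x. d * eigfun l x)"
  shows "0 \<le> x \<Longrightarrow> x \<le> pi \<Longrightarrow> S (- \<i> * l) (K (gR y)) x = - \<i> * d * \<eta> (- \<i> * l) x"
    and "0 \<le> x \<Longrightarrow> x \<le> pi \<Longrightarrow> S (\<i> * l) (K (gL y)) x = \<i> * d * \<eta> (\<i> * l) x"
proof -
  have "(\<lambda>x. d * eigfun l x) = glue (\<lambda>x. d * \<phi> (- \<i> * l) x) (\<lambda>x. d * \<phi> (\<i> * l) x)"
    unfolding eigfun_def glue_def by auto
  then obtain N where N: "negligible N" "\<And>x. x \<in> {0..pi} - N \<Longrightarrow> y x = d * \<phi> (- \<i> * l) x"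
    "\<And>x. x \<in> {0..pi} - N \<Longrightarrow> y (- x) = d * \<phi> (\<i> * l) x"
    using glue_ae_half y by metis
  have R: "K (gR y) x = - \<i> * d * K (\<phi> (- \<i> * l)) x" if "x \<le> pi" for x
    unfolding K_cmult[symmetric] by (rule K_cong[OF N(1) _ that]) (use N(2) in \<open>simp add: gR_def\<close>)
  have L: "K (gL y) x = \<i> * d * K (\<phi> (\<i> * l)) x" if "x \<le> pi" for x
    unfolding K_cmult[symmetric] by (rule K_cong[OF N(1) _ that]) (use N(3) in \<open>simp add: gL_def\<close>)
  assume x: "0 \<le> x" "x \<le> pi"
  have c: "continuous_on {0..pi} (\<lambda>x. a * K (\<phi> z) x)" for a z
    by (intro continuous_intros K\<phi>_continuous)
  have "S (- \<i> * l) (K (gR y)) x = S (- \<i> * l) (\<lambda>x. (- \<i> * d) * K (\<phi> (- \<i> * l)) x) x"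
    by (rule S_cong[OF c _ x]) (rule R)
  then show "S (- \<i> * l) (K (gR y)) x = - \<i> * d * \<eta> (- \<i> * l) x"
    unfolding S_cmult[OF K\<phi>_continuous x] \<eta>_def .
  have "S (\<i> * l) (K (gL y)) x = S (\<i> * l) (\<lambda>x. (\<i> * d) * K (\<phi> (\<i> * l)) x) x"
    by (rule S_cong[OF c _ x]) (rule L)
  then show "S (\<i> * l) (K (gL y)) x = \<i> * d * \<eta> (\<i> * l) x"
    unfolding S_cmult[OF K\<phi>_continuous x] \<eta>_def .
qed

lemma YR_YL_eigfun:
  assumes y: "ae_eq y (\<lambda>x. 0)"
  shows "x \<in> per_interval \<Longrightarrow> glue (YR l c y) (YL l c y) x = c * eigfun l x"
  using S_K_gR_gL[of y 0 l x] S_K_gR_gL[of y 0 l "- x"] y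
  unfolding glue_def YR_def YL_def eigfun_def by auto

text \<open>For zero data and \<open>\<Delta> l = 0\<close> the matching equation holds for every
  constant, in particular for 1. The eigenfunction is continuous with value 1 at 0, so it is not a
  null function.\<close>

lemma eigenvalue_if:
  assumes D: "\<Delta> l = 0"
  shows "(eigfun l, \<lambda>x. 0) \<in> op_minus (L_per \<epsilon> f) l" "\<not> ae_eq (eigfun l) (\<lambda>x. 0)"
proof -
  have z: "ae_eq (\<lambda>x. 0) (\<lambda>x. 0 * eigfun l x)" unfolding ae_eq_def by simp
  show "(eigfun l, \<lambda>x. 0) \<in> op_minus (L_per \<epsilon> f) l"
  proof (rule op_minus_if[OF zero_in_L2, where c=1])
    show "ae_eq (eigfun l) (glue (YR l 1 (\<lambda>x. 0)) (YL l 1 (\<lambda>x. 0)))"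
      unfolding ae_eq_iff_negligible using YR_YL_eigfun[of "\<lambda>x. 0" _ l 1] by (simp add: ae_eq_def cong: conj_cong)
    show "YR l 1 (\<lambda>x. 0) pi = YL l 1 (\<lambda>x. 0) pi"
      unfolding YR_YL_pi using D S_K_gR_gL[OF z, of pi] by simp
  qed
  show "\<not> ae_eq (eigfun l) (\<lambda>x. 0)"
  proof
    assume e: "ae_eq (eigfun l) (\<lambda>x. 0)"
    have "continuous_on {-pi..pi} (eigfun l)"
      unfolding eigfun_def by (rule continuous_on_glue[OF \<phi>_continuous \<phi>_continuous]) (simp add: \<phi>_0)
    then have "continuous_on per_interval (eigfun l)" by (rule continuous_on_subset) auto
    from ae_eq_continuous_imp_eq[OF this continuous_on_const e, of 0] show False
      using pi_gt_zero by (simp add: eigfun_def glue_def \<phi>_0)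
  qed
qed

text \<open>The parameter z = - \<i> l has real part Im l, and for Re z \<noteq> 0 the two values at
  pi differ.\<close>

lemma \<Delta>_zero_imp_real:
  assumes "\<Delta> l = 0"
  shows "Im l = 0"
  using \<phi>_minus_neq[of "- \<i> * l"] assms unfolding \<Delta>_def by auto

text \<open>For a Jordan chain \<open>u \<mapsto> d e \<mapsto> 0\<close> with \<open>e\<close> the eigenfunction, the periodicity of \<open>u\<close> reads
  \<open>d (\<eta> (- \<i> l) \<pi> + \<eta> (\<i> l) \<pi>) = 0\<close>, so that \<open>d = 0\<close>.\<close>

lemma root_space_eigfun:
  assumes D: "\<Delta> l = 0" and u: "u \<in> root_space (L_per \<epsilon> f) l"
  shows "\<exists>c. ae_eq u (\<lambda>x. c * eigfun l x)"
proof -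
  obtain k where "(u, \<lambda>x. 0) \<in> op_minus (L_per \<epsilon> f) l ^^ k" using u unfolding root_space_def by blast
  then show ?thesis
  proof (induction k arbitrary: u)
    case 0
    \<comment> \<open>The zeroth power of a relation is the identity, so here u is literally the
      zero function.\<close>
    then show ?case by (intro exI[of _ 0]) (simp add: ae_eq_def)
  next
    case (Suc k)
    then obtain y where y: "(u, y) \<in> op_minus (L_per \<epsilon> f) l" "(y, \<lambda>x. 0) \<in> op_minus (L_per \<epsilon> f) l ^^ k"
      by (meson relpow_Suc_D2)
    obtain d where d: "ae_eq y (\<lambda>x. d * eigfun l x)" using Suc.IH[OF y(2)] by blast
    obtain c where c: "y \<in> L2" "ae_eq u (glue (YR l c y) (YL l c y))" "YR l c y pi = YL l c y pi"
      using op_minus_imp[OF y(1)] by blast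
    have "\<i> * d * (\<eta> (- \<i> * l) pi + \<eta> (\<i> * l) pi) = 0"
      using c(3) S_K_gR_gL[OF d, of pi] unfolding YR_YL_pi D by (simp add: algebra_simps)
    moreover have "\<eta> (- \<i> * l) pi + \<eta> (\<i> * l) pi \<noteq> 0"
      using \<eta>_sum_neq_0[of "- \<i> * l"] \<Delta>_zero_imp_real[OF D] D unfolding \<Delta>_def by simp
    ultimately have "d = 0" by simp
    then have "ae_eq y (\<lambda>x. 0)" using d by simp
    then have "ae_eq u (\<lambda>x. c * eigfun l x)"
      using c(2) YR_YL_eigfun[of y _ l c] unfolding ae_eq_iff_negligible by (simp cong: conj_cong)
    then show ?case by blast
  qed
qed

text \<open>A limit point of zeros would make the entire function \<Delta> vanish identically, also
  at the non-real point \<i>.\<close>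

lemma \<Delta>_zeros_no_limit_point: "\<not> z islimpt {l. \<Delta> l = 0}"
proof
  assume z: "z islimpt {l. \<Delta> l = 0}"
  have "\<Delta> holomorphic_on UNIV"
  proof -
    have "(\<lambda>z. \<phi> z pi) \<circ> (\<lambda>l. - \<i> * l) holomorphic_on UNIV" "(\<lambda>z. \<phi> z pi) \<circ> (\<lambda>l. \<i> * l) holomorphic_on UNIV"
      by (rule holomorphic_on_compose; auto intro!: holomorphic_intros holomorphic_on_subset[OF \<phi>_entire])+
    then have "(\<lambda>l. ((\<lambda>z. \<phi> z pi) \<circ> (\<lambda>l. - \<i> * l)) l - ((\<lambda>z. \<phi> z pi) \<circ> (\<lambda>l. \<i> * l)) l) holomorphic_on UNIV"
      by (rule holomorphic_on_diff)
    then show ?thesis unfolding \<Delta>_def[abs_def] comp_def .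
  qed
  then have "\<Delta> \<i> = 0"
    by (rule analytic_continuation[of _ UNIV "{l. \<Delta> l = 0}" z]) (use z in auto)
  then show False using \<Delta>_zero_imp_real[of \<i>] by simp
qed

text \<open>The spectrum lies in the zero set of \<Delta>, so it is real and has no limit point, and
  hence each of its points is isolated. At each zero the root space is spanned by the single
  function \<open>eigfun l\<close>.\<close>

lemma spectrum_real_discrete:
  "spectrum_of (L_per \<epsilon> f) \<subseteq> \<real> \<and> purely_discrete_spectrum (L_per \<epsilon> f)"
proof -
  have sub: "spectrum_of (L_per \<epsilon> f) \<subseteq> {l. \<Delta> l = 0}"
    unfolding spectrum_of_def using resolvent_set_if by blast
  have lim: "\<not> z islimpt spectrum_of (L_per \<epsilon> f)" for z
    using \<Delta>_zeros_no_limit_point[of z] islimpt_subset[OF _ sub] by blast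
  have "finite_dim_ae (root_space (L_per \<epsilon> f) l)" if D: "\<Delta> l = 0" for l
    unfolding finite_dim_ae_def
  proof (intro exI[of _ "{eigfun l}"] conjI ballI)
    show "{eigfun l} \<subseteq> root_space (L_per \<epsilon> f) l"
      unfolding root_space_def using eigenvalue_if(1)[OF D] by (auto intro!: exI[of _ 1])
    show "\<exists>c. ae_eq u (\<lambda>x. \<Sum>b\<in>{eigfun l}. c b * b x)" if u: "u \<in> root_space (L_per \<epsilon> f) l" for u
    proof -
      obtain c where "ae_eq u (\<lambda>x. c * eigfun l x)" using root_space_eigfun[OF D u] by blast
      then show ?thesis by (intro exI[of _ "\<lambda>_. c"]) simp
    qed
  qed simp
  moreover have "is_eigenvalue (L_per \<epsilon> f) l" if "\<Delta> l = 0" for l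
    unfolding is_eigenvalue_def using eigenvalue_if[OF that] by blast
  ultimately have "purely_discrete_spectrum (L_per \<epsilon> f)"
    unfolding purely_discrete_spectrum_def isolated_in_islimpt_iff using lim sub by blast
  moreover have "spectrum_of (L_per \<epsilon> f) \<subseteq> \<real>"
    using sub \<Delta>_zero_imp_real by (auto simp: complex_is_Real_iff)
  ultimately show ?thesis by blast
qed

end

theorem theorem2:
  fixes \<epsilon> :: real and f :: "real \<Rightarrow> real"
  assumes "0 < \<epsilon>" and "\<epsilon> < pi"
    and "\<And>x. f (x + 2 * pi) = f x"
    and "\<And>x. f (x + pi) = - f x"
    and "\<And>x. f (- x) = - f x"
    and "\<And>x. x \<in> {0<..<pi} \<Longrightarrow> f x > 0"
    and "continuous_on UNIV f"
    and "finite {x \<in> {-pi..pi}. \<not> f differentiable (at x)}"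
    and "\<And>k::int. f differentiable (at (of_int k * pi))"
    and "(f has_real_derivative 2 / pi) (at 0)"
  shows "spectrum_of (L_per \<epsilon> f) \<subseteq> \<real> \<and> purely_discrete_spectrum (L_per \<epsilon> f)"
proof -
  have "f (pi - x) = f x" for x
    using assms(4)[of "- x"] assms(5)[of x] by simp
  then interpret singular_ode \<epsilon> f
    using assms(1,2,5-7,10) by unfold_locales auto
  show ?thesis by (rule spectrum_real_discrete)
qed

end
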